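(* Let $N\ge1$, $0<b<\min\{N,4\}$, $0<\sigma<4^*$ and $1<p<\frac{(2\sigma+2)N}{N-b}$. Then the embedding $$\dot H^2(\mathbb R^N)\cap L^p(\mathbb R^N)\hookrightarrow L^{2\sigma+2}_b(\mathbb R^N)$$ is compact.
   Context: $4^*=\frac{4-b}{N-4}$ if $N\ge5$ and $4^*=\infty$ if $N\in\{1,2,3,4\}$. $\dot H^2\cap L^p$ is the space of $f\in L^p(\mathbb R^N)$ whose weak derivatives of order two are in $L^2(\mathbb R^N)$, with norm $\|\Delta f\|_{L^2}+\|f\|_{L^p}$. For $1\le q<\infty$, $L^q_b(\mathbb R^N)=L^q(\mathbb R^N,|x|^{-b}dx)$ is the space of measurable $u$ with $\|u\|_{L^q_b}=\left(\int_{\mathbb R^N}|x|^{-b}|u|^q\,dx\right)^{1/q}<\infty$. *)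

theory Defs
  imports "HOL-Analysis.Analysis"
begin

text \<open>
  Functions on \<open>R^N\<close> are complex-valued and \<open>N\<close> is \<open>CARD('n)\<close>. Elements of Lebesgue spaces are
  represented by functions rather than by equivalence classes modulo null sets, so the norms below
  are seminorms on these sets of representatives, vanishing exactly on the class of 0.
\<close>

definition Lp_space :: "real \<Rightarrow> 'a measure \<Rightarrow> ('a \<Rightarrow> complex) set" where
  "Lp_space p M = {f \<in> borel_measurable M. integrable M (\<lambda>x. norm (f x) powr p)}"

definition Lp_norm :: "real \<Rightarrow> 'a measure \<Rightarrow> ('a \<Rightarrow> complex) \<Rightarrow> real" where
  "Lp_norm p M f = (\<integral>x. norm (f x) powr p \<partial>M) powr (1 / p)"

text \<open>The measure \<open>|x|^{-b} dx\<close>; the value \<open>0 powr (-b) = 0\<close> at the origin concerns a null set only.\<close>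

definition weighted_lebesgue :: "real \<Rightarrow> (real ^ 'n) measure" where
  "weighted_lebesgue b = density lebesgue (\<lambda>x. ennreal (norm x powr (- b)))"

definition partial_deriv :: "'n \<Rightarrow> (real ^ 'n \<Rightarrow> real) \<Rightarrow> real ^ 'n \<Rightarrow> real" where
  "partial_deriv i f x = frechet_derivative f (at x) (axis i 1)"

primrec C_k :: "nat \<Rightarrow> (real ^ 'n \<Rightarrow> real) \<Rightarrow> bool" where
  "C_k 0 f \<longleftrightarrow> continuous_on UNIV f"
| "C_k (Suc k) f \<longleftrightarrow> (\<forall>x. f differentiable (at x)) \<and> (\<forall>i. C_k k (partial_deriv i f))"

definition test_function :: "(real ^ 'n \<Rightarrow> real) \<Rightarrow> bool" where
  "test_function \<phi> \<longleftrightarrow> (\<forall>k. C_k k \<phi>) \<and> compact (closure {x. \<phi> x \<noteq> 0})"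

definition locally_integrable :: "(real ^ 'n \<Rightarrow> complex) \<Rightarrow> bool" where
  "locally_integrable f \<longleftrightarrow> (\<forall>K. compact K \<longrightarrow> f absolutely_integrable_on K)"

text \<open>Two integrations by parts, hence no sign. Real test functions suffice by linearity.\<close>

definition has_weak_deriv2 ::
    "'n \<Rightarrow> 'n \<Rightarrow> (real ^ 'n \<Rightarrow> complex) \<Rightarrow> (real ^ 'n \<Rightarrow> complex) \<Rightarrow> bool" where
  "has_weak_deriv2 i j f g \<longleftrightarrow> locally_integrable f \<and> locally_integrable g \<and>
     (\<forall>\<phi>. test_function \<phi> \<longrightarrow>
        (\<integral>x. partial_deriv i (partial_deriv j \<phi>) x *\<^sub>R f x \<partial>lebesgue) =
        (\<integral>x. \<phi> x *\<^sub>R g x \<partial>lebesgue))"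

text \<open>A representative of the weak derivative, which is unique up to a null set when it exists.\<close>

definition weak_deriv2 ::
    "'n \<Rightarrow> 'n \<Rightarrow> (real ^ 'n \<Rightarrow> complex) \<Rightarrow> real ^ 'n \<Rightarrow> complex" where
  "weak_deriv2 i j f = (SOME g. has_weak_deriv2 i j f g)"

definition weak_laplacian :: "(real ^ 'n \<Rightarrow> complex) \<Rightarrow> real ^ 'n \<Rightarrow> complex" where
  "weak_laplacian f x = (\<Sum>i\<in>UNIV. weak_deriv2 i i f x)"

definition H2dot_Lp :: "real \<Rightarrow> (real ^ 'n \<Rightarrow> complex) set" where
  "H2dot_Lp p = {f \<in> Lp_space p lebesgue.
     \<forall>i j. \<exists>g. has_weak_deriv2 i j f g \<and> g \<in> Lp_space 2 lebesgue}"

definition H2dot_Lp_norm :: "real \<Rightarrow> (real ^ 'n \<Rightarrow> complex) \<Rightarrow> real" where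
  "H2dot_Lp_norm p f = Lp_norm 2 lebesgue (weak_laplacian f) + Lp_norm p lebesgue f"

text \<open>
  The inclusion \<open>X \<subseteq> Y\<close> is bounded, and every bounded sequence in \<open>X\<close> has a subsequence
  converging in \<open>Y\<close>.
\<close>

definition compact_embedding ::
    "('a \<Rightarrow> complex) set \<Rightarrow> (('a \<Rightarrow> complex) \<Rightarrow> real) \<Rightarrow>
     ('a \<Rightarrow> complex) set \<Rightarrow> (('a \<Rightarrow> complex) \<Rightarrow> real) \<Rightarrow> bool" where
  "compact_embedding X norm_X Y norm_Y \<longleftrightarrow>
     X \<subseteq> Y \<and>
     (\<exists>C. \<forall>f\<in>X. norm_Y f \<le> C * norm_X f) \<and>
     (\<forall>u :: nat \<Rightarrow> 'a \<Rightarrow> complex.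
        (\<forall>n. u n \<in> X) \<and> (\<exists>B. \<forall>n. norm_X (u n) \<le> B) \<longrightarrow>
        (\<exists>r v. strict_mono r \<and> v \<in> Y \<and> (\<lambda>k. norm_Y (\<lambda>x. u (r k) x - v x)) \<longlonglongrightarrow> 0))"

definition four_star :: "nat \<Rightarrow> real \<Rightarrow> ereal" where
  "four_star N b = (if N \<ge> 5 then ereal ((4 - b) / (real N - 4)) else \<infinity>)"

end

theory Submission
  imports Defs "HOL-Complex_Analysis.Great_Picard" "HOL-Library.Diagonal_Subsequence"
begin

text \<open>
  Write \<open>q = 2\<sigma> + 2\<close> and \<open>N = CARD('n)\<close>. There are test functions \<open>\<phi>\<close>, \<open>W\<close>, both radial, with
  \<open>\<integral>\<phi> = 1\<close> and \<open>\<Delta>W = \<phi> - 2\<^sup>N \<phi>(2 \<cdot>)\<close>: a fundamental solution of the Laplacian, smoothed near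
  the origin, minus its rescaling by 2. Writing \<open>\<phi>\<^sub>t = t\<^sup>N \<phi>(t \<cdot>)\<close>, this gives
  \<open>\<phi>\<^sub>t * f - \<phi>\<^sub>2\<^sub>t * f = t\<^sup>-\<^sup>2 W\<^sub>t * \<Delta>f\<close>, hence
  \<open>f = \<phi>\<^sub>t * f - \<Sum>\<^sub>k (2\<^sup>k t)\<^sup>-\<^sup>2 W\<^bsub>2^k t\<^esub> * \<Delta>f\<close>. Averaging over balls of radius \<open>2/t\<close> bounds
  \<open>t\<^sup>-\<^sup>2 W\<^sub>t * \<Delta>f\<close> in the weighted norm by a negative power of \<open>t\<close> times \<open>\<parallel>\<Delta>f\<parallel>\<^sub>2\<close> exactly when
  \<open>\<sigma> < 4\<^sup>*\<close>, so \<open>\<phi>\<^sub>t * f\<close> approximates \<open>f\<close> uniformly on bounded sets; neither Sobolev's inequality nor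
  the Fourier transform is needed. For fixed \<open>t\<close> the functions \<open>\<phi>\<^sub>t * f\<close> are uniformly bounded and
  equicontinuous, so they converge locally uniformly along a subsequence, and the condition on \<open>p\<close>
  makes their weighted norms over \<open>|x| \<ge> R\<close> uniformly small. A diagonal argument and the completeness
  of the weighted space conclude.
\<close>

section \<open>Smooth functions with prescribed support\<close>

text \<open>The obstacle is that \<open>H2dot_Lp\<close> controls f only through integration against
  test functions and gives no pointwise decay of f or of its Laplacian. Subtracting from the
  smoothed fundamental solution its own rescaling removes the tail at infinity, so that W is itself
  a test function. The telescoping identity is then, at each point and each scale, a single instance
  of the definition of weak derivative.

  The two hypotheses on the exponents enter separately. The one on \<sigma> is local: it makes
  positive the exponent 4 - b - \<sigma> (N - 4) that governs the decay in t. The one on p concerns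
  infinity: it leaves room for some s > max p q with s (N - b) < q N, and for such s the decay of
  |x|^(-b) suffices to bound the weighted tail by Hoelder's argument from an L^s bound on the
  mollified function.

  The estimates only show that the mollified functions converge to some limit. That this limit is f
  has to be proved, by testing against test functions under a locally integrable majorant.\<close>

definition bump :: "nat \<Rightarrow> real \<Rightarrow> real" where
  "bump k s = (if s > 0 then inverse s ^ k * exp (- inverse s) else 0)"

lemma bump_tendsto_0: "(bump k \<longlongrightarrow> 0) (at_right 0)"
proof -
  have "((\<lambda>x::real. x ^ k * exp (- x)) \<longlongrightarrow> 0) at_top"
    using tendsto_power_div_exp_0[of k] by (simp add: exp_minus divide_inverse)
  from filterlim_compose[OF this filterlim_inverse_at_top_right]
  have "((\<lambda>s::real. inverse s ^ k * exp (- inverse s)) \<longlongrightarrow> 0) (at_right 0)" .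
  moreover have "\<forall>\<^sub>F s in at_right 0. inverse s ^ k * exp (- inverse s) = bump k s"
    using eventually_at_right_less[of "0::real"] by eventually_elim (simp add: bump_def)
  ultimately show ?thesis
    by (rule Lim_transform_eventually)
qed

text \<open>The factor \<open>inverse s ^ k\<close> makes the family closed under differentiation,
  so that derivatives of every order are covered by one formula.\<close>

lemma bump_has_derivative:
  "(bump k has_real_derivative bump (k + 2) s - real k * bump (k + 1) s) (at s)"
proof -
  consider "s > 0" | "s < 0" | "s = 0" by linarith
  then show ?thesis
  proof cases
    case 1
    have "((\<lambda>s. inverse s ^ k * exp (- inverse s)) has_real_derivative
        bump (k + 2) s - real k * bump (k + 1) s) (at s)"
      using 1
      by (auto intro!: derivative_eq_intros simp: bump_def)
         (cases k; auto simp: field_simps power2_eq_square)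
    then show ?thesis
      by (rule has_field_derivative_transform_within_open[of _ _ _ "{0<..}"])
         (use 1 in \<open>auto simp: bump_def\<close>)
  next
    case 2
    have "(bump k has_real_derivative 0) (at s)"
      by (rule has_field_derivative_transform_within_open[where S="{..<0}", OF DERIV_const[of 0]])
         (use 2 in \<open>auto simp: bump_def\<close>)
    then show ?thesis using 2 by (simp add: bump_def)
  next
    \<comment> \<open>At 0 the right-hand difference quotient of \<open>bump k\<close> is
      \<open>bump (Suc k)\<close>, so the limit already known for every member of the family gives
      derivative 0.\<close>
    case 3
    have "\<forall>\<^sub>F h in at_right 0. bump (Suc k) h = bump k h / h"
      using eventually_at_right_less[of "0::real"]
      by eventually_elim (simp add: bump_def divide_inverse)
    with bump_tendsto_0 have "((\<lambda>h. bump k h / h) \<longlongrightarrow> 0) (at_right 0)"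
      by (rule Lim_transform_eventually)
    moreover have "((\<lambda>h. bump k h / h) \<longlongrightarrow> 0) (at_left 0)"
      by (rule tendsto_eventually) (auto simp: bump_def eventually_at_filter)
    ultimately have "((\<lambda>h. bump k h / h) \<longlongrightarrow> 0) (at 0)"
      by (simp add: filterlim_at_split)
    then show ?thesis using 3 by (simp add: DERIV_def bump_def)
  qed
qed

text \<open>
  Every rule preserves closure under differentiation, so all members are infinitely differentiable.
  In rule \<open>powr\<close> the factor \<open>h\<close> vanishes near the singularity of \<open>s powr a\<close>.
\<close>

inductive smooth1 :: "(real \<Rightarrow> real) \<Rightarrow> bool" where
  bump: "smooth1 (\<lambda>s. bump k (\<alpha> * s + \<beta>))"
| const: "smooth1 (\<lambda>_. c)"
| add: "smooth1 f \<Longrightarrow> smooth1 g \<Longrightarrow> smooth1 (\<lambda>s. f s + g s)"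
| mult: "smooth1 f \<Longrightarrow> smooth1 g \<Longrightarrow> smooth1 (\<lambda>s. f s * g s)"
| powr: "smooth1 h \<Longrightarrow> 0 < c \<Longrightarrow> (\<And>s. s < c \<Longrightarrow> h s = 0) \<Longrightarrow> smooth1 (\<lambda>s. s powr a * h s)"
| prim: "smooth1 g \<Longrightarrow> (\<And>s. (G has_real_derivative g s) (at s)) \<Longrightarrow> smooth1 G"
| scale: "smooth1 g \<Longrightarrow> smooth1 (\<lambda>s. g (c * s))"

lemma smooth1_cmult: "smooth1 f \<Longrightarrow> smooth1 (\<lambda>s. c * f s)"
  by (intro smooth1.mult smooth1.const)

lemma smooth1_diff: "smooth1 f \<Longrightarrow> smooth1 g \<Longrightarrow> smooth1 (\<lambda>s. f s - g s)"
  using smooth1.add[OF _ smooth1_cmult[of g "-1"]] by simp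

lemma deriv_zero_of_vanishing:
  fixes h :: "real \<Rightarrow> real"
  assumes "\<And>s. s < c \<Longrightarrow> h s = k" "(h has_real_derivative d) (at s)" "s < c"
  shows "d = 0"
proof -
  have "(h has_real_derivative 0) (at s)"
    by (rule has_field_derivative_transform_within_open[where S="{..<c}", OF DERIV_const[of k]])
       (use assms in auto)
  from DERIV_unique[OF assms(2) this] show ?thesis .
qed

lemma smooth1_derivative:
  assumes "smooth1 g"
  shows "\<exists>g'. smooth1 g' \<and> (\<forall>s. (g has_real_derivative g' s) (at s))"
  using assms
proof induction
  case (bump k \<alpha> \<beta>)
  have "((\<lambda>s. bump k (\<alpha> * s + \<beta>)) has_real_derivative
      \<alpha> * (bump (k + 2) (\<alpha> * s + \<beta>) - real k * bump (k + 1) (\<alpha> * s + \<beta>))) (at s)" for s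
  proof -
    have "((\<lambda>s. \<alpha> * s + \<beta>) has_real_derivative \<alpha>) (at s)"
      by (auto intro!: derivative_eq_intros)
    from DERIV_chain2[OF bump_has_derivative this] show ?thesis by (simp add: mult.commute)
  qed
  moreover have "smooth1 (\<lambda>s. \<alpha> * (bump (k + 2) (\<alpha> * s + \<beta>) - real k * bump (k + 1) (\<alpha> * s + \<beta>)))"
    by (intro smooth1_cmult smooth1_diff smooth1.bump)
  ultimately show ?case by blast
next
  case (const c)
  show ?case by (rule exI[of _ "\<lambda>_. 0"]) (auto intro: smooth1.const)
next
  case (add f g)
  then obtain f' g' where "smooth1 f'" "smooth1 g'"
    "\<forall>s. (f has_real_derivative f' s) (at s)" "\<forall>s. (g has_real_derivative g' s) (at s)" by auto
  then show ?case
    by (intro exI[of _ "\<lambda>s. f' s + g' s"]) (auto intro!: smooth1.add DERIV_add)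
next
  case (mult f g)
  then obtain f' g' where *: "smooth1 f'" "smooth1 g'"
    "\<And>s. (f has_real_derivative f' s) (at s)" "\<And>s. (g has_real_derivative g' s) (at s)" by auto
  then show ?case using mult.hyps
    by (intro exI[of _ "\<lambda>s. f' s * g s + g' s * f s"])
       (auto intro!: smooth1.add smooth1.mult DERIV_mult)
next
  case (powr h c a)
  then obtain h' where h': "smooth1 h'" "\<And>s. (h has_real_derivative h' s) (at s)" by auto
  have z: "h' s = 0" if "s < c" for s
    using deriv_zero_of_vanishing[of c h 0] powr.hyps(3) h'(2) that by blast
  \<comment> \<open>Below c the product is constantly 0; from c > 0 on, the power is differentiable.
    As h' vanishes below c too, both summands of the derivative are again of the form of rule
    \<open>powr\<close>.\<close>
  have "((\<lambda>s. s powr a * h s) has_real_derivative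
      a * (s powr (a - 1) * h s) + s powr a * h' s) (at s)" for s
  proof (cases "s < c")
    case True
    have "((\<lambda>s. s powr a * h s) has_real_derivative 0) (at s)"
      by (rule has_field_derivative_transform_within_open[where S="{..<c}", OF DERIV_const[of 0]])
         (use True powr.hyps in auto)
    then show ?thesis using True z powr.hyps by simp
  next
    case False
    then have "s > 0" using powr.hyps by linarith
    then show ?thesis
      using h' by (auto intro!: derivative_eq_intros simp: mult_ac)
  qed
  moreover have "smooth1 (\<lambda>s. a * (s powr (a - 1) * h s) + s powr a * h' s)"
    using powr.hyps h' z by (intro smooth1.add smooth1_cmult smooth1.powr[where c=c]) auto
  ultimately show ?case by blast
next
  case (prim g G)
  then show ?case by blast
next
  case (scale g c)
  then obtain g' where *: "smooth1 g'" "\<And>s. (g has_real_derivative g' s) (at s)" by auto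
  have "((\<lambda>s. g (c * s)) has_real_derivative c * g' (c * s)) (at s)" for s
  proof -
    have "((\<lambda>s. c * s) has_real_derivative c) (at s)"
      by (auto intro!: derivative_eq_intros)
    from DERIV_chain2[OF *(2) this] show ?thesis by (simp add: mult.commute)
  qed
  moreover have "smooth1 (\<lambda>s. c * g' (c * s))" using * by (intro smooth1_cmult smooth1.scale)
  ultimately show ?case by blast
qed

lemma smooth1_continuous: "smooth1 g \<Longrightarrow> continuous_on A g"
proof -
  assume "smooth1 g"
  then obtain g' where "\<And>s. (g has_real_derivative g' s) (at s)"
    using smooth1_derivative by blast
  then show ?thesis
    by (intro continuous_at_imp_continuous_on ballI DERIV_isCont)
qed

text \<open>Since g vanishes below a positive c, the integral from 0 is 0 there, also for negative
  s, where the interval is empty. The fundamental theorem of calculus is thus only applied at s >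
  0.\<close>

lemma smooth1_antiderivative:
  assumes "smooth1 g" "0 < c" "\<And>s. s < c \<Longrightarrow> g s = 0"
  defines "G \<equiv> \<lambda>s. integral {0..s} g"
  shows "(G has_real_derivative g s) (at s)" "smooth1 G" "s < c \<Longrightarrow> G s = 0"
proof -
  have 0: "G s = 0" if "s < c" for s
  proof -
    have "integral {0..s} g = integral {0..s} (\<lambda>_. 0)"
      using that assms(3) by (intro integral_cong) auto
    then show ?thesis by (simp add: G_def)
  qed
  then show "s < c \<Longrightarrow> G s = 0" .
  have *: "(G has_real_derivative g s) (at s)" for s
  proof (cases "s < c")
    case True
    have "(G has_real_derivative 0) (at s)"
      by (rule has_field_derivative_transform_within_open[where S="{..<c}", OF DERIV_const[of 0]])
         (use True 0 in auto)
    then show ?thesis using True assms by simp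
  next
    case False
    then have s: "s > 0" using assms by linarith
    have "(G has_real_derivative g s) (at s within {0..s+1})"
      unfolding G_def using s smooth1_continuous[OF assms(1)]
      by (intro integral_has_real_derivative) auto
    then show ?thesis using s at_within_Icc_at[of 0 s "s + 1"] by simp
  qed
  then show "(G has_real_derivative g s) (at s)" .
  show "smooth1 G" using smooth1.prim[OF assms(1) *] .
qed

section \<open>Smooth functions of several variables\<close>

inductive smoothn :: "(real ^ 'n \<Rightarrow> real) \<Rightarrow> bool" where
  coord: "smoothn (\<lambda>x. x $ i)"
| comp: "smooth1 g \<Longrightarrow> smoothn h \<Longrightarrow> smoothn (\<lambda>x. g (h x))"
| add: "smoothn f \<Longrightarrow> smoothn g \<Longrightarrow> smoothn (\<lambda>x. f x + g x)"
| mult: "smoothn f \<Longrightarrow> smoothn g \<Longrightarrow> smoothn (\<lambda>x. f x * g x)"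

lemma smoothn_const: "smoothn (\<lambda>_. c)"
  using smoothn.comp[OF smooth1.const smoothn.coord] .

lemma smoothn_sum: "finite I \<Longrightarrow> (\<And>i. i \<in> I \<Longrightarrow> smoothn (f i)) \<Longrightarrow> smoothn (\<lambda>x. \<Sum>i\<in>I. f i x)"
  by (induction I rule: finite_induct) (simp_all add: smoothn_const smoothn.add)

lemma smoothn_prod: "finite I \<Longrightarrow> (\<And>i. i \<in> I \<Longrightarrow> smoothn (f i)) \<Longrightarrow> smoothn (\<lambda>x. \<Prod>i\<in>I. f i x)"
  by (induction I rule: finite_induct) (simp_all add: smoothn_const smoothn.mult)

lemma partial_deriv_eq: "(f has_derivative f') (at x) \<Longrightarrow> partial_deriv i f x = f' (axis i 1)"
  by (simp add: partial_deriv_def frechet_derivative_at[symmetric])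

lemma smoothn_derivative:
  fixes f :: "real ^ 'n::finite \<Rightarrow> real"
  assumes "smoothn f"
  shows "(\<forall>x. f differentiable (at x)) \<and> (\<forall>i. smoothn (partial_deriv i f))"
  using assms
proof induction
  case (coord j)
  have d: "((\<lambda>x. x $ j) has_derivative (\<lambda>v. v $ j)) (at x)" for x :: "real ^ 'n"
    by (intro bounded_linear_imp_has_derivative bounded_linear_vec_nth)
  have "partial_deriv i (\<lambda>x. x $ j) = (\<lambda>_. if i = j then 1 else 0)" for i :: 'n
    using partial_deriv_eq[OF d] by (auto simp: axis_def)
  then show ?case using d by (auto simp: smoothn_const differentiable_def)
next
  case (comp g h)
  from smooth1_derivative[OF comp(1)] obtain g' where g': "smooth1 g'"
    "\<And>s. (g has_real_derivative g' s) (at s)" by auto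
  have d: "((\<lambda>x. g (h x)) has_derivative (\<lambda>v. g' (h x) * frechet_derivative h (at x) v)) (at x)" for x
  proof -
    have "(h has_derivative frechet_derivative h (at x)) (at x)"
      using comp.IH by (simp add: frechet_derivative_works[symmetric])
    from has_derivative_compose[of h _ x UNIV g "\<lambda>v. g' (h x) * v", OF this]
    show ?thesis using g'(2)[of "h x"] by (simp add: has_field_derivative_def)
  qed
  have "partial_deriv i (\<lambda>x. g (h x)) = (\<lambda>x. g' (h x) * partial_deriv i h x)" for i
    using partial_deriv_eq[OF d] by (auto simp: partial_deriv_def)
  moreover have "smoothn (\<lambda>x. g' (h x) * partial_deriv i h x)" for i
    using comp g' by (intro smoothn.mult smoothn.comp[of g' h]) auto
  ultimately show ?case using d unfolding differentiable_def by auto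
next
  case (add f g)
  have d: "((\<lambda>x. f x + g x) has_derivative
      (\<lambda>v. frechet_derivative f (at x) v + frechet_derivative g (at x) v)) (at x)" for x
    using add.IH by (intro has_derivative_add) (auto simp: frechet_derivative_works[symmetric])
  have "partial_deriv i (\<lambda>x. f x + g x) = (\<lambda>x. partial_deriv i f x + partial_deriv i g x)" for i
    using partial_deriv_eq[OF d] by (auto simp: partial_deriv_def)
  moreover have "smoothn (\<lambda>x. partial_deriv i f x + partial_deriv i g x)" for i
    using add by (intro smoothn.add) auto
  ultimately show ?case using d unfolding differentiable_def by auto
next
  case (mult f g)
  have d: "((\<lambda>x. f x * g x) has_derivative
      (\<lambda>v. f x * frechet_derivative g (at x) v + frechet_derivative f (at x) v * g x)) (at x)" for x
    using mult.IH by (intro has_derivative_mult) (auto simp: frechet_derivative_works[symmetric])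
  have "partial_deriv i (\<lambda>x. f x * g x) = (\<lambda>x. f x * partial_deriv i g x + partial_deriv i f x * g x)" for i
    using partial_deriv_eq[OF d] by (auto simp: partial_deriv_def)
  moreover have "smoothn (\<lambda>x. f x * partial_deriv i g x + partial_deriv i f x * g x)" for i
    using mult by (intro smoothn.add smoothn.mult) auto
  ultimately show ?case using d unfolding differentiable_def by auto
qed

text \<open>\<open>C_k\<close> recurses through all partial derivatives, so closure of
  \<open>smoothn\<close> under \<open>partial_deriv\<close> is exactly the induction step.\<close>

lemma smoothn_C_k: "smoothn f \<Longrightarrow> C_k k (f :: real ^ 'n::finite \<Rightarrow> real)"
proof (induction k arbitrary: f)
  case 0
  then show ?case
    using smoothn_derivative[of f] by (simp add: differentiable_imp_continuous_within continuous_on_eq_continuous_at)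
next
  case (Suc k)
  then show ?case using smoothn_derivative[of f] by simp
qed

lemma smoothn_test_function:
  fixes f :: "real ^ 'n::finite \<Rightarrow> real"
  assumes "smoothn f" "bounded {x. f x \<noteq> 0}"
  shows "test_function f"
  unfolding test_function_def using assms by (simp add: smoothn_C_k)

lemma smoothn_radial:
  fixes y :: "real ^ 'n::finite"
  assumes "smooth1 g"
  shows "smoothn (\<lambda>x. g (c * ((x - y) \<bullet> (x - y))))"
proof -
  have "smoothn (\<lambda>x. x $ i + - (y $ i))" for i :: 'n
    by (intro smoothn.add smoothn.coord smoothn_const)
  then have "smoothn (\<lambda>x. \<Sum>i\<in>UNIV. (x $ i + - (y $ i)) * (x $ i + - (y $ i)))"
    by (intro smoothn_sum smoothn.mult) auto
  then have "smoothn (\<lambda>x. (x - y) \<bullet> (x - y))"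
    by (simp add: inner_vec_def)
  then show ?thesis by (intro smoothn.comp[OF smooth1.scale[OF assms]])
qed

section \<open>Radial profiles of the mollifier and of the smoothed fundamental solution\<close>

lemma DERIV_zero_imp_const_beyond:
  fixes G :: "real \<Rightarrow> real"
  assumes "\<And>s. (G has_real_derivative g s) (at s)" "\<And>s. a \<le> s \<Longrightarrow> g s = 0" "a \<le> s"
  shows "G s = G a"
proof (cases "a = s")
  case False
  then have "a < s" using assms by simp
  show ?thesis
  proof (rule DERIV_isconst_end[OF \<open>a < s\<close>])
    show "continuous_on {a..s} G"
      using assms(1) by (intro continuous_at_imp_continuous_on ballI DERIV_isCont)
    show "(G has_real_derivative 0) (at x)" if "a < x" "x < s" for x
      using assms(1)[of x] assms(2)[of x] that by simp
  qed
qed auto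

text \<open>The derivative is carried along because the mollifier profile is a power of s times F';
  strict positivity on (1, 2) later makes its integral nonzero.\<close>

definition smooth_step :: "(real \<Rightarrow> real) \<Rightarrow> (real \<Rightarrow> real) \<Rightarrow> bool" where
  "smooth_step F F' \<longleftrightarrow> smooth1 F \<and> smooth1 F' \<and> (\<forall>s. (F has_real_derivative F' s) (at s)) \<and>
    (\<forall>s\<le>1. F s = 0) \<and> (\<forall>s\<ge>2. F s = 1) \<and> (\<forall>s. 0 \<le> F s \<and> F s \<le> 1) \<and>
    (\<forall>s. 0 \<le> F' s) \<and> (\<forall>s. 1 < s \<longrightarrow> s < 2 \<longrightarrow> 0 < F' s) \<and>
    (\<forall>s\<le>1. F' s = 0) \<and> (\<forall>s\<ge>2. F' s = 0)"

lemma smooth_step_exists: "\<exists>F F'. smooth_step F F'"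
proof -
  \<comment> \<open>Positive exactly on (1, 2): the first factor vanishes for s \<le> 1, the second
    for s \<ge> 2.\<close>
  define g where "g s = bump 0 (1 * s + - 1) * bump 0 (- 1 * s + 2)" for s
  have g: "smooth1 g" unfolding g_def by (intro smooth1.mult smooth1.bump)
  have g0: "g s = 0" if "s \<le> 1" for s using that by (simp add: g_def bump_def)
  have g2: "g s = 0" if "2 \<le> s" for s using that by (simp add: g_def bump_def)
  have gnn: "0 \<le> g s" for s by (simp add: g_def bump_def)
  have gpos: "0 < g s" if "1 < s" "s < 2" for s using that by (simp add: g_def bump_def)
  define G where "G = (\<lambda>s. integral {0..s} g)"
  have G: "(G has_real_derivative g s) (at s)" "smooth1 G" "s < 1 \<Longrightarrow> G s = 0" for s
    using smooth1_antiderivative[of g 1] g g0 unfolding G_def by auto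
  have mono: "G a \<le> G b" if "a \<le> b" for a b
    using DERIV_nonneg_imp_nondecreasing[OF that] G(1) gnn by blast
  \<comment> \<open>The derivative is positive only on the open interval (1, 2), so strict growth is
    obtained on a closed subinterval and extended by monotonicity.\<close>
  have "G (5/4) < G (7/4)"
  proof (rule DERIV_pos_imp_increasing[of "5/4" "7/4" G])
    show "\<exists>y. (G has_real_derivative y) (at x) \<and> 0 < y" if "5/4 \<le> x" "x \<le> 7/4" for x
      using G(1)[of x] gpos[of x] that by (intro exI[of _ "g x"]) simp
  qed simp
  then have pos: "0 < G 2"
    using mono[of 0 "5/4"] mono[of "7/4" 2] G(3)[of 0] by simp
  have G1: "G s = 0" if "s \<le> 1" for s
  proof -
    have "integral {0..s} g = integral {0..s} (\<lambda>_. 0)"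
      using that g0 by (intro integral_cong) auto
    then show ?thesis by (simp add: G_def)
  qed
  have Gc: "G s = G 2" if "2 \<le> s" for s
    using DERIV_zero_imp_const_beyond[of G g 2 s] G(1) g2 that by blast
  define F where "F s = (1 / G 2) * G s" for s
  define F' where "F' s = (1 / G 2) * g s" for s
  have bds: "0 \<le> G s" "G s \<le> G 2" for s
  proof -
    show "0 \<le> G s" using mono[of 1 s] G1[of 1] G1[of s] by (cases "s \<le> 1") auto
    show "G s \<le> G 2" using mono[of s 2] Gc[of s] by (cases "s \<le> 2") auto
  qed
  define F where "F s = (1 / G 2) * G s" for s
  define F' where "F' s = (1 / G 2) * g s" for s
  have bds: "0 \<le> G s" "G s \<le> G 2" for s
    using mono[of 0 s] mono[of s 2] G1[of s] Gc[of s] G(3)[of 0] mono[of 0 2]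
    by (cases "s \<le> 1"; cases "s \<le> 2"; force)+
  have "smooth_step F F'"
    unfolding smooth_step_def
  proof (intro conjI allI impI)
    show "smooth1 F" unfolding F_def by (intro smooth1_cmult G)
    show "smooth1 F'" unfolding F'_def by (intro smooth1_cmult g)
    show "(F has_real_derivative F' s) (at s)" for s
      unfolding F_def F'_def using G(1) by (intro DERIV_cmult)
    show "F s = 0" if "s \<le> 1" for s using G1[OF that] by (simp add: F_def)
    show "F s = 1" if "2 \<le> s" for s using Gc[OF that] pos by (simp add: F_def)
    show "0 \<le> F s" "F s \<le> 1" for s using bds[of s] pos by (simp_all add: F_def)
    show "0 \<le> F' s" for s using gnn[of s] pos by (simp add: F'_def)
    show "0 < F' s" if "1 < s" "s < 2" for s using gpos[OF that] pos by (simp add: F'_def)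
    show "F' s = 0" if "s \<le> 1" for s using g0[OF that] by (simp add: F'_def)
    show "F' s = 0" if "2 \<le> s" for s using g2[OF that] by (simp add: F'_def)
  qed
  then show ?thesis by blast
qed

text \<open>In dimension n the function w(|x|^2) has Laplacian 2 n w' + 4 s w'' at s = |x|^2, and
  \<Phi>(4 s) is the mollifier at 2 x. The last clause is therefore the equation for W of the
  overview, read in the variable s.\<close>

definition bump_pair ::
    "real \<Rightarrow> (real \<Rightarrow> real) \<Rightarrow> (real \<Rightarrow> real) \<Rightarrow> (real \<Rightarrow> real) \<Rightarrow> (real \<Rightarrow> real) \<Rightarrow> bool" where
  "bump_pair n \<Phi> w w' w'' \<longleftrightarrow> smooth1 \<Phi> \<and> smooth1 w \<and>
    (\<forall>s. (w has_real_derivative w' s) (at s)) \<and> (\<forall>s. (w' has_real_derivative w'' s) (at s)) \<and>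
    (\<forall>s. 0 \<le> \<Phi> s) \<and> (\<forall>s. 1 < s \<longrightarrow> s < 2 \<longrightarrow> 0 < \<Phi> s) \<and>
    (\<forall>s\<ge>2. \<Phi> s = 0) \<and> (\<forall>s\<ge>2. w s = 0) \<and>
    (\<forall>s\<ge>0. 2 * n * w' s + 4 * s * w'' s = \<Phi> s - 2 powr n * \<Phi> (4 * s))"

text \<open>The equation has divergence form, so one integration turns its right-hand side into the
  difference of F(s) and F(4 s), up to the factor 1/4. Both are 0 for s < 1/4 and both are 1 for s
  \<ge> 2; hence w' is supported away from the origin and from infinity. Without the rescaled term s
  powr (n/2) * w' would stay at 1/4 for large s, which is the slow decay of the fundamental
  solution.\<close>

lemma bump_pair_exists: "\<exists>\<Phi> w w' w''. bump_pair n \<Phi> w w' w''"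
proof -
  obtain F F' where "smooth_step F F'"
    using smooth_step_exists by blast
  then have F: "smooth1 F" "smooth1 F'" "\<And>s. (F has_real_derivative F' s) (at s)"
    "\<And>s. s \<le> 1 \<Longrightarrow> F s = 0" "\<And>s. 2 \<le> s \<Longrightarrow> F s = 1"
    "\<And>s. 0 \<le> F' s" "\<And>s. 1 < s \<Longrightarrow> s < 2 \<Longrightarrow> 0 < F' s"
    "\<And>s. s \<le> 1 \<Longrightarrow> F' s = 0" "\<And>s. 2 \<le> s \<Longrightarrow> F' s = 0"
    unfolding smooth_step_def by blast+
  define \<Phi> where "\<Phi> s = s powr (1 - n / 2) * F' s" for s
  define h where "h s = (1 / 4) * (F s - F (4 * s))" for s
  \<comment> \<open>At \<open>s = |x|\<^sup>2\<close> the Laplacian of \<open>w(|x|\<^sup>2)\<close> is \<open>4 s w'' + 2 n w' = 4 s powr (1 - n/2) * (s powr (n/2) * w')'\<close>;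
    integrating the required value of it gives \<open>w'\<close>.\<close>
  define w' where "w' s = s powr (- n / 2) * h s" for s
  define h' where "h' s = (1 / 4) * (F' s - 4 * F' (4 * s))" for s
  define w'' where "w'' s = (- n / 2) * s powr (- n / 2 - 1) * h s + s powr (- n / 2) * h' s" for s
  have h: "smooth1 h" unfolding h_def by (intro smooth1_cmult smooth1_diff F smooth1.scale)
  have h0: "h s = 0" if "s < 1/4" for s using that F(4) by (simp add: h_def)
  have dh: "(h has_real_derivative h' s) (at s)" for s
    unfolding h_def h'_def 
    using DERIV_chain2[OF F(3) DERIV_cmult_Id, of 4]
    by (intro DERIV_cmult DERIV_diff F(3)) (simp add: mult.commute)
  have sm: "smooth1 w'" unfolding w'_def by (rule smooth1.powr[where c="1/4", OF h]) (simp_all add: h0)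
  have w0: "w' s = 0" if "s < 1/4" for s using h0[OF that] by (simp add: w'_def)
  have w2: "w' s = 0" if "2 \<le> s" for s using F(5) that by (simp add: w'_def h_def)
  define A where "A = (\<lambda>s. integral {0..s} w')"
  have A: "(A has_real_derivative w' s) (at s)" "smooth1 A" for s
    using smooth1_antiderivative[of w' "1/4"] sm w0 unfolding A_def by auto
  have dw': "(w' has_real_derivative w'' s) (at s)" for s
  proof (cases "s < 1/4")
    case True
    have "h' s = 0" using True F(8) by (simp add: h'_def)
    then have "w'' s = 0" using h0[OF True] by (simp add: w''_def)
    moreover have "(w' has_real_derivative 0) (at s)"
      by (rule has_field_derivative_transform_within_open[where S="{..<1/4}", OF DERIV_const[of 0]])
         (use True w0 in auto)
    ultimately show ?thesis by simp
  next
    case False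
    then have "s > 0" by linarith
    then show ?thesis unfolding w'_def w''_def
      by (auto intro!: derivative_eq_intros dh simp: mult_ac)
  qed
  \<comment> \<open>Normalising the primitive at the outer end makes w vanish for s \<ge> 2; near
    the origin it is then constant.\<close>
  have "bump_pair n \<Phi> (\<lambda>s. A s - A 2) w' w''"
    unfolding bump_pair_def
  proof (intro conjI allI impI)
    show "smooth1 \<Phi>" unfolding \<Phi>_def by (rule smooth1.powr[where c=1, OF F(2)]) (simp_all add: F(8))
    show "smooth1 (\<lambda>s. A s - A 2)" by (intro smooth1_diff A smooth1.const)
    show "((\<lambda>s. A s - A 2) has_real_derivative w' s) (at s)" for s
      by (auto intro!: derivative_eq_intros A)
    show "(w' has_real_derivative w'' s) (at s)" for s by (rule dw')
    show "A s - A 2 = 0" if "2 \<le> s" for s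
      using DERIV_zero_imp_const_beyond[of A w' 2 s] A(1) w2 that by simp
    show "2 * n * w' s + 4 * s * w'' s = \<Phi> s - 2 powr n * \<Phi> (4 * s)" if "0 \<le> s" for s
    proof (cases "s = 0")
      case True
      then show ?thesis by (simp add: w'_def w''_def \<Phi>_def)
    next
      case False
      then have s: "s > 0" using that by simp
      have e0: "s * s powr a = s powr (1 + a)" for a
        using s by (subst powr_add) simp
      have e1: "s * s powr (- n / 2 - 1) = s powr (- n / 2)"
        and e2: "s * s powr (- n / 2) = s powr (1 - n / 2)"
        by (simp_all only: e0) simp_all
      \<comment> \<open>The factor 2^n of the rescaled mollifier and the power of 4 s together leave
        a factor 4, the one that the chain rule produces in h'.\<close>
      have "(4::real) powr (1 - n / 2) = (2 powr 2) powr (1 - n / 2)" by simp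
      also have "\<dots> = 2 powr (2 - n)" 
        by (subst powr_powr) (simp only: right_diff_distrib mult_1_right times_divide_eq_right nonzero_mult_div_cancel_left zero_neq_numeral not_False_eq_True)
      finally have "2 powr n * (4::real) powr (1 - n / 2) = 2 powr (n + (2 - n))"
        by (simp only: powr_add)
      then have "2 powr n * (4::real) powr (1 - n / 2) = 4" by simp
      then have e3: "2 powr n * (4 * s) powr (1 - n / 2) = 4 * s powr (1 - n / 2)"
        using s by (simp only: powr_mult mult.assoc[symmetric])
      have "2 * n * w' s + 4 * s * w'' s
          = 2 * n * s powr (- n / 2) * h s - 2 * n * (s * s powr (- n / 2 - 1)) * h s
            + 4 * (s * s powr (- n / 2)) * h' s"
        by (simp only: w'_def w''_def) (simp add: field_simps)
      also have "\<dots> = s powr (1 - n / 2) * F' s - 4 * s powr (1 - n / 2) * F' (4 * s)"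
        by (simp only: e1 e2 h'_def) (simp add: field_simps)
      also have "\<dots> = \<Phi> s - 2 powr n * \<Phi> (4 * s)"
        by (simp only: \<Phi>_def e3[symmetric] mult.assoc)
      finally show ?thesis .
    qed
    show "0 \<le> \<Phi> s" for s using F(6)[of s] by (simp add: \<Phi>_def)
    show "0 < \<Phi> s" if "1 < s" "s < 2" for s using F(7)[OF that] that by (simp add: \<Phi>_def)
    show "\<Phi> s = 0" if "2 \<le> s" for s using F(9)[OF that] by (simp add: \<Phi>_def)
  qed
  then show ?thesis by blast
qed

section \<open>The Laplacian of a radial function\<close>

lemma partial_deriv_radial:
  fixes y :: "real ^ 'n::finite" and g :: "real \<Rightarrow> real"
  assumes g: "\<And>s. (g has_real_derivative g' s) (at s)"
  shows "partial_deriv i (\<lambda>x. g (c * ((x - y) \<bullet> (x - y)))) =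
    (\<lambda>x. 2 * c * (x $ i - y $ i) * g' (c * ((x - y) \<bullet> (x - y))))"
proof
  fix x :: "real ^ 'n"
  have 1: "((\<lambda>x. c * ((x - y) \<bullet> (x - y))) has_derivative (\<lambda>v. c * (2 * ((x - y) \<bullet> v)))) (at x)"
    by (auto intro!: derivative_eq_intros simp: inner_commute)
  from has_derivative_compose[OF 1, of g "\<lambda>v. g' (c * ((x - y) \<bullet> (x - y))) * v"]
  have "((\<lambda>x. g (c * ((x - y) \<bullet> (x - y)))) has_derivative
      (\<lambda>v. g' (c * ((x - y) \<bullet> (x - y))) * (c * (2 * ((x - y) \<bullet> v))))) (at x)"
    using g by (simp add: has_field_derivative_def)
  from partial_deriv_eq[OF this, of i]
  show "partial_deriv i (\<lambda>x. g (c * ((x - y) \<bullet> (x - y)))) x =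
      2 * c * (x $ i - y $ i) * g' (c * ((x - y) \<bullet> (x - y)))"
    by (simp add: inner_axis)
qed

lemma partial_deriv2_radial:
  fixes y :: "real ^ 'n::finite" and g :: "real \<Rightarrow> real"
  assumes g: "\<And>s. (g has_real_derivative g' s) (at s)" "\<And>s. (g' has_real_derivative g'' s) (at s)"
  shows "partial_deriv i (partial_deriv i (\<lambda>x. g (c * ((x - y) \<bullet> (x - y))))) x =
    2 * c * g' (c * ((x - y) \<bullet> (x - y))) + 4 * c^2 * (x $ i - y $ i)^2 * g'' (c * ((x - y) \<bullet> (x - y)))"
proof -
  have 1: "((\<lambda>x. c * ((x - y) \<bullet> (x - y))) has_derivative (\<lambda>v. c * (2 * ((x - y) \<bullet> v)))) (at x)"
    by (auto intro!: derivative_eq_intros simp: inner_commute)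
  from has_derivative_compose[OF 1, of g' "\<lambda>v. g'' (c * ((x - y) \<bullet> (x - y))) * v"]
  have 2: "((\<lambda>x. g' (c * ((x - y) \<bullet> (x - y)))) has_derivative
      (\<lambda>v. g'' (c * ((x - y) \<bullet> (x - y))) * (c * (2 * ((x - y) \<bullet> v))))) (at x)"
    using g by (simp add: has_field_derivative_def)
  have 3: "((\<lambda>x. 2 * c * (x $ i - y $ i)) has_derivative (\<lambda>v. 2 * c * v $ i)) (at x)"
    by (auto intro!: derivative_eq_intros bounded_linear_imp_has_derivative bounded_linear_vec_nth)
  show ?thesis
    unfolding partial_deriv_radial[OF g(1)]
    using partial_deriv_eq[OF has_derivative_mult[OF 3 2], of i]
    by (simp add: inner_axis power2_eq_square algebra_simps)
qed

lemma laplacian_radial: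
  fixes y :: "real ^ 'n::finite" and g :: "real \<Rightarrow> real"
  assumes g: "\<And>s. (g has_real_derivative g' s) (at s)" "\<And>s. (g' has_real_derivative g'' s) (at s)"
  shows "(\<Sum>i\<in>UNIV. partial_deriv i (partial_deriv i (\<lambda>x. g (c * ((x - y) \<bullet> (x - y))))) x) =
    c * (2 * real CARD('n) * g' (c * ((x - y) \<bullet> (x - y)))
      + 4 * (c * ((x - y) \<bullet> (x - y))) * g'' (c * ((x - y) \<bullet> (x - y))))"
proof -
  define r where "r = (x - y) \<bullet> (x - y)"
  have r: "(\<Sum>i\<in>UNIV. (x $ i - y $ i)^2) = r"
    by (simp add: inner_vec_def power2_eq_square r_def)
  have "(\<Sum>i\<in>UNIV. partial_deriv i (partial_deriv i (\<lambda>x. g (c * ((x - y) \<bullet> (x - y))))) x) =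
      (\<Sum>i\<in>UNIV. 2 * c * g' (c * r) + (x $ i - y $ i)^2 * (4 * c^2 * g'' (c * r)))"
    by (simp add: partial_deriv2_radial[OF g] r_def[symmetric] mult_ac)
  also have "\<dots> = real CARD('n) * (2 * c * g' (c * r)) + r * (4 * c^2 * g'' (c * r))"
    by (simp only: sum.distrib sum_distrib_right[symmetric] r) simp
  finally show ?thesis
    unfolding r_def[symmetric] by (simp only: algebra_simps power2_eq_square)
qed

section \<open>Radial weights\<close>

abbreviation weight :: "real \<Rightarrow> 'a::real_normed_vector \<Rightarrow> ennreal" where
  "weight b y \<equiv> ennreal (norm y powr (- b))"

lemma dyadic_shell_inner:
  fixes r a :: real
  assumes "0 < r" "r < a"
  obtains k where "a / 2 ^ Suc k \<le> r" "r < a / 2 ^ k"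
proof -
  define m where "m = (LEAST m. a / 2 ^ m \<le> r)"
  obtain j where "a / r < 2 ^ j" using real_arch_pow[of 2 "a / r"] by auto
  then have "a / 2 ^ j \<le> r" using assms by (simp add: field_simps)
  then have m: "a / 2 ^ m \<le> r" unfolding m_def by (rule LeastI)
  then have "m \<noteq> 0" using assms by (intro notI) simp
  then obtain k where k: "m = Suc k" by (cases m) auto
  have "\<not> a / 2 ^ k \<le> r" using not_less_Least[of k "\<lambda>m. a / 2 ^ m \<le> r"] k m_def by simp
  with m k show thesis by (intro that[of k]) simp_all
qed

lemma dyadic_shell_outer:
  fixes r R :: real
  assumes "0 < R" "R \<le> r"
  obtains k where "R * 2 ^ k \<le> r" "r < R * 2 ^ Suc k"
proof -
  define m where "m = (LEAST m. r < R * 2 ^ m)"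
  obtain j where "r / R < 2 ^ j" using real_arch_pow[of 2 "r / R"] by auto
  then have "r < R * 2 ^ j" using assms by (simp add: field_simps)
  then have m: "r < R * 2 ^ m" unfolding m_def by (rule LeastI)
  then have "m \<noteq> 0" using assms by (intro notI) simp
  then obtain k where k: "m = Suc k" by (cases m) auto
  have "\<not> r < R * 2 ^ k" using not_less_Least[of k "\<lambda>m. r < R * 2 ^ m"] k m_def by simp
  with m k show thesis by (intro that[of k]) simp_all
qed

lemma le_suminf_ennreal: "f k \<le> suminf (f :: nat \<Rightarrow> ennreal)"
  using sum_le_suminf[of f "{k}"] by simp

text \<open>A dyadic form of integration in polar coordinates: a power of the norm is bounded by a
  constant on each shell, and the shell is enlarged to a ball of known volume. The enlargement costs
  only a constant factor because the resulting series is geometric.\<close>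

lemma nn_integral_le_sum_balls:
  fixes v :: "'a::euclidean_space \<Rightarrow> ennreal"
  assumes v: "\<And>y. v y \<le> (\<Sum>k. ennreal (c k) * indicator (ball 0 (r k)) y)"
    and nn: "\<And>k. 0 \<le> c k" "\<And>k. 0 \<le> r k"
    and S: "(\<lambda>k. c k * (unit_ball_vol (real DIM('a)) * r k ^ DIM('a))) sums S"
  shows "(\<integral>\<^sup>+y. v y \<partial>lborel) \<le> ennreal S"
proof -
  have "(\<integral>\<^sup>+y. v y \<partial>lborel) \<le> (\<integral>\<^sup>+y. (\<Sum>k. ennreal (c k) * indicator (ball 0 (r k)) y) \<partial>(lborel :: 'a measure))"
    by (intro nn_integral_mono v)
  also have "\<dots> = (\<Sum>k. \<integral>\<^sup>+y. ennreal (c k) * indicator (ball 0 (r k)) y \<partial>(lborel :: 'a measure))"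
    by (intro nn_integral_suminf borel_measurable_times_ennreal borel_measurable_const borel_measurable_indicator) simp
  also have "\<dots> = (\<Sum>k. ennreal (c k * (unit_ball_vol (real DIM('a)) * r k ^ DIM('a))))"
    using nn by (simp add: nn_integral_cmult_indicator emeasure_ball ennreal_mult)
  also have "\<dots> = ennreal S"
    by (intro suminf_ennreal_eq S) (use nn in simp)
  finally show ?thesis .
qed

text \<open>On the shell of radius about a / 2^k, weight times volume is comparable to a^(N - b)
  times \<rho>^k with \<rho> = 2^(b - N), and \<rho> < 1 because b < N.\<close>

lemma powr_inner_nn_integral:
  assumes "0 \<le> b" "b < real DIM('a::euclidean_space)"
  shows "\<exists>C\<ge>0. \<forall>a>0. (\<integral>\<^sup>+y. weight b y * indicator (ball 0 a) (y::'a) \<partial>lborel)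
    \<le> ennreal (C * a powr (real DIM('a) - b))"
proof -
  define n where "n = DIM('a)"
  define \<omega> where "\<omega> = unit_ball_vol (real n)"
  have \<omega>: "0 \<le> \<omega>" by (simp add: \<omega>_def)
  define \<rho> where "\<rho> = 2 powr (b - real n)"
  have \<rho>: "0 < \<rho>" "\<rho> < 1"
    using assms powr_less_cancel_iff[of 2 "b - real n" 0] by (auto simp: \<rho>_def n_def)
  define C where "C = \<omega> * 2 powr b * (1 / (1 - \<rho>))"
  have "0 \<le> C" using \<omega> \<rho> by (simp add: C_def)
  moreover have "(\<integral>\<^sup>+y. weight b y * indicator (ball 0 a) (y::'a) \<partial>lborel)
      \<le> ennreal (C * a powr (real n - b))" if a: "a > 0" for a
  proof (rule nn_integral_le_sum_balls[where r="\<lambda>k. a / 2 ^ k" and c="\<lambda>k. (a / 2 ^ Suc k) powr (- b)"])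
    fix y :: 'a
    show "weight b y * indicator (ball 0 a) y
      \<le> (\<Sum>k. ennreal ((a / 2 ^ Suc k) powr (- b)) * indicator (ball 0 (a / 2 ^ k)) y)" (is "_ \<le> suminf ?f")
    \<comment> \<open>The origin lies in no shell, but contributes nothing because
      \<open>0 powr (- b)\<close> is 0.\<close>
    proof (cases "y = 0 \<or> y \<notin> ball 0 a")
      case False
      then obtain k where k: "a / 2 ^ Suc k \<le> norm y" "norm y < a / 2 ^ k"
        using dyadic_shell_inner[of "norm y" a] by auto
      have "weight b y * indicator (ball 0 a) y \<le> ?f k"
        using k a assms False by (auto intro!: ennreal_leI powr_mono2')
      also have "\<dots> \<le> suminf ?f" by (rule le_suminf_ennreal)
      finally show ?thesis .
    qed auto
  next
    have eq: "(a / 2 ^ Suc k) powr (- b) * (unit_ball_vol (real n) * (a / 2 ^ k) ^ n)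
        = \<omega> * 2 powr b * a powr (real n - b) * \<rho> ^ k" for k
    proof -
      define x :: real where "x = 2 ^ k"
      have x: "x > 0" by (simp add: x_def)
      have 1: "(a / (2 * x)) powr (- b) = (a / x) powr (- b) * 2 powr b"
      proof -
        have "a / (2 * x) = (a / x) / 2" by (simp only: divide_divide_eq_left mult.commute)
        then have "(a / (2 * x)) powr (- b) = (a / x) powr (- b) / 2 powr (- b)"
          using a x by (simp only: powr_divide)
        then show ?thesis by (simp only: powr_minus divide_inverse inverse_inverse_eq)
      qed
      have 2: "(a / x) ^ n = (a / x) powr real n" using a x by (simp add: powr_realpow)
      have 3: "\<rho> ^ k = x powr (b - real n)"
        by (simp add: \<rho>_def x_def powr_power mult.commute powr_realpow[symmetric] powr_powr)
      have "(a / x) powr (- b) * (a / x) powr real n = (a / x) powr (real n - b)"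
        by (simp add: powr_add[symmetric])
      also have "\<dots> = a powr (real n - b) * x powr (b - real n)"
      proof -
        have "(a / x) powr (real n - b) = a powr (real n - b) / x powr (real n - b)"
          using a x by (simp only: powr_divide)
        then show ?thesis
          using powr_minus[of x "real n - b"] by (simp only: divide_inverse minus_diff_eq)
      qed
      finally have "(a / x) powr (- b) * (a / x) powr real n = a powr (real n - b) * x powr (b - real n)" .
      then show ?thesis
        unfolding power_Suc x_def[symmetric] 1 2 3 \<omega>_def by (simp add: mult_ac)
    qed
    have "(\<lambda>k. \<omega> * 2 powr b * a powr (real n - b) * \<rho> ^ k) sums
        (\<omega> * 2 powr b * a powr (real n - b) * (1 / (1 - \<rho>)))"
      using \<rho> by (intro sums_mult geometric_sums) simp
    then show "(\<lambda>k. (a / 2 ^ Suc k) powr (- b) * (unit_ball_vol (real DIM('a)) * (a / 2 ^ k) ^ DIM('a)))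
        sums (C * a powr (real n - b))"
      unfolding n_def[symmetric] eq C_def by (simp add: mult_ac)
  qed (use a in auto)
  ultimately show ?thesis unfolding n_def by (intro exI[of _ C] conjI allI impI)
qed

text \<open>The same summation over shells growing outwards; now the ratio 2^(N - c) is below 1
  because the exponent c exceeds the dimension.\<close>

lemma powr_outer_nn_integral:
  assumes "real DIM('a::euclidean_space) < c"
  shows "\<exists>C\<ge>0. \<forall>R>0. (\<integral>\<^sup>+y. weight c y * indicator {y. R \<le> norm y} (y::'a) \<partial>lborel)
    \<le> ennreal (C * R powr (real DIM('a) - c))"
proof -
  define n where "n = DIM('a)"
  define \<omega> where "\<omega> = unit_ball_vol (real n)"
  have \<omega>: "0 \<le> \<omega>" by (simp add: \<omega>_def)
  define \<rho> where "\<rho> = 2 powr (real n - c)"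
  have c0: "0 \<le> c" using assms by (smt (verit) of_nat_0_le_iff)
  have \<rho>: "0 < \<rho>" "\<rho> < 1"
    using assms powr_less_cancel_iff[of 2 "real n - c" 0] by (auto simp: \<rho>_def n_def)
  define C where "C = \<omega> * 2 ^ n * (1 / (1 - \<rho>))"
  have "0 \<le> C" using \<omega> \<rho> by (simp add: C_def)
  moreover have "(\<integral>\<^sup>+y. weight c y * indicator {y. R \<le> norm y} (y::'a) \<partial>lborel)
      \<le> ennreal (C * R powr (real n - c))" if a: "R > 0" for R
  proof (rule nn_integral_le_sum_balls[where r="\<lambda>k. R * 2 ^ Suc k" and c="\<lambda>k. (R * 2 ^ k) powr (- c)"])
    fix y :: 'a
    show "weight c y * indicator {y. R \<le> norm y} y
      \<le> (\<Sum>k. ennreal ((R * 2 ^ k) powr (- c)) * indicator (ball 0 (R * 2 ^ Suc k)) y)" (is "_ \<le> suminf ?f")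
    proof (cases "R \<le> norm y")
      case True
      then obtain k where k: "R * 2 ^ k \<le> norm y" "norm y < R * 2 ^ Suc k"
        using dyadic_shell_outer[of R "norm y"] a by auto
      have "weight c y * indicator {y. R \<le> norm y} y \<le> ?f k"
        using k a c0 True by (auto intro!: ennreal_leI powr_mono2')
      also have "\<dots> \<le> suminf ?f" by (rule le_suminf_ennreal)
      finally show ?thesis .
    qed auto
  next
    have eq: "(R * 2 ^ k) powr (- c) * (unit_ball_vol (real n) * (R * 2 ^ Suc k) ^ n)
        = \<omega> * 2 ^ n * R powr (real n - c) * \<rho> ^ k" for k
    proof -
      define x :: real where "x = 2 ^ k"
      have x: "x > 0" by (simp add: x_def)
      have 2: "(R * (2 * x)) ^ n = 2 ^ n * (R * x) powr real n"
        using a x by (simp add: powr_realpow power_mult_distrib)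
      have 3: "\<rho> ^ k = x powr (real n - c)"
        by (simp add: \<rho>_def x_def powr_power mult.commute powr_realpow[symmetric] powr_powr)
      have "(R * x) powr (- c) * (R * x) powr real n = (R * x) powr (real n - c)"
        by (simp add: powr_add[symmetric])
      also have "\<dots> = R powr (real n - c) * x powr (real n - c)"
        using a x by (simp add: powr_mult)
      finally have "(R * x) powr (- c) * (R * x) powr real n = R powr (real n - c) * x powr (real n - c)" .
      then show ?thesis
        unfolding power_Suc x_def[symmetric] 2 3 \<omega>_def by (simp add: mult_ac)
    qed
    have "(\<lambda>k. \<omega> * 2 ^ n * R powr (real n - c) * \<rho> ^ k) sums
        (\<omega> * 2 ^ n * R powr (real n - c) * (1 / (1 - \<rho>)))"
      using \<rho> by (intro sums_mult geometric_sums) simp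
    then show "(\<lambda>k. (R * 2 ^ k) powr (- c) * (unit_ball_vol (real DIM('a)) * (R * 2 ^ Suc k) ^ DIM('a)))
        sums (C * R powr (real n - c))"
      unfolding n_def[symmetric] eq C_def by (simp add: mult_ac)
  qed (use a in auto)
  ultimately show ?thesis unfolding n_def by (intro exI[of _ C] conjI allI impI)
qed

text \<open>No ball carries essentially more weight than a centred one of the same radius: points
  with |y| < a are counted by the centred ball, and elsewhere the weight is at most a^(-b).
  Uniformity in the centre is what the exchange of integrals over balls relies on.\<close>

lemma powr_ball_nn_integral:
  assumes "0 \<le> b" "b < real DIM('a::euclidean_space)"
  shows "\<exists>C\<ge>0. \<forall>a>0. \<forall>x::'a. (\<integral>\<^sup>+y. weight b y * indicator (ball x a) y \<partial>lborel)
    \<le> ennreal (C * a powr (real DIM('a) - b))"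
proof -
  define n where "n = DIM('a)"
  define \<omega> where "\<omega> = unit_ball_vol (real n)"
  have \<omega>: "0 \<le> \<omega>" by (simp add: \<omega>_def)
  obtain C where C: "C \<ge> 0" "\<And>a. a > 0 \<Longrightarrow>
      (\<integral>\<^sup>+y. weight b y * indicator (ball 0 a) (y::'a) \<partial>lborel)
      \<le> ennreal (C * a powr (real n - b))"
    using powr_inner_nn_integral[OF assms] unfolding n_def by blast
  have "(\<integral>\<^sup>+y. weight b y * indicator (ball x a) y \<partial>lborel)
      \<le> ennreal ((C + \<omega>) * a powr (real n - b))" if a: "a > 0" for a and x :: 'a
  proof -
    define I where "I z = (\<integral>\<^sup>+y. weight b y * indicator (ball z a) (y::'a) \<partial>lborel)" for z
    have pw: "a powr (- b) * a ^ n = a powr (real n - b)"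
      using a by (simp add: powr_realpow[symmetric] powr_add[symmetric])
    have 1: "I x \<le> (\<integral>\<^sup>+y. weight b y * indicator (ball 0 a) y
            + ennreal (a powr (- b)) * indicator (ball x a) y \<partial>lborel)"
      unfolding I_def
    proof (rule nn_integral_mono)
      fix y :: 'a
      have le: "norm y powr (- b) \<le> a powr (- b)" if "\<not> norm y < a"
        using that a assms by (intro powr_mono2') simp_all
      show "weight b y * indicator (ball x a) y
        \<le> weight b y * indicator (ball 0 a) y
            + ennreal (a powr (- b)) * indicator (ball x a) y"
        by (cases "norm y < a"; cases "y \<in> ball x a") (simp_all add: le ennreal_leI)
    qed
    have 2: "(\<integral>\<^sup>+y. weight b y * indicator (ball 0 a) y
            + ennreal (a powr (- b)) * indicator (ball x a) y \<partial>lborel)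
        = I 0 + ennreal (a powr (- b)) * emeasure lborel (ball x a)"
    proof -
      have m: "(\<lambda>y::'a. weight b y) \<in> borel_measurable lborel"
        by measurable
      have "(\<integral>\<^sup>+y. weight b y * indicator (ball 0 a) y
            + ennreal (a powr (- b)) * indicator (ball x a) y \<partial>lborel)
        = I 0 + (\<integral>\<^sup>+y. ennreal (a powr (- b)) * indicator (ball x a) y \<partial>lborel)"
        unfolding I_def
        by (intro nn_integral_add borel_measurable_times_ennreal m borel_measurable_indicator
            borel_measurable_const) (simp_all only: sets_lborel borel_open open_ball)
      also have "(\<integral>\<^sup>+y. ennreal (a powr (- b)) * indicator (ball x a) y \<partial>lborel)
          = ennreal (a powr (- b)) * emeasure lborel (ball x a)"
        by (intro nn_integral_cmult_indicator) (simp only: sets_lborel borel_open open_ball)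
      finally show ?thesis .
    qed
    have 3: "ennreal (a powr (- b)) * emeasure lborel (ball x a) = ennreal (\<omega> * a powr (real n - b))"
    proof -
      have "ennreal (a powr (- b)) * emeasure lborel (ball x a) = ennreal (a powr (- b)) * ennreal (\<omega> * a ^ n)"
        using a by (simp add: emeasure_ball n_def \<omega>_def)
      also have "\<dots> = ennreal (a powr (- b) * (\<omega> * a ^ n))"
        using a \<omega> by (simp add: ennreal_mult)
      also have "a powr (- b) * (\<omega> * a ^ n) = \<omega> * a powr (real n - b)"
        unfolding pw[symmetric] by (simp only: mult_ac)
      finally show ?thesis .
    qed
    have "I 0 \<le> ennreal (C * a powr (real n - b))"
      unfolding I_def by (rule C(2)[OF a])
    then have "I x \<le> ennreal (C * a powr (real n - b)) + ennreal (\<omega> * a powr (real n - b))"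
      using 1 unfolding 2 3 by (meson add_right_mono order_trans)
    also have "\<dots> = ennreal ((C + \<omega>) * a powr (real n - b))"
      using C \<omega> by (simp add: distrib_right)
    finally show ?thesis unfolding I_def .
  qed
  moreover have "0 \<le> C + \<omega>" using C(1) \<omega> by simp
  ultimately show ?thesis unfolding n_def by (intro exI[of _ "C + \<omega>"] conjI allI impI)
qed

section \<open>Local integrability and the fundamental lemma\<close>

text \<open>Products over the coordinates of steps in m (x_i - a_i) and m (b_i - x_i). A step equals
  1 once its argument reaches 2, so at an interior point all factors are eventually 1; at any other
  point some argument is nonpositive and its factor is 0.\<close>

lemma box_test_function_approx:
  fixes a b :: "real ^ 'n::finite"
  shows "\<exists>\<psi> :: nat \<Rightarrow> real ^ 'n \<Rightarrow> real. (\<forall>m. test_function (\<psi> m)) \<and>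
    (\<forall>m x. 0 \<le> \<psi> m x \<and> \<psi> m x \<le> indicator (box a b) x) \<and>
    (\<forall>x. (\<lambda>m. \<psi> m x) \<longlonglongrightarrow> indicator (box a b) x)"
proof -
  obtain F F' where "smooth_step F F'" using smooth_step_exists by blast
  then have F: "smooth1 F" "\<And>s. s \<le> 1 \<Longrightarrow> F s = 0" "\<And>s. 2 \<le> s \<Longrightarrow> F s = 1" "\<And>s. 0 \<le> F s" "\<And>s. F s \<le> 1"
    unfolding smooth_step_def by blast+
  define \<psi> where "\<psi> m x = (\<Prod>i\<in>UNIV. F (real m * (x $ i + - (a $ i))) * F (real m * (b $ i + (- 1) * x $ i)))"
    for m :: nat and x :: "real ^ 'n"
  have sm: "smoothn (\<psi> m)" for m
    unfolding \<psi>_def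
    by (intro smoothn_prod smoothn.mult smoothn.comp[OF smooth1.scale[OF F(1)]]
        smoothn.add smoothn.coord smoothn_const finite)
  have out: "\<psi> m x = 0" if "x \<notin> box a b" for m x
  proof -
    from that obtain i where i: "x $ i \<le> a $ i \<or> b $ i \<le> x $ i"
      by (auto simp: mem_box_cart not_less)
    have "F (real m * (x $ i + - (a $ i))) = 0 \<or> F (real m * (b $ i + (- 1) * x $ i)) = 0"
    proof (cases "x $ i \<le> a $ i")
      case True
      then have "real m * (x $ i + - (a $ i)) \<le> 0" by (intro mult_nonneg_nonpos) simp_all
      then have "F (real m * (x $ i + - (a $ i))) = 0" by (intro F(2)) linarith
      then show ?thesis ..
    next
      case False
      then have "real m * (b $ i + (- 1) * x $ i) \<le> 0" using i by (intro mult_nonneg_nonpos) simp_all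
      then have "F (real m * (b $ i + (- 1) * x $ i)) = 0" by (intro F(2)) linarith
      then show ?thesis ..
    qed
    then have "F (real m * (x $ i + - (a $ i))) * F (real m * (b $ i + (- 1) * x $ i)) = 0"
      by (simp only: mult_eq_0_iff)
    then show ?thesis unfolding \<psi>_def by (intro prod_zero) auto
  qed
  have "0 \<le> \<psi> m x" "\<psi> m x \<le> 1" for m x
    unfolding \<psi>_def using F(4,5) by (auto intro!: prod_nonneg prod_le_1 mult_le_one)
  then have bd: "0 \<le> \<psi> m x \<and> \<psi> m x \<le> indicator (box a b) x" for m x
    using out[of x m] by (cases "x \<in> box a b") auto
  have "{x. \<psi> m x \<noteq> 0} \<subseteq> box a b" for m using out by blast
  then have test: "test_function (\<psi> m)" for m
    using sm bounded_box bounded_subset by (blast intro: smoothn_test_function)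
  have one: "(\<lambda>m. F (real m * d)) \<longlonglongrightarrow> 1" if "d > 0" for d
  proof (rule tendsto_eventually)
    obtain M :: nat where M: "2 / d < real M" using reals_Archimedean2 by blast
    have "F (real m * d) = 1" if m: "M \<le> m" for m
    proof (rule F(3))
      have "2 / d \<le> real m" using M m by linarith
      then show "2 \<le> real m * d" using \<open>d > 0\<close> by (simp add: divide_le_eq)
    qed
    then show "\<forall>\<^sub>F m in sequentially. F (real m * d) = 1"
      unfolding eventually_sequentially by blast
  qed
  have lim: "(\<lambda>m. \<psi> m x) \<longlonglongrightarrow> indicator (box a b) x" for x
  proof (cases "x \<in> box a b")
    case False
    then show ?thesis using out[of x] by simp
  next
    case True
    have "(\<lambda>m. \<psi> m x) \<longlonglongrightarrow> (\<Prod>i\<in>(UNIV::'n set). 1 * 1)"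
      unfolding \<psi>_def
      by (intro tendsto_prod tendsto_mult one) (use True in \<open>simp_all add: mem_box_cart\<close>)
    then show ?thesis using True by simp
  qed
  show ?thesis using test bd lim by blast
qed

text \<open>The Borel counterpart of \<open>locally_integrable\<close>, on \<open>lborel\<close>.
  The value type is general so that it also covers real majorants and real and imaginary
  parts.\<close>

definition locint :: "(real ^ 'n \<Rightarrow> 'b::{banach, second_countable_topology}) \<Rightarrow> bool" where
  "locint f \<longleftrightarrow> f \<in> borel_measurable borel \<and> (\<forall>R. integrable lborel (\<lambda>x. indicator (ball 0 R) x *\<^sub>R f x))"

lemma locint_bounded_integrable:
  fixes f :: "real ^ 'n::finite \<Rightarrow> 'b::{banach, second_countable_topology}"
  assumes "locint f" "\<phi> \<in> borel_measurable borel" "\<And>x. \<bar>\<phi> x\<bar> \<le> B * indicator (ball 0 R) x"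
  shows "integrable lborel (\<lambda>x. \<phi> x *\<^sub>R f x)"
proof (rule Bochner_Integration.integrable_bound)
  show "integrable lborel (\<lambda>x. B *\<^sub>R indicator (ball 0 R) x *\<^sub>R f x)"
    using assms(1) unfolding locint_def by (intro integrable_scaleR_right) blast
  have "f \<in> borel_measurable borel" using assms unfolding locint_def by blast
  then show "(\<lambda>x. \<phi> x *\<^sub>R f x) \<in> borel_measurable lborel"
    using assms(2) by (intro borel_measurable_scaleR) simp_all
  show "AE x in lborel. norm (\<phi> x *\<^sub>R f x) \<le> norm (B *\<^sub>R indicator (ball 0 R) x *\<^sub>R f x)"
  proof (rule AE_I2)
    fix x
    have "\<bar>\<phi> x\<bar> \<le> \<bar>B\<bar> * \<bar>indicator (ball 0 R) x\<bar>"
      using assms(3)[of x] by (cases "x \<in> ball 0 R") simp_all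
    then have "\<bar>\<phi> x\<bar> * norm (f x) \<le> (\<bar>B\<bar> * \<bar>indicator (ball 0 R) x\<bar>) * norm (f x)"
      by (rule mult_right_mono) simp
    then show "norm (\<phi> x *\<^sub>R f x) \<le> norm (B *\<^sub>R indicator (ball 0 R) x *\<^sub>R f x)"
      by (simp add: mult.assoc abs_mult)
  qed
qed

text \<open>The hypothesis says that the measures with densities h^+ and h^- agree on boxes. Boxes
  form an intersection-stable generator, so the measures agree, hence the densities do, and h^+ =
  h^- forces both to vanish.\<close>

lemma AE_zero_of_box_integrals:
  fixes h :: "real ^ 'n::finite \<Rightarrow> real"
  assumes "locint h" and z: "\<And>a b. (\<integral>x. indicator (box a b) x *\<^sub>R h x \<partial>lborel) = 0"
  shows "AE x in lborel. h x = 0"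
proof -
  have m: "h \<in> borel_measurable borel" using assms unfolding locint_def by blast
  have ib: "integrable lborel (\<lambda>x. indicator (box a b) x *\<^sub>R h x)" for a b :: "real ^ 'n"
  proof -
    have "bounded (box a b)" by simp
    then obtain R where R: "box a b \<subseteq> ball 0 R"
      using bounded_subset_ballD by blast
    show ?thesis
      by (rule locint_bounded_integrable[OF assms(1), of _ 1 R])
         (use R in \<open>auto simp: indicator_def\<close>)
  qed
  \<comment> \<open>\<open>ennreal\<close> truncates at 0, so \<open>D h\<close> has density h^+ and
    \<open>D (\<lambda>x. - h x)\<close> has density h^-.\<close>
  define D where "D f = density lborel (\<lambda>x. ennreal (f x))" for f :: "real ^ 'n \<Rightarrow> real"
  have em: "emeasure (D f) (box a b) = (\<integral>\<^sup>+x. ennreal (indicator (box a b) x *\<^sub>R f x) \<partial>lborel)"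
    if "f \<in> borel_measurable borel" for f a b
    unfolding D_def using that
    by (subst emeasure_density) (auto intro!: nn_integral_cong split: split_indicator)
  have eqb: "emeasure (D h) (box a b) = emeasure (D (\<lambda>x. - h x)) (box a b)"
    and fin: "emeasure (D h) (box a b) \<noteq> \<infinity>" for a b
  proof -
    let ?g = "\<lambda>x. indicator (box a b) x *\<^sub>R h x"
    have i: "integrable lborel ?g" by (rule ib)
    define P Q where "P = (\<integral>\<^sup>+x. ennreal (?g x) \<partial>lborel)" and "Q = (\<integral>\<^sup>+x. ennreal (- ?g x) \<partial>lborel)"
    have p: "P \<noteq> \<infinity>" and q: "Q \<noteq> \<infinity>"
      using i unfolding real_integrable_def P_def Q_def by blast+
    have "enn2real P - enn2real Q = 0"
      using real_lebesgue_integral_def[OF i] z[of a b] unfolding P_def Q_def by simp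
    then have "enn2real P = enn2real Q" by simp
    moreover have "ennreal (enn2real P) = P" "ennreal (enn2real Q) = Q"
      using p q by (simp_all add: less_top)
    ultimately have "P = Q" by metis
    moreover have "(\<integral>\<^sup>+x. ennreal (indicator (box a b) x *\<^sub>R - h x) \<partial>lborel) = Q"
      unfolding Q_def by (simp only: scaleR_minus_right)
    ultimately show "emeasure (D h) (box a b) = emeasure (D (\<lambda>x. - h x)) (box a b)"
      unfolding em[OF m] em[OF borel_measurable_uminus[OF m]] P_def[symmetric] by simp
    show "emeasure (D h) (box a b) \<noteq> \<infinity>" using p unfolding em[OF m] P_def .
  qed
  have "D h = D (\<lambda>x. - h x)"
  proof (rule measure_eqI_generator_eq)
    let ?E = "range (\<lambda>(a, b). box a b :: (real ^ 'n) set)"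
    show "Int_stable ?E" by (auto simp: Int_stable_def box_Int_box)
    show "?E \<subseteq> Pow UNIV" by simp
    show "sets (D h) = sigma_sets UNIV ?E" "sets (D (\<lambda>x. - h x)) = sigma_sets UNIV ?E"
      by (simp_all add: D_def borel_eq_box)
    let ?A = "\<lambda>n::nat. box (- (real n *\<^sub>R One)) (real n *\<^sub>R One) :: (real ^ 'n) set"
    show "range ?A \<subseteq> ?E" "(\<Union>i. ?A i) = UNIV"
      unfolding UN_box_eq_UNIV by auto
    show "emeasure (D h) (?A i) \<noteq> \<infinity>" for i by (rule fin)
    show "emeasure (D h) X = emeasure (D (\<lambda>x. - h x)) X" if "X \<in> ?E" for X
      using that eqb by auto
  qed
  then have "AE x in lborel. ennreal (h x) = ennreal (- h x)"
    unfolding D_def using m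
    by (intro sigma_finite_measure.density_unique[OF sigma_finite_lborel]) simp_all
  then show ?thesis
  proof eventually_elim
    case (elim x)
    have "h x \<le> 0 \<or> - h x \<le> 0" by linarith
    then show ?case using elim by (metis ennreal_eq_0_iff neg_le_0_iff_le order_antisym)
  qed
qed

lemma locint_bounded_linear:
  fixes f :: "real ^ 'n::finite \<Rightarrow> 'b::{banach, second_countable_topology}"
    and T :: "'b \<Rightarrow> 'c::{banach, second_countable_topology}"
  assumes "bounded_linear T" "locint f"
  shows "locint (\<lambda>x. T (f x))"
proof -
  interpret T: bounded_linear T by fact
  have "integrable lborel (\<lambda>x. T (indicator (ball 0 R) x *\<^sub>R f x))" for R
    using assms unfolding locint_def by (intro integrable_bounded_linear[OF assms(1)]) blast
  moreover have "(\<lambda>x. T (f x)) \<in> borel_measurable borel"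
    using assms unfolding locint_def
    by (intro borel_measurable_continuous_on[of T, OF linear_continuous_on[OF assms(1)]]) blast
  ultimately show ?thesis unfolding locint_def by (simp add: T.scaleR)
qed

text \<open>Test functions approximating a box, with dominated convergence, give vanishing box
  integrals; the criterion for real functions is then applied to the real and imaginary
  parts.\<close>

lemma fundamental_lemma:
  fixes g :: "real ^ 'n::finite \<Rightarrow> complex"
  assumes g: "locint g" and z: "\<And>\<psi>. test_function \<psi> \<Longrightarrow> (\<integral>x. \<psi> x *\<^sub>R g x \<partial>lborel) = 0"
  shows "AE x in lborel. g x = 0"
proof -
  have m: "g \<in> borel_measurable borel" using g unfolding locint_def by blast
  have bx: "(\<integral>x. indicator (box a b) x *\<^sub>R g x \<partial>lborel) = 0"
    and ix: "integrable lborel (\<lambda>x. indicator (box a b) x *\<^sub>R g x)" for a b :: "real ^ 'n"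
  proof -
    have "bounded (box a b)" by simp
    then obtain R where R: "box a b \<subseteq> ball 0 R" using bounded_subset_ballD by blast
    show i: "integrable lborel (\<lambda>x. indicator (box a b) x *\<^sub>R g x)"
      by (rule locint_bounded_integrable[OF g, of _ 1 R]) (use R in \<open>auto simp: indicator_def\<close>)
    obtain \<psi> :: "nat \<Rightarrow> real ^ 'n \<Rightarrow> real" where \<psi>: "\<And>m. test_function (\<psi> m)"
      "\<And>m x. 0 \<le> \<psi> m x \<and> \<psi> m x \<le> indicator (box a b) x"
      "\<And>x. (\<lambda>m. \<psi> m x) \<longlonglongrightarrow> indicator (box a b) x"
      using box_test_function_approx[of a b] by blast
    have "(\<lambda>m. \<integral>x. \<psi> m x *\<^sub>R g x \<partial>lborel) \<longlonglongrightarrow> (\<integral>x. indicator (box a b) x *\<^sub>R g x \<partial>lborel)"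
    proof (rule integral_dominated_convergence)
      show "integrable lborel (\<lambda>x. norm (indicator (box a b) x *\<^sub>R g x))"
        using i by (rule integrable_norm)
      show "AE x in lborel. (\<lambda>m. \<psi> m x *\<^sub>R g x) \<longlonglongrightarrow> indicator (box a b) x *\<^sub>R g x"
        by (intro AE_I2 tendsto_scaleR \<psi> tendsto_const)
      show "AE x in lborel. norm (\<psi> k x *\<^sub>R g x) \<le> norm (indicator (box a b) x *\<^sub>R g x)" for k
      proof (rule AE_I2)
        fix x
        show "norm (\<psi> k x *\<^sub>R g x) \<le> norm (indicator (box a b) x *\<^sub>R g x)"
          using \<psi>(2)[of k x] by (auto intro!: mult_right_mono)
      qed
      show "(\<lambda>x. indicator (box a b) x *\<^sub>R g x) \<in> borel_measurable lborel"
        using i by (rule borel_measurable_integrable)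
      show "(\<lambda>x. \<psi> k x *\<^sub>R g x) \<in> borel_measurable lborel" for k
      proof -
        have "continuous_on UNIV (\<psi> k)"
          using \<psi>(1)[of k] unfolding test_function_def by (metis C_k.simps(1))
        then have "\<psi> k \<in> borel_measurable borel" by (rule borel_measurable_continuous_onI)
        with m show ?thesis by (intro borel_measurable_scaleR) simp_all
      qed
    qed
    then have "(\<lambda>m::nat. 0::complex) \<longlonglongrightarrow> (\<integral>x. indicator (box a b) x *\<^sub>R g x \<partial>lborel)"
      using z[OF \<psi>(1)] by simp
    then show "(\<integral>x. indicator (box a b) x *\<^sub>R g x \<partial>lborel) = 0"
      using LIMSEQ_unique tendsto_const by blast
  qed
  have "AE x in lborel. T (g x) = 0" if T: "bounded_linear T" for T :: "complex \<Rightarrow> real"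
  proof (rule AE_zero_of_box_integrals)
    interpret T: bounded_linear T by fact
    show "locint (\<lambda>x. T (g x))" by (rule locint_bounded_linear[OF T g])
    show "(\<integral>x. indicator (box a b) x *\<^sub>R T (g x) \<partial>lborel) = 0" for a b
      using integral_bounded_linear[OF T ix[of a b]] bx[of a b] by (simp add: T.scaleR T.zero)
  qed
  from this[OF bounded_linear_Re] this[OF bounded_linear_Im] show ?thesis
    by eventually_elim (simp add: complex_eq_iff)
qed

section \<open>Rescaled radial kernels\<close>

text \<open>The profile takes the squared distance, which is a polynomial in x, so no singularity
  arises at x = y. The parameter t is an inverse length, and the power of t makes the integral of
  the kernel independent of t.\<close>

definition kern :: "(real \<Rightarrow> real) \<Rightarrow> real \<Rightarrow> real ^ 'n \<Rightarrow> real ^ 'n \<Rightarrow> real" where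
  "kern k t y x = t ^ CARD('n) * k (t^2 * ((x - y) \<bullet> (x - y)))"

definition rconv :: "(real \<Rightarrow> real) \<Rightarrow> real \<Rightarrow> (real ^ 'n \<Rightarrow> complex) \<Rightarrow> real ^ 'n \<Rightarrow> complex" where
  "rconv k t f y = (\<integral>x. kern k t y x *\<^sub>R f x \<partial>lborel)"

definition profile :: "real \<Rightarrow> (real \<Rightarrow> real) \<Rightarrow> bool" where
  "profile B k \<longleftrightarrow> continuous_on UNIV k \<and> (\<forall>s\<ge>2. k s = 0) \<and> (\<forall>s\<ge>0. \<bar>k s\<bar> \<le> B)"

lemma profile_exists:
  assumes "continuous_on UNIV k" "\<And>s. s \<ge> 2 \<Longrightarrow> k s = 0"
  shows "\<exists>B. profile B k"
proof -
  have "bounded (k ` {0..2})"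
    using assms(1) by (intro compact_imp_bounded compact_continuous_image) (auto intro: continuous_on_subset)
  then obtain B where B: "B > 0" "\<And>s. s \<in> {0..2} \<Longrightarrow> \<bar>k s\<bar> \<le> B"
    unfolding bounded_pos by auto
  have "\<bar>k s\<bar> \<le> B" if "s \<ge> 0" for s
    using B assms(2)[of s] that by (cases "s \<le> 2") auto
  with assms show ?thesis unfolding profile_def by blast
qed

lemma profile_nonneg: "profile B k \<Longrightarrow> 0 \<le> B"
  unfolding profile_def by (metis abs_ge_zero order_refl order_trans)

lemma kern_bound:
  assumes "profile B k" "0 < t"
  shows "\<bar>kern k t y x\<bar> \<le> (B * t ^ CARD('n)) * indicator (ball y (2 / t)) (x :: real ^ 'n::finite)"
proof (cases "x \<in> ball y (2 / t)")
  case True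
  have "\<bar>k (t^2 * ((x - y) \<bullet> (x - y)))\<bar> \<le> B"
    using assms unfolding profile_def by simp
  then have "t ^ CARD('n) * \<bar>k (t^2 * ((x - y) \<bullet> (x - y)))\<bar> \<le> t ^ CARD('n) * B"
    using assms by (intro mult_left_mono) simp_all
  then show ?thesis using True assms by (simp add: kern_def abs_mult mult.commute)
next
  case False
  then have "2 / t \<le> norm (x - y)" by (simp add: dist_norm norm_minus_commute)
  then have "2 \<le> t * norm (x - y)" using assms by (simp add: divide_le_eq mult.commute)
  \<comment> \<open>The profile vanishes already from 2 on; the radius 2/t gives 4, and spares the
    root in the exact radius.\<close>
  then have "2 * 2 \<le> (t * norm (x - y)) * (t * norm (x - y))" by (intro mult_mono) simp_all
  also have "\<dots> = t^2 * ((x - y) \<bullet> (x - y))"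
    by (simp add: power2_eq_square dot_square_norm mult_ac)
  finally have "k (t^2 * ((x - y) \<bullet> (x - y))) = 0" using assms unfolding profile_def by simp
  then show ?thesis using False by (simp add: kern_def)
qed

lemma kern_commute: "kern k t y x = kern k t x y"
  by (simp add: kern_def inner_diff inner_commute algebra_simps)

lemma kern_continuous:
  assumes "profile B k"
  shows "continuous_on UNIV (\<lambda>p :: (real ^ 'n::finite) \<times> (real ^ 'n). kern k t (snd p) (fst p))"
proof -
  have k: "continuous_on UNIV k" using assms unfolding profile_def by blast
  have "continuous_on UNIV (\<lambda>p :: (real ^ 'n) \<times> (real ^ 'n).
      t^2 * ((fst p - snd p) \<bullet> (fst p - snd p)))"
    by (intro continuous_intros)
  from continuous_on_compose2[OF k this]
  show ?thesis unfolding kern_def by (intro continuous_on_mult continuous_on_const) simp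
qed

lemma kern_measurable:
  assumes "profile B k"
  shows "kern k t y \<in> borel_measurable (borel :: (real ^ 'n::finite) measure)"
proof -
  have "continuous_on UNIV (\<lambda>x. kern k t (snd (x, y)) (fst (x, y)))"
    by (rule continuous_on_compose2[OF kern_continuous[OF assms]]) (auto intro!: continuous_intros)
  then show ?thesis by (intro borel_measurable_continuous_onI) simp
qed

lemma kern_integrable:
  fixes f :: "real ^ 'n::finite \<Rightarrow> 'b::{banach, second_countable_topology}"
  assumes "profile B k" "0 < t" "locint f"
  shows "integrable lborel (\<lambda>x. kern k t y x *\<^sub>R f x)"
proof (rule locint_bounded_integrable[OF assms(3) kern_measurable[OF assms(1)]])
  show "\<bar>kern k t y x\<bar> \<le> (B * t ^ CARD('n)) * indicator (ball 0 (norm y + 2 / t)) x" for x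
  proof -
    have "norm x < norm y + 2 / t" if "x \<in> ball y (2 / t)"
      using that norm_triangle_ineq2[of x y] by (simp add: dist_norm norm_minus_commute)
    then show ?thesis
      using kern_bound[OF assms(1,2), of y x] profile_nonneg[OF assms(1)] assms(2)
      by (cases "x \<in> ball y (2 / t)") (auto simp: indicator_def)
  qed
qed

lemma rconv_norm_le:
  fixes f :: "real ^ 'n::finite \<Rightarrow> complex"
  assumes "profile B k" "0 < t" "locint f"
  shows "ennreal (norm (rconv k t f y)) \<le>
    ennreal (B * t ^ CARD('n)) * (\<integral>\<^sup>+x. ennreal (norm (f x)) * indicator (ball y (2 / t)) x \<partial>lborel)"
proof -
  have m: "f \<in> borel_measurable borel" using assms unfolding locint_def by blast
  have nn: "0 \<le> B * t ^ CARD('n)" using profile_nonneg[OF assms(1)] assms(2) by simp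
  have "ennreal (norm (rconv k t f y)) \<le> (\<integral>\<^sup>+x. ennreal (norm (kern k t y x *\<^sub>R f x)) \<partial>lborel)"
    unfolding rconv_def by (rule integral_norm_bound_ennreal[OF kern_integrable[OF assms]])
  also have "\<dots> \<le> (\<integral>\<^sup>+x. ennreal (B * t ^ CARD('n)) * (ennreal (norm (f x)) * indicator (ball y (2 / t)) x) \<partial>lborel)"
  proof (rule nn_integral_mono)
    fix x
    have "norm (kern k t y x *\<^sub>R f x) \<le> (B * t ^ CARD('n) * indicator (ball y (2 / t)) x) * norm (f x)"
      using mult_right_mono[OF kern_bound[OF assms(1,2), of y x] norm_ge_zero[of "f x"]] by simp
    also have "\<dots> = (B * t ^ CARD('n)) * (norm (f x) * indicator (ball y (2 / t)) x)" by (simp only: mult_ac)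
    finally have "ennreal (norm (kern k t y x *\<^sub>R f x)) \<le> ennreal ((B * t ^ CARD('n)) * (norm (f x) * indicator (ball y (2 / t)) x))"
      by (rule ennreal_leI)
    also have "\<dots> = ennreal (B * t ^ CARD('n)) * (ennreal (norm (f x)) * indicator (ball y (2 / t)) x)"
      using nn by (simp add: ennreal_mult ennreal_indicator)
    finally show "ennreal (norm (kern k t y x *\<^sub>R f x))
      \<le> ennreal (B * t ^ CARD('n)) * (ennreal (norm (f x)) * indicator (ball y (2 / t)) x)" .
  qed
  also have "\<dots> = ennreal (B * t ^ CARD('n)) * (\<integral>\<^sup>+x. ennreal (norm (f x)) * indicator (ball y (2 / t)) x \<partial>lborel)"
    using m by (intro nn_integral_cmult borel_measurable_times_ennreal borel_measurable_indicator) simp_all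
  finally show ?thesis .
qed

section \<open>Fubini for the mollification and its limit at small scales\<close>

lemma lborel_integral_affine:
  fixes h :: "'a::euclidean_space \<Rightarrow> 'b::{banach, second_countable_topology}"
  assumes "h \<in> borel_measurable borel" "t \<noteq> 0"
  shows "(\<integral>y. h y \<partial>lborel) = (\<integral>z. \<bar>t\<bar> ^ DIM('a) *\<^sub>R h (x + t *\<^sub>R z) \<partial>lborel)"
proof -
  have "(\<integral>y. h y \<partial>lborel) =
      (\<integral>y. h y \<partial>density (distr lborel borel (\<lambda>z. x + t *\<^sub>R z)) (\<lambda>_. ennreal (\<bar>t\<bar> ^ DIM('a))))"
    using lborel_affine[OF assms(2), of x] by (simp add: ennreal_power)
  also have "\<dots> = (\<integral>y. \<bar>t\<bar> ^ DIM('a) *\<^sub>R h y \<partial>distr lborel borel (\<lambda>z. x + t *\<^sub>R z))"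
    using assms by (intro integral_density) auto
  also have "\<dots> = (\<integral>z. \<bar>t\<bar> ^ DIM('a) *\<^sub>R h (x + t *\<^sub>R z) \<partial>lborel)"
    using assms(1) by (intro integral_distr) (auto intro!: borel_measurable_scaleR)
  finally show ?thesis .
qed

lemma locint_const: "locint (\<lambda>x :: real ^ 'n::finite. c :: 'b::{banach, second_countable_topology})"
proof -
  have "integrable lborel (indicator (ball (0 :: real ^ 'n) R) :: _ \<Rightarrow> real)" for R
    using emeasure_lborel_ball_finite[of "0 :: real ^ 'n" R]
    by (intro integrable_real_indicator) (simp_all add: less_top)
  then show ?thesis unfolding locint_def by (auto intro: integrable_scaleR_left)
qed

text \<open>The substitution moves the scale from the kernel into the test function. What remains is
  one fixed integrable kernel, to which dominated convergence applies as t grows.\<close>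

lemma kern_test_integral:
  fixes \<psi> :: "real ^ 'n::finite \<Rightarrow> real"
  assumes "profile B k" "0 < t" "continuous_on UNIV \<psi>"
  shows "(\<integral>y. \<psi> y * kern k t y x \<partial>lborel) = (\<integral>z. k (z \<bullet> z) * \<psi> (x + (1 / t) *\<^sub>R z) \<partial>lborel)"
proof -
  have m: "(\<lambda>y. \<psi> y * kern k t y x) \<in> borel_measurable borel"
    unfolding kern_commute[of k t _ x]
    by (intro borel_measurable_times borel_measurable_continuous_onI[OF assms(3)] kern_measurable[OF assms(1)])
  have "(\<integral>y. \<psi> y * kern k t y x \<partial>lborel) = (\<integral>z. \<bar>1 / t\<bar> ^ DIM(real ^ 'n) *\<^sub>R
      (\<psi> (x + (1 / t) *\<^sub>R z) * kern k t (x + (1 / t) *\<^sub>R z) x) \<partial>lborel)"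
    by (rule lborel_integral_affine[OF m]) (use assms in simp)
  also have "\<dots> = (\<integral>z. k (z \<bullet> z) * \<psi> (x + (1 / t) *\<^sub>R z) \<partial>lborel)"
  proof (rule Bochner_Integration.integral_cong[OF refl])
    fix z :: "real ^ 'n"
    have "t^2 * ((x - (x + (1 / t) *\<^sub>R z)) \<bullet> (x - (x + (1 / t) *\<^sub>R z))) = z \<bullet> z"
      using assms(2) by (simp add: power2_eq_square)
    moreover have "\<bar>1 / t\<bar> ^ CARD('n) * t ^ CARD('n) = 1"
      using assms(2) by (simp add: power_mult_distrib[symmetric])
    ultimately show "\<bar>1 / t\<bar> ^ DIM(real ^ 'n) *\<^sub>R (\<psi> (x + (1 / t) *\<^sub>R z) * kern k t (x + (1 / t) *\<^sub>R z) x)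
        = k (z \<bullet> z) * \<psi> (x + (1 / t) *\<^sub>R z)"
      unfolding kern_def by (simp add: mult.assoc[symmetric]) 
  qed
  finally show ?thesis .
qed

lemma profile_sq:
  assumes "profile B k"
  shows "integrable lborel (\<lambda>z :: real ^ 'n::finite. k (z \<bullet> z))"
proof -
  have "integrable lborel (\<lambda>x :: real ^ 'n. kern k 1 0 x *\<^sub>R (1::real))"
    using assms locint_const by (intro kern_integrable) simp_all
  then show ?thesis by (simp add: kern_def)
qed

lemma lborel_integrable_tensor:
  fixes a :: "'a::euclidean_space \<Rightarrow> real" and c :: "'b::euclidean_space \<Rightarrow> real"
  assumes "integrable lborel a" "integrable lborel c"
  shows "integrable (lborel :: ('a \<times> 'b) measure) (\<lambda>p. a (fst p) * c (snd p))"
proof -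
  have m: "a \<in> borel_measurable borel" "c \<in> borel_measurable borel"
    using assms by (auto dest: borel_measurable_integrable)
  have "integrable (lborel \<Otimes>\<^sub>M lborel) (\<lambda>p. a (fst p) * c (snd p))"
  proof (rule lborel_pair.Fubini_integrable)
    show "(\<lambda>p. a (fst p) * c (snd p)) \<in> borel_measurable (lborel \<Otimes>\<^sub>M lborel)"
      by (intro borel_measurable_times measurable_compose[OF measurable_fst] measurable_compose[OF measurable_snd])
         (simp_all add: m)
    show "integrable lborel (\<lambda>x. \<integral>y. norm (a (fst (x, y)) * c (snd (x, y))) \<partial>lborel)"
      using integrable_mult_left[OF integrable_abs[OF assms(1)], of "\<integral>y. \<bar>c y\<bar> \<partial>lborel"]
      by (simp add: abs_mult)
    show "AE x in lborel. integrable lborel (\<lambda>y. a (fst (x, y)) * c (snd (x, y)))"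
      using assms(2) by (intro AE_I2) simp
  qed
  then show ?thesis by (simp add: lborel_prod)
qed

text \<open>As f is only locally integrable, integrability on the product comes from the supports: y
  in the ball of radius R and x within 2/t of y confine x to the ball of radius R + 2/t, which
  yields a product majorant.\<close>

lemma rconv_fubini:
  fixes f :: "real ^ 'n::finite \<Rightarrow> complex"
  assumes k: "profile B k" and t: "0 < t" and f: "locint f" and M: "0 \<le> M"
    and \<psi>: "continuous_on UNIV \<psi>" "\<And>x. \<bar>\<psi> x\<bar> \<le> M * indicator (ball 0 R) x"
  shows "(\<integral>y. \<psi> y *\<^sub>R rconv k t f y \<partial>lborel) = (\<integral>x. (\<integral>y. \<psi> y * kern k t y x \<partial>lborel) *\<^sub>R f x \<partial>lborel)"
proof -
  have mf: "f \<in> borel_measurable borel" using f unfolding locint_def by blast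
  have m\<psi>: "\<psi> \<in> borel_measurable borel" using \<psi>(1) by (rule borel_measurable_continuous_onI)
  define C where "C = M * (B * t ^ CARD('n))"
  have B: "0 \<le> B * t ^ CARD('n)" using profile_nonneg[OF k] t by simp
  have C: "0 \<le> C" unfolding C_def using M B by simp
  let ?F = "\<lambda>p. (\<psi> (snd p) * kern k t (snd p) (fst p)) *\<^sub>R f (fst p)"
  have fst: "fst \<in> borel_measurable (borel :: ((real^'n) \<times> (real^'n)) measure)"
    and snd: "snd \<in> borel_measurable (borel :: ((real^'n) \<times> (real^'n)) measure)"
    by (intro borel_measurable_continuous_onI continuous_on_fst continuous_on_snd continuous_on_id)+
  have mF: "?F \<in> borel_measurable borel"
    by (intro borel_measurable_scaleR borel_measurable_times measurable_compose[OF fst mf]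
        measurable_compose[OF snd m\<psi>] borel_measurable_continuous_onI[OF kern_continuous[OF k]])
  have ia: "integrable lborel (\<lambda>x. norm (indicator (ball 0 (R + 2 / t)) x *\<^sub>R f x))"
    using f unfolding locint_def by (intro integrable_norm) blast
  have ic: "integrable lborel (\<lambda>y :: real ^ 'n. C * indicator (ball 0 R) y)"
  proof -
    have "integrable lborel (indicator (ball (0 :: real ^ 'n) R) :: _ \<Rightarrow> real)"
    proof -
      have "locint (\<lambda>x :: real ^ 'n. 1 :: real)" by (rule locint_const)
      then show ?thesis unfolding locint_def by simp
    qed
    then show ?thesis by (rule integrable_mult_right)
  qed
  have iF: "integrable (lborel :: ((real^'n) \<times> (real^'n)) measure) ?F"
  proof (rule Bochner_Integration.integrable_bound[OF lborel_integrable_tensor[OF ia ic]])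
    show "?F \<in> borel_measurable lborel" using mF by simp
    show "AE p in lborel. norm (?F p)
      \<le> norm (norm (indicator (ball 0 (R + 2 / t)) (fst p) *\<^sub>R f (fst p)) * (C * indicator (ball 0 R) (snd p)))"
    proof (rule AE_I2)
      fix p :: "(real^'n) \<times> (real^'n)"
      obtain x y where p: "p = (x, y)" by (cases p)
      have 1: "\<bar>\<psi> y\<bar> * \<bar>kern k t y x\<bar> \<le> C * (indicator (ball 0 R) y * indicator (ball 0 (R + 2 / t)) x)"
      proof (cases "y \<in> ball 0 R \<and> x \<in> ball y (2 / t)")
        case True
        then have "norm x < R + 2 / t"
          using norm_triangle_ineq2[of x y] by (simp add: dist_norm norm_minus_commute)
        then show ?thesis
          using mult_mono[OF \<psi>(2)[of y] kern_bound[OF k t, of y x]] True M B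
          by (simp add: C_def)
      next
        case False
        then have "\<psi> y = 0 \<or> kern k t y x = 0"
          using \<psi>(2)[of y] kern_bound[OF k t, of y x] by (cases "y \<in> ball 0 R") simp_all
        then have "\<bar>\<psi> y\<bar> * \<bar>kern k t y x\<bar> = 0" by (elim disjE) simp_all
        moreover have "0 \<le> C * (indicator (ball 0 R) y * indicator (ball 0 (R + 2 / t)) x :: real)"
          using C by simp
        ultimately show ?thesis by linarith
      qed
      have "norm (?F p) = (\<bar>\<psi> y\<bar> * \<bar>kern k t y x\<bar>) * norm (f x)"
        by (simp add: p abs_mult)
      also have "\<dots> \<le> (C * (indicator (ball 0 R) y * indicator (ball 0 (R + 2 / t)) x)) * norm (f x)"
        by (rule mult_right_mono[OF 1 norm_ge_zero])
      also have "\<dots> = norm (norm (indicator (ball 0 (R + 2 / t)) (fst p) *\<^sub>R f (fst p)) * (C * indicator (ball 0 R) (snd p)))"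
        using C by (simp add: p abs_mult)
      finally show "norm (?F p)
        \<le> norm (norm (indicator (ball 0 (R + 2 / t)) (fst p) *\<^sub>R f (fst p)) * (C * indicator (ball 0 R) (snd p)))" .
    qed
  qed
  then have iF': "integrable (lborel \<Otimes>\<^sub>M lborel) (case_prod (\<lambda>x y. (\<psi> y * kern k t y x) *\<^sub>R f x))"
    by (simp add: lborel_prod case_prod_unfold)
  have "(\<integral>y. \<psi> y *\<^sub>R rconv k t f y \<partial>lborel) = (\<integral>y. \<integral>x. (\<psi> y * kern k t y x) *\<^sub>R f x \<partial>lborel \<partial>lborel)"
    unfolding rconv_def by (simp only: integral_scaleR_right[symmetric] scaleR_scaleR)
  also have "\<dots> = (\<integral>x. \<integral>y. (\<psi> y * kern k t y x) *\<^sub>R f x \<partial>lborel \<partial>lborel)"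
    by (rule lborel_pair.Fubini_integral[OF iF'])
  also have "\<dots> = (\<integral>x. (\<integral>y. \<psi> y * kern k t y x \<partial>lborel) *\<^sub>R f x \<partial>lborel)"
  proof (rule Bochner_Integration.integral_cong[OF refl])
    fix x
    have "locint \<psi>"
    proof -
      have "integrable lborel (\<lambda>x. indicator (ball 0 r) x *\<^sub>R \<psi> x)" for r
      proof (rule Bochner_Integration.integrable_bound)
        show "integrable lborel (\<lambda>y :: real ^ 'n. M *\<^sub>R (indicator (ball 0 R) y *\<^sub>R (1::real)))"
          using locint_const[of "1::real"] unfolding locint_def by (intro integrable_scaleR_right) blast
        show "(\<lambda>x. indicator (ball 0 r) x *\<^sub>R \<psi> x) \<in> borel_measurable lborel"
          using m\<psi> by (intro borel_measurable_scaleR borel_measurable_indicator) simp_all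
        show "AE x in lborel. norm (indicator (ball 0 r) x *\<^sub>R \<psi> x) \<le> norm (M *\<^sub>R (indicator (ball 0 R) x *\<^sub>R (1::real)))"
        proof (rule AE_I2)
          fix x
          show "norm (indicator (ball 0 r) x *\<^sub>R \<psi> x) \<le> norm (M *\<^sub>R (indicator (ball 0 R) x *\<^sub>R (1::real)))"
            using \<psi>(2)[of x] M by (cases "x \<in> ball 0 r"; cases "x \<in> ball 0 R") simp_all
        qed
      qed
      then show ?thesis unfolding locint_def using m\<psi> by blast
    qed
    then have "integrable lborel (\<lambda>y. kern k t x y *\<^sub>R \<psi> y)" by (rule kern_integrable[OF k t])
    then have "integrable lborel (\<lambda>y. \<psi> y * kern k t y x)"
      by (simp add: kern_commute[of k t x] mult.commute)
    then show "(\<integral>y. (\<psi> y * kern k t y x) *\<^sub>R f x \<partial>lborel) = (\<integral>y. \<psi> y * kern k t y x \<partial>lborel) *\<^sub>R f x"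
      by (rule integral_scaleR_left)
  qed
  finally show ?thesis .
qed

lemma sets_borel_pair_lborel:
  "sets (borel \<Otimes>\<^sub>M lborel) = sets (borel :: ('a::euclidean_space \<times> 'b::euclidean_space) measure)"
proof -
  have "sets (borel \<Otimes>\<^sub>M lborel) = sets ((borel :: 'a measure) \<Otimes>\<^sub>M (borel :: 'b measure))"
    by (intro sets_pair_measure_cong refl sets_lborel)
  then show ?thesis by (simp only: borel_prod)
qed

lemma rconv_measurable:
  fixes f :: "real ^ 'n::finite \<Rightarrow> complex"
  assumes k: "profile B k" and f: "f \<in> borel_measurable borel"
  shows "rconv k t f \<in> borel_measurable borel"
proof -
  have "(\<lambda>p :: (real^'n) \<times> (real^'n). kern k t (fst p) (snd p) *\<^sub>R f (snd p)) \<in> borel_measurable borel"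
    unfolding kern_commute[of k t "fst _"]
    by (intro borel_measurable_scaleR borel_measurable_continuous_onI[OF kern_continuous[OF k]]
        measurable_compose[OF _ f] borel_measurable_continuous_onI continuous_on_snd continuous_on_id)
  then have "(\<lambda>(y :: real^'n, x). kern k t y x *\<^sub>R f x) \<in> borel_measurable (borel \<Otimes>\<^sub>M lborel)"
    by (subst measurable_cong_sets[OF sets_borel_pair_lborel refl]) (simp only: case_prod_unfold)
  from sigma_finite_measure.borel_measurable_lebesgue_integral[OF sigma_finite_lborel this]
  show ?thesis unfolding rconv_def .
qed

lemma kern_test_measurable:
  fixes \<psi> :: "real ^ 'n::finite \<Rightarrow> real"
  assumes k: "profile B k" and f: "\<psi> \<in> borel_measurable borel"
  shows "(\<lambda>x. \<integral>y. \<psi> y * kern k t y x \<partial>lborel) \<in> borel_measurable borel"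
proof -
  have "(\<lambda>p :: (real^'n) \<times> (real^'n). \<psi> (snd p) * kern k t (snd p) (fst p)) \<in> borel_measurable borel"
    by (intro borel_measurable_times borel_measurable_continuous_onI[OF kern_continuous[OF k]]
        measurable_compose[OF _ f] borel_measurable_continuous_onI continuous_on_snd continuous_on_id)
  then have "(\<lambda>(x :: real^'n, y). \<psi> y * kern k t y x) \<in> borel_measurable (borel \<Otimes>\<^sub>M lborel)"
    by (subst measurable_cong_sets[OF sets_borel_pair_lborel refl]) (simp only: case_prod_unfold)
  from sigma_finite_measure.borel_measurable_lebesgue_integral[OF sigma_finite_lborel this]
  show ?thesis .
qed

text \<open>Fubini lets the mollification fall on \<psi>, where continuity and total mass 1 give
  pointwise convergence.\<close>

lemma rconv_weak_limit:
  fixes f :: "real ^ 'n::finite \<Rightarrow> complex"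
  assumes k: "profile B k" and int1: "(\<integral>z. k (z \<bullet> z) \<partial>(lborel :: (real ^ 'n) measure)) = 1" and f: "locint f"
    and M: "0 \<le> M" and \<psi>: "continuous_on UNIV \<psi>" "\<And>x. \<bar>\<psi> x\<bar> \<le> M * indicator (ball 0 R) x"
  shows "(\<lambda>m. \<integral>y. \<psi> y *\<^sub>R rconv k (2 ^ m) f y \<partial>lborel) \<longlonglongrightarrow> (\<integral>x. \<psi> x *\<^sub>R f x \<partial>lborel)"
proof -
  have mf: "f \<in> borel_measurable borel" using f unfolding locint_def by blast
  have m\<psi>: "\<psi> \<in> borel_measurable borel" using \<psi>(1) by (rule borel_measurable_continuous_onI)
  have \<psi>M: "\<bar>\<psi> x\<bar> \<le> M" for x using \<psi>(2)[of x] M by (cases "x \<in> ball 0 R") simp_all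
  have ik: "integrable lborel (\<lambda>z :: real ^ 'n. k (z \<bullet> z))" by (rule profile_sq[OF k])
  define I where "I = (\<integral>z. \<bar>k (z \<bullet> z)\<bar> \<partial>(lborel :: (real ^ 'n) measure))"
  define P where "P m x = (\<integral>y. \<psi> y * kern k (2 ^ m) y x \<partial>lborel)" for m :: nat and x
  have P_eq: "P m x = (\<integral>z. k (z \<bullet> z) * \<psi> (x + (1 / 2 ^ m) *\<^sub>R z) \<partial>lborel)" for m x
    unfolding P_def by (rule kern_test_integral[OF k _ \<psi>(1)]) simp
  have mint: "(\<lambda>z. k (z \<bullet> z) * \<psi> (x + c *\<^sub>R z)) \<in> borel_measurable lborel" for x c
  proof -
    have "continuous_on UNIV (\<lambda>z. \<psi> (x + c *\<^sub>R z))"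
      by (rule continuous_on_compose2[OF \<psi>(1)]) (auto intro!: continuous_intros)
    then have "(\<lambda>z. \<psi> (x + c *\<^sub>R z)) \<in> borel_measurable lborel"
      using borel_measurable_continuous_onI by simp
    with borel_measurable_integrable[OF ik] show ?thesis by (rule borel_measurable_times)
  qed
  have bint: "norm (k (z \<bullet> z) * \<psi> (x + c *\<^sub>R z)) \<le> M * \<bar>k (z \<bullet> z)\<bar>" for x c and z :: "real ^ 'n"
    using mult_left_mono[OF \<psi>M[of "x + c *\<^sub>R z"] abs_ge_zero[of "k (z \<bullet> z)"]]
    by (simp add: abs_mult mult.commute)
  have iM: "integrable lborel (\<lambda>z :: real ^ 'n. M * \<bar>k (z \<bullet> z)\<bar>)"
    using ik by (intro integrable_mult_right integrable_abs)
  have Pbd: "\<bar>P m x\<bar> \<le> M * I" for m x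
  proof -
    have "norm (P m x) \<le> (\<integral>z. M * \<bar>k (z \<bullet> z)\<bar> \<partial>(lborel :: (real ^ 'n) measure))"
      unfolding P_eq
    proof (rule Bochner_Integration.integral_norm_bound_integral)
      show "integrable lborel (\<lambda>z. k (z \<bullet> z) * \<psi> (x + (1 / 2 ^ m) *\<^sub>R z))"
      proof (rule Bochner_Integration.integrable_bound[OF iM mint], rule AE_I2)
        show "norm (k (z \<bullet> z) * \<psi> (x + (1 / 2 ^ m) *\<^sub>R z)) \<le> norm (M * \<bar>k (z \<bullet> z)\<bar>)" for z
          using order_trans[OF bint abs_ge_self] by simp
      qed
      show "integrable lborel (\<lambda>z :: real ^ 'n. M * \<bar>k (z \<bullet> z)\<bar>)" by (rule iM)
      show "norm (k (z \<bullet> z) * \<psi> (x + (1 / 2 ^ m) *\<^sub>R z)) \<le> M * \<bar>k (z \<bullet> z)\<bar>" for z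
        by (rule bint)
    qed
    also have "\<dots> = M * I" unfolding I_def by (rule integral_mult_right_zero)
    finally show ?thesis by simp
  qed
  \<comment> \<open>One ball for all m, since 2 / 2^m \<le> 2; f is integrable on it, which supplies
    the majorant for the final limit.\<close>
  have Pz: "P m x = 0" if "x \<notin> ball 0 (R + 2)" for m x
  proof -
    have "\<psi> y * kern k (2 ^ m) y x = 0" for y
    proof (cases "y \<in> ball 0 R")
      case True
      have "(2::real) / 2 ^ m \<le> 2" by (simp add: divide_le_eq)
      then have "x \<notin> ball y (2 / 2 ^ m)"
        using that True norm_triangle_ineq2[of x y] by (simp add: dist_norm norm_minus_commute)
      then show ?thesis using kern_bound[OF k, of "2 ^ m" y x] by simp
    next
      case False
      then show ?thesis using \<psi>(2)[of y] by simp
    qed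
    then have "(\<lambda>y. \<psi> y * kern k (2 ^ m) y x) = (\<lambda>_. 0)" by (rule ext)
    then show ?thesis unfolding P_def by (simp only: Bochner_Integration.integral_zero)
  qed
  have lim: "(\<lambda>m. P m x) \<longlonglongrightarrow> \<psi> x" for x
  proof -
    have "(\<lambda>m. \<integral>z. k (z \<bullet> z) * \<psi> (x + (1 / 2 ^ m) *\<^sub>R z) \<partial>lborel) \<longlonglongrightarrow> (\<integral>z. k (z \<bullet> z) * \<psi> x \<partial>(lborel :: (real ^ 'n) measure))"
    proof (rule integral_dominated_convergence[where f="\<lambda>z :: real ^ 'n. k (z \<bullet> z) * \<psi> x"
          and s="\<lambda>m z. k (z \<bullet> z) * \<psi> (x + (1 / 2 ^ m) *\<^sub>R z)" and w="\<lambda>z. M * \<bar>k (z \<bullet> z)\<bar>"])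
      show "(\<lambda>z. k (z \<bullet> z) * \<psi> (x + (1 / 2 ^ m) *\<^sub>R z)) \<in> borel_measurable lborel" for m
        by (rule mint)
      show "integrable lborel (\<lambda>z :: real ^ 'n. M * \<bar>k (z \<bullet> z)\<bar>)" by (rule iM)
      show "(\<lambda>z :: real ^ 'n. k (z \<bullet> z) * \<psi> x) \<in> borel_measurable lborel"
        using mint[of x 0] by simp
      show "AE z in lborel. (\<lambda>m. k (z \<bullet> z) * \<psi> (x + (1 / 2 ^ m) *\<^sub>R z)) \<longlonglongrightarrow> k (z \<bullet> z) * \<psi> x"
      proof (rule AE_I2)
        fix z :: "real ^ 'n"
        have "(\<lambda>m. (1 / 2) ^ m :: real) \<longlonglongrightarrow> 0" by (intro LIMSEQ_realpow_zero) simp_all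
        then have "(\<lambda>m. x + ((1 / 2) ^ m) *\<^sub>R z) \<longlonglongrightarrow> x + 0 *\<^sub>R z"
          by (intro tendsto_add tendsto_scaleR tendsto_const)
        then have "(\<lambda>m. x + (1 / 2 ^ m) *\<^sub>R z) \<longlonglongrightarrow> x" by (simp add: power_one_over)
        moreover have "isCont \<psi> x" using \<psi>(1) by (simp add: continuous_on_eq_continuous_at)
        ultimately have "(\<lambda>m. \<psi> (x + (1 / 2 ^ m) *\<^sub>R z)) \<longlonglongrightarrow> \<psi> x" by (rule isCont_tendsto_compose[rotated])
        then show "(\<lambda>m. k (z \<bullet> z) * \<psi> (x + (1 / 2 ^ m) *\<^sub>R z)) \<longlonglongrightarrow> k (z \<bullet> z) * \<psi> x"
          by (rule tendsto_mult_left)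
      qed
      show "AE z in lborel. norm (k (z \<bullet> z) * \<psi> (x + (1 / 2 ^ m) *\<^sub>R z)) \<le> M * \<bar>k (z \<bullet> z)\<bar>" for m
        by (intro AE_I2 bint)
    qed
    moreover have "(\<integral>z. k (z \<bullet> z) * \<psi> x \<partial>(lborel :: (real ^ 'n) measure)) = \<psi> x"
      using int1 by simp
    ultimately show ?thesis unfolding P_eq by (simp only:)
  qed
  have "(\<lambda>m. \<integral>x. P m x *\<^sub>R f x \<partial>lborel) \<longlonglongrightarrow> (\<integral>x. \<psi> x *\<^sub>R f x \<partial>lborel)"
  proof (rule integral_dominated_convergence)
    show "(\<lambda>x. \<psi> x *\<^sub>R f x) \<in> borel_measurable lborel"
      using mf m\<psi> by (intro borel_measurable_scaleR) simp_all
    show "(\<lambda>x. P m x *\<^sub>R f x) \<in> borel_measurable lborel" for m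
      unfolding P_def using mf kern_test_measurable[OF k m\<psi>] by (intro borel_measurable_scaleR) simp_all
    show "integrable lborel (\<lambda>x. M * I * norm (indicator (ball 0 (R + 2)) x *\<^sub>R f x))"
      using f unfolding locint_def by (intro integrable_mult_right integrable_norm) blast
    show "AE x in lborel. (\<lambda>m. P m x *\<^sub>R f x) \<longlonglongrightarrow> \<psi> x *\<^sub>R f x"
      by (intro AE_I2 tendsto_scaleR lim tendsto_const)
    show "AE x in lborel. norm (P m x *\<^sub>R f x) \<le> M * I * norm (indicator (ball 0 (R + 2)) x *\<^sub>R f x)" for m
    proof (rule AE_I2)
      fix x
      show "norm (P m x *\<^sub>R f x) \<le> M * I * norm (indicator (ball 0 (R + 2)) x *\<^sub>R f x)"
        using Pz[of x m] mult_right_mono[OF Pbd[of m x] norm_ge_zero[of "f x"]]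
        by (cases "x \<in> ball 0 (R + 2)") simp_all
    qed
  qed
  then show ?thesis
    unfolding P_def by (simp add: rconv_fubini[OF k _ f M \<psi>])
qed

lemma test_function_bounds:
  fixes \<psi> :: "real ^ 'n::finite \<Rightarrow> real"
  assumes "test_function \<psi>"
  shows "continuous_on UNIV \<psi>" "\<exists>M\<ge>0. \<exists>R. \<forall>x. \<bar>\<psi> x\<bar> \<le> M * indicator (ball 0 R) x"
proof -
  show c: "continuous_on UNIV \<psi>" using assms unfolding test_function_def by (metis C_k.simps(1))
  have comp: "compact (closure {x. \<psi> x \<noteq> 0})" using assms unfolding test_function_def by blast
  have "bounded (\<psi> ` closure {x. \<psi> x \<noteq> 0})"
    using c comp by (intro compact_imp_bounded compact_continuous_image) (auto intro: continuous_on_subset)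
  then obtain M where M: "M > 0" "\<And>x. x \<in> closure {x. \<psi> x \<noteq> 0} \<Longrightarrow> \<bar>\<psi> x\<bar> \<le> M"
    unfolding bounded_pos by auto
  obtain R where R: "closure {x. \<psi> x \<noteq> 0} \<subseteq> ball 0 R"
    using bounded_subset_ballD[OF compact_imp_bounded[OF comp]] by blast
  have "\<bar>\<psi> x\<bar> \<le> M * indicator (ball 0 R) x" for x
  proof (cases "\<psi> x = 0")
    case False
    then have x: "x \<in> closure {x. \<psi> x \<noteq> 0}" by (intro subsetD[OF closure_subset]) simp
    from M(2)[OF x] subsetD[OF R x] show ?thesis by simp
  qed (use M in simp)
  then show "\<exists>M\<ge>0. \<exists>R. \<forall>x. \<bar>\<psi> x\<bar> \<le> M * indicator (ball 0 R) x"
    using less_imp_le[OF M(1)] by (intro exI[of _ M] conjI exI[of _ R] allI)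
qed

lemma locint_diff:
  fixes f g :: "real ^ 'n::finite \<Rightarrow> 'b::{banach, second_countable_topology}"
  assumes "locint f" "locint g"
  shows "locint (\<lambda>x. f x - g x)"
proof -
  have "integrable lborel (\<lambda>x. indicator (ball 0 R) x *\<^sub>R f x - indicator (ball 0 R) x *\<^sub>R g x)" for R
    using assms unfolding locint_def by (intro Bochner_Integration.integrable_diff) blast+
  moreover have "(\<lambda>x. f x - g x) \<in> borel_measurable borel"
    using assms unfolding locint_def by (intro borel_measurable_diff) blast+
  ultimately show ?thesis unfolding locint_def by (simp add: scaleR_diff_right)
qed

lemma locint_dominated:
  fixes f :: "real ^ 'n::finite \<Rightarrow> 'b::{banach, second_countable_topology}" and D :: "real ^ 'n \<Rightarrow> real"
  assumes "locint D" "f \<in> borel_measurable borel" "AE x in lborel. norm (f x) \<le> D x"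
  shows "locint f"
  unfolding locint_def
proof (intro conjI allI)
  fix R
  show "integrable lborel (\<lambda>x. indicator (ball 0 R) x *\<^sub>R f x)"
  proof (rule Bochner_Integration.integrable_bound)
    show "integrable lborel (\<lambda>x. indicator (ball 0 R) x *\<^sub>R D x)"
      using assms unfolding locint_def by blast
    show "(\<lambda>x. indicator (ball 0 R) x *\<^sub>R f x) \<in> borel_measurable lborel"
      using assms(2) by (intro borel_measurable_scaleR borel_measurable_indicator) simp_all
    show "AE x in lborel. norm (indicator (ball 0 R) x *\<^sub>R f x) \<le> norm (indicator (ball 0 R) x *\<^sub>R D x)"
      using assms(3)
    proof eventually_elim
      case (elim x)
      then show ?case by (cases "x \<in> ball 0 R") simp_all
    qed
  qed
qed (rule assms(2))

text \<open>Identifies the limit produced by the energy estimates. Against a test function the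
  mollifications converge to the integral of l, by the majorant D, and to that of f, by the weak
  limit; the fundamental lemma concludes.\<close>

lemma rconv_limit_AE:
  fixes f l :: "real ^ 'n::finite \<Rightarrow> complex" and D :: "real ^ 'n \<Rightarrow> real"
  assumes k: "profile B k" and int1: "(\<integral>z. k (z \<bullet> z) \<partial>(lborel :: (real ^ 'n) measure)) = 1" and f: "locint f"
    and l: "l \<in> borel_measurable borel" and lim: "AE y in lborel. (\<lambda>m. rconv k (2 ^ m) f y) \<longlonglongrightarrow> l y"
    and D: "locint D" and dom: "\<And>m. AE y in lborel. norm (rconv k (2 ^ m) f y) \<le> D y"
  shows "AE y in lborel. l y = f y"
proof -
  have mf: "f \<in> borel_measurable borel" using f unfolding locint_def by blast
  have "AE y in lborel. \<forall>m. norm (rconv k (2 ^ m) f y) \<le> D y" using dom by (simp add: AE_all_countable)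
  with lim have "AE y in lborel. norm (l y) \<le> D y"
  proof eventually_elim
    case (elim y)
    show ?case by (rule LIMSEQ_le_const2[OF tendsto_norm[OF elim(1)]]) (use elim(2) in blast)
  qed
  then have ll: "locint l" by (rule locint_dominated[OF D l])
  have "(\<integral>x. \<psi> x *\<^sub>R (l x - f x) \<partial>lborel) = 0" if t: "test_function \<psi>" for \<psi>
  proof -
    obtain M R where M: "0 \<le> M" "\<And>x. \<bar>\<psi> x\<bar> \<le> M * indicator (ball 0 R) x"
      using test_function_bounds(2)[OF t] by blast
    have m\<psi>: "\<psi> \<in> borel_measurable borel"
      using test_function_bounds(1)[OF t] by (rule borel_measurable_continuous_onI)
    have "(\<lambda>m. \<integral>y. \<psi> y *\<^sub>R rconv k (2 ^ m) f y \<partial>lborel) \<longlonglongrightarrow> (\<integral>x. \<psi> x *\<^sub>R l x \<partial>lborel)"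
    proof (rule integral_dominated_convergence)
      show "(\<lambda>x. \<psi> x *\<^sub>R l x) \<in> borel_measurable lborel"
        using l m\<psi> by (intro borel_measurable_scaleR) simp_all
      show "(\<lambda>x. \<psi> x *\<^sub>R rconv k (2 ^ m) f x) \<in> borel_measurable lborel" for m
        using rconv_measurable[OF k mf] m\<psi> by (intro borel_measurable_scaleR) simp_all
      show "integrable lborel (\<lambda>x. M * (indicator (ball 0 R) x *\<^sub>R D x))"
        using D unfolding locint_def by (intro integrable_mult_right) blast
      show "AE x in lborel. (\<lambda>m. \<psi> x *\<^sub>R rconv k (2 ^ m) f x) \<longlonglongrightarrow> \<psi> x *\<^sub>R l x"
        using lim by eventually_elim (intro tendsto_scaleR tendsto_const)
      show "AE x in lborel. norm (\<psi> x *\<^sub>R rconv k (2 ^ m) f x) \<le> M * (indicator (ball 0 R) x *\<^sub>R D x)" for m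
        using dom[of m]
      proof eventually_elim
        case (elim x)
        have "\<bar>\<psi> x\<bar> * norm (rconv k (2 ^ m) f x) \<le> (M * indicator (ball 0 R) x) * D x"
          using M elim by (intro mult_mono) simp_all
        then show ?case by (simp add: mult.assoc)
      qed
    qed
    from LIMSEQ_unique[OF this rconv_weak_limit[OF k int1 f M(1) test_function_bounds(1)[OF t] M(2)]]
    have "(\<integral>x. \<psi> x *\<^sub>R l x \<partial>lborel) = (\<integral>x. \<psi> x *\<^sub>R f x \<partial>lborel)" .
    moreover have "integrable lborel (\<lambda>x. \<psi> x *\<^sub>R l x)" "integrable lborel (\<lambda>x. \<psi> x *\<^sub>R f x)"
      by (rule locint_bounded_integrable[OF ll m\<psi> M(2)], rule locint_bounded_integrable[OF f m\<psi> M(2)])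
    ultimately show ?thesis by (simp add: scaleR_diff_right)
  qed
  from fundamental_lemma[OF locint_diff[OF ll f] this] show ?thesis by simp
qed

section \<open>The mollifier and its telescoping identity\<close>

text \<open>A relation between Borel functions. Only the sum of the pure second derivatives is
  retained, since the telescoping identity pairs f with the Laplacian of one test function.\<close>

definition weak_lap :: "(real ^ 'n \<Rightarrow> complex) \<Rightarrow> (real ^ 'n \<Rightarrow> complex) \<Rightarrow> bool" where
  "weak_lap f g \<longleftrightarrow> (\<forall>\<psi>. test_function \<psi> \<longrightarrow>
    (\<integral>x. (\<Sum>i\<in>UNIV. partial_deriv i (partial_deriv i \<psi>) x) *\<^sub>R f x \<partial>lborel) = (\<integral>x. \<psi> x *\<^sub>R g x \<partial>lborel))"

text \<open>\<open>TN\<close> only carries the dimension. The last clause is the equation of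
  \<open>bump_pair\<close> at the point t (x - y); the factor \<open>t^2\<close> is the chain
  rule.\<close>

definition mollifier_pair :: "'n::finite itself \<Rightarrow> real \<Rightarrow> (real \<Rightarrow> real) \<Rightarrow> (real \<Rightarrow> real) \<Rightarrow> bool" where
  "mollifier_pair TN B \<Phi> w \<longleftrightarrow> profile B \<Phi> \<and> profile B w \<and>
    (\<integral>z. \<Phi> (z \<bullet> z) \<partial>(lborel :: (real ^ 'n) measure)) = 1 \<and>
    (\<forall>t>0. \<forall>y :: real ^ 'n. test_function (\<lambda>x. w (t^2 * ((x - y) \<bullet> (x - y)))) \<and>
      (\<forall>x. (\<Sum>i\<in>UNIV. partial_deriv i (partial_deriv i (\<lambda>x. w (t^2 * ((x - y) \<bullet> (x - y))))) x) =
        t^2 * (\<Phi> (t^2 * ((x - y) \<bullet> (x - y))) - 2 ^ CARD('n) * \<Phi> (4 * (t^2 * ((x - y) \<bullet> (x - y)))))))"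

lemma profile_cmult: "profile B k \<Longrightarrow> profile (\<bar>c\<bar> * B) (\<lambda>s. c * k s)"
  unfolding profile_def by (auto intro!: continuous_on_mult continuous_on_const mult_left_mono simp: abs_mult)

lemma profile_mono: "profile B k \<Longrightarrow> B \<le> B' \<Longrightarrow> profile B' k"
  unfolding profile_def by (meson order_trans)

lemma mollifier_pair_exists: "\<exists>B \<Phi> w. mollifier_pair TYPE('n::finite) B \<Phi> w"
proof -
  obtain \<Phi> w w' w'' where "bump_pair (real CARD('n)) \<Phi> w w' w''"
    using bump_pair_exists by blast
  then have sm: "smooth1 \<Phi>" "smooth1 w"
    and d: "\<And>s. (w has_real_derivative w' s) (at s)" "\<And>s. (w' has_real_derivative w'' s) (at s)"
    and pos: "\<And>s. 0 \<le> \<Phi> s" "\<And>s. 1 < s \<Longrightarrow> s < 2 \<Longrightarrow> 0 < \<Phi> s"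
    and supp: "\<And>s. 2 \<le> s \<Longrightarrow> \<Phi> s = 0" "\<And>s. 2 \<le> s \<Longrightarrow> w s = 0"
    and eq: "\<And>s. 0 \<le> s \<Longrightarrow> 2 * real CARD('n) * w' s + 4 * s * w'' s = \<Phi> s - 2 powr real CARD('n) * \<Phi> (4 * s)"
    unfolding bump_pair_def by blast+
  obtain B1 where B1: "profile B1 \<Phi>"
    using profile_exists[OF smooth1_continuous[OF sm(1)] supp(1)] by blast
  obtain B2 where B2: "profile B2 w"
    using profile_exists[OF smooth1_continuous[OF sm(2)] supp(2)] by blast
  define I where "I = (\<integral>z. \<Phi> (z \<bullet> z) \<partial>(lborel :: (real ^ 'n) measure))"
  have int: "integrable lborel (\<lambda>z :: real ^ 'n. \<Phi> (z \<bullet> z))" by (rule profile_sq[OF B1])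
  \<comment> \<open>A nonnegative function with integral 0 vanishes almost everywhere, but \<Phi> is
    positive on the nonempty open shell 1 < |z|^2 < 2.\<close>
  have "I \<noteq> 0"
  proof
    assume "I = 0"
    then have ae: "AE z in (lborel :: (real ^ 'n) measure). \<Phi> (z \<bullet> z) = 0"
      unfolding I_def using integral_nonneg_eq_0_iff_AE[OF int] pos(1) by simp
    define U where "U = {z :: real ^ 'n. 1 < z \<bullet> z \<and> z \<bullet> z < 2}"
    have o: "open U" unfolding U_def
      by (intro open_Collect_conj open_Collect_less continuous_intros)
    have "AE z in (lborel :: (real ^ 'n) measure). z \<notin> U"
      using ae
    proof eventually_elim
      case (elim z)
      then show ?case using pos(2)[of "z \<bullet> z"] by (auto simp: U_def)
    qed
    then have "U \<in> null_sets lborel"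
      using o by (subst (asm) AE_iff_null_sets[symmetric]) simp_all
    then have "negligible U" by (simp add: negligible_iff_null_sets null_sets_completionI)
    moreover have "U \<noteq> {}"
    proof -
      obtain i :: 'n where True by blast
      have "axis i (5/4) \<bullet> (axis i (5/4) :: real ^ 'n) = 25/16"
        by (simp add: inner_axis_axis)
      then have "axis i (5/4) \<in> U" by (simp add: U_def)
      then show ?thesis by blast
    qed
    ultimately show False using open_not_negligible[OF o] by blast
  qed
  \<comment> \<open>Both profiles are divided by the same I, which preserves the linear equation
    between them.\<close>
  define \<Phi>1 where "\<Phi>1 s = (1 / I) * \<Phi> s" for s
  define w1 where "w1 s = (1 / I) * w s" for s
  define B where "B = max (\<bar>1 / I\<bar> * B1) (\<bar>1 / I\<bar> * B2)"
  have "mollifier_pair TYPE('n) B \<Phi>1 w1"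
    unfolding mollifier_pair_def
  proof (intro conjI allI impI)
    show "profile B \<Phi>1" "profile B w1"
      unfolding \<Phi>1_def w1_def B_def
      by (rule profile_mono[OF profile_cmult[OF B1] max.cobounded1],
          rule profile_mono[OF profile_cmult[OF B2] max.cobounded2])
    show "(\<integral>z. \<Phi>1 (z \<bullet> z) \<partial>(lborel :: (real ^ 'n) measure)) = 1"
      unfolding \<Phi>1_def using \<open>I \<noteq> 0\<close> by (simp add: I_def[symmetric])
  next
    fix t :: real and y :: "real ^ 'n" assume t: "0 < t"
    have sm1: "smooth1 w1" unfolding w1_def by (rule smooth1_cmult[OF sm(2)])
    show "test_function (\<lambda>x. w1 (t^2 * ((x - y) \<bullet> (x - y))))"
    proof (rule smoothn_test_function[OF smoothn_radial[OF sm1]])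
      have "{x. w1 (t^2 * ((x - y) \<bullet> (x - y))) \<noteq> 0} \<subseteq> ball y (2 / t)"
      proof
        fix x assume "x \<in> {x. w1 (t^2 * ((x - y) \<bullet> (x - y))) \<noteq> 0}"
        then have "kern w t y x \<noteq> 0" using t by (simp add: w1_def kern_def)
        then show "x \<in> ball y (2 / t)" using kern_bound[OF B2 t, of y x] by (cases "x \<in> ball y (2 / t)") simp_all
      qed
      then show "bounded {x. w1 (t^2 * ((x - y) \<bullet> (x - y))) \<noteq> 0}"
        by (rule bounded_subset[OF bounded_ball])
    qed
    fix x :: "real ^ 'n"
    define r where "r = t^2 * ((x - y) \<bullet> (x - y))"
    have d1: "(w1 has_real_derivative (1 / I) * w' s) (at s)" for s
      unfolding w1_def by (rule DERIV_cmult[OF d(1)])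
    have d2: "((\<lambda>s. (1 / I) * w' s) has_real_derivative (1 / I) * w'' s) (at s)" for s
      by (rule DERIV_cmult[OF d(2)])
    have r0: "0 \<le> r" by (simp add: r_def)
    have "(\<Sum>i\<in>UNIV. partial_deriv i (partial_deriv i (\<lambda>x. w1 (t^2 * ((x - y) \<bullet> (x - y))))) x)
        = t^2 * (2 * real CARD('n) * ((1 / I) * w' r) + 4 * r * ((1 / I) * w'' r))"
      unfolding r_def by (rule laplacian_radial[OF d1 d2])
    also have "\<dots> = t^2 * ((1 / I) * (2 * real CARD('n) * w' r + 4 * r * w'' r))"
      by (simp only: distrib_left mult_ac)
    also have "\<dots> = t^2 * (\<Phi>1 r - 2 ^ CARD('n) * \<Phi>1 (4 * r))"
      unfolding eq[OF r0] \<Phi>1_def by (simp add: powr_realpow right_diff_distrib)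
    finally show "(\<Sum>i\<in>UNIV. partial_deriv i (partial_deriv i (\<lambda>x. w1 (t^2 * ((x - y) \<bullet> (x - y))))) x) =
        t^2 * (\<Phi>1 (t^2 * ((x - y) \<bullet> (x - y))) - 2 ^ CARD('n) * \<Phi>1 (4 * (t^2 * ((x - y) \<bullet> (x - y)))))"
      unfolding r_def .
  qed
  then show ?thesis by blast
qed

text \<open>The difference of the two kernels is t^(N - 2) times the Laplacian in x of w(t^2 |x -
  y|^2): doubling t multiplies the prefactor by 2^N and the argument of \<Phi> by 4. For each fixed
  y this is the Laplacian of a test function, so the identity holds at every y and not just almost
  everywhere.\<close>

lemma rconv_telescope:
  fixes f g :: "real ^ 'n::finite \<Rightarrow> complex"
  assumes m: "mollifier_pair TYPE('n) B \<Phi> w" and f: "locint f" and wl: "weak_lap f g" and t: "0 < t"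
  shows "rconv \<Phi> t f y - rconv \<Phi> (2 * t) f y = (1 / t^2) *\<^sub>R rconv w t g y"
proof -
  have k: "profile B \<Phi>" using m unfolding mollifier_pair_def by blast
  have test: "test_function (\<lambda>x. w (t^2 * ((x - y) \<bullet> (x - y))))"
    and lap: "\<And>x. (\<Sum>i\<in>UNIV. partial_deriv i (partial_deriv i (\<lambda>x. w (t^2 * ((x - y) \<bullet> (x - y))))) x) =
        t^2 * (\<Phi> (t^2 * ((x - y) \<bullet> (x - y))) - 2 ^ CARD('n) * \<Phi> (4 * (t^2 * ((x - y) \<bullet> (x - y)))))"
    using m t unfolding mollifier_pair_def by blast+
  define n where "n = CARD('n)"
  have pt: "kern \<Phi> t y x - kern \<Phi> (2 * t) y x = (t ^ n / t^2) *
      (t^2 * (\<Phi> (t^2 * ((x - y) \<bullet> (x - y))) - 2 ^ n * \<Phi> (4 * (t^2 * ((x - y) \<bullet> (x - y))))))" for x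
    using t unfolding kern_def n_def[symmetric]
    by (simp add: power_mult_distrib mult.assoc right_diff_distrib) 
  have "rconv \<Phi> t f y - rconv \<Phi> (2 * t) f y = (\<integral>x. kern \<Phi> t y x *\<^sub>R f x - kern \<Phi> (2 * t) y x *\<^sub>R f x \<partial>lborel)"
    unfolding rconv_def
    by (rule Bochner_Integration.integral_diff[symmetric]; rule kern_integrable[OF k _ f]) (use t in simp_all)
  also have "\<dots> = (\<integral>x. (t ^ n / t^2) *\<^sub>R ((\<Sum>i\<in>UNIV. partial_deriv i (partial_deriv i
      (\<lambda>x. w (t^2 * ((x - y) \<bullet> (x - y))))) x) *\<^sub>R f x) \<partial>lborel)"
    unfolding lap scaleR_diff_left[symmetric] pt scaleR_scaleR n_def ..
  also have "\<dots> = (t ^ n / t^2) *\<^sub>R (\<integral>x. (\<Sum>i\<in>UNIV. partial_deriv i (partial_deriv i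
      (\<lambda>x. w (t^2 * ((x - y) \<bullet> (x - y))))) x) *\<^sub>R f x \<partial>lborel)"
    by (rule integral_scaleR_right)
  also have "\<dots> = (t ^ n / t^2) *\<^sub>R (\<integral>x. w (t^2 * ((x - y) \<bullet> (x - y))) *\<^sub>R g x \<partial>lborel)"
    using wl test unfolding weak_lap_def by simp
  also have "\<dots> = (1 / t^2) *\<^sub>R (t ^ n *\<^sub>R (\<integral>x. w (t^2 * ((x - y) \<bullet> (x - y))) *\<^sub>R g x \<partial>lborel))"
    by simp
  also have "t ^ n *\<^sub>R (\<integral>x. w (t^2 * ((x - y) \<bullet> (x - y))) *\<^sub>R g x \<partial>lborel) = rconv w t g y"
    unfolding rconv_def kern_def n_def scaleR_scaleR[symmetric] by (rule integral_scaleR_right[symmetric])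
  finally show ?thesis .
qed

section \<open>Kernel estimates in Lebesgue spaces\<close>

definition Lp_fun :: "real \<Rightarrow> (real ^ 'n \<Rightarrow> complex) \<Rightarrow> bool" where
  "Lp_fun p f \<longleftrightarrow> f \<in> borel_measurable borel \<and> integrable lborel (\<lambda>x. norm (f x) powr p)"

text \<open>The p-th power of the norm, the form in which the integral estimates compose.\<close>

definition mass :: "real \<Rightarrow> (real ^ 'n \<Rightarrow> complex) \<Rightarrow> real" where
  "mass p f = (\<integral>x. norm (f x) powr p \<partial>lborel)"

lemma mass_nonneg: "0 \<le> mass p f"
  unfolding mass_def by (intro Bochner_Integration.integral_nonneg) simp

lemma Lp_fun_mass: "Lp_fun p f \<Longrightarrow> (\<integral>\<^sup>+x. ennreal (norm (f x) powr p) \<partial>lborel) = ennreal (mass p f)"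
  unfolding Lp_fun_def mass_def by (intro nn_integral_eq_integral) (blast, simp)

text \<open>With \<open>l\<close> optimised after integration, this takes the place of Hoelder's inequality.\<close>

lemma le_interpolate_powr:
  fixes x l :: real
  assumes "0 < l" "1 \<le> \<tau>" "0 \<le> x"
  shows "x \<le> l + l powr (1 - \<tau>) * x powr \<tau>"
proof (cases "x \<le> l")
  case True
  have "0 \<le> l powr (1 - \<tau>) * x powr \<tau>" by simp
  with True show ?thesis by linarith
next
  case False
  then have x: "0 < x" "l < x" using assms by linarith+
  have "x = x powr (1 - \<tau>) * x powr \<tau>" using x by (simp add: powr_add[symmetric])
  also have "\<dots> \<le> l powr (1 - \<tau>) * x powr \<tau>"
    using assms x by (intro mult_right_mono powr_mono2') simp_all
  finally show ?thesis using assms by linarith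
qed

lemma Lp_fun_locint:
  fixes f :: "real ^ 'n::finite \<Rightarrow> complex"
  assumes "1 \<le> p" "Lp_fun p f"
  shows "locint f"
  unfolding locint_def
proof (intro conjI allI)
  show m: "f \<in> borel_measurable borel" using assms unfolding Lp_fun_def by blast
  fix R
  have i: "integrable lborel (\<lambda>x :: real ^ 'n. indicator (ball 0 R) x + norm (f x) powr p)"
  proof (rule Bochner_Integration.integrable_add)
    have "locint (\<lambda>x :: real ^ 'n. 1 :: real)" by (rule locint_const)
    then show "integrable lborel (indicator (ball 0 R) :: real ^ 'n \<Rightarrow> real)" unfolding locint_def by simp
    show "integrable lborel (\<lambda>x. norm (f x) powr p)" using assms unfolding Lp_fun_def by blast
  qed
  show "integrable lborel (\<lambda>x. indicator (ball 0 R) x *\<^sub>R f x)"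
  proof (rule Bochner_Integration.integrable_bound[OF i])
    show "(\<lambda>x. indicator (ball 0 R) x *\<^sub>R f x) \<in> borel_measurable lborel"
      using m by (intro borel_measurable_scaleR borel_measurable_indicator) simp_all
    show "AE x in lborel. norm (indicator (ball 0 R) x *\<^sub>R f x) \<le> norm (indicator (ball 0 R) x + norm (f x) powr p)"
    proof (rule AE_I2)
      fix x
      show "norm (indicator (ball 0 R) x *\<^sub>R f x) \<le> norm (indicator (ball 0 R) x + norm (f x) powr p)"
        using le_interpolate_powr[of 1 p "norm (f x)"] assms(1) by (cases "x \<in> ball 0 R") simp_all
    qed
  qed
qed

text \<open>Jensen's inequality for an average over a ball, up to a constant. Interpolating |f|
  between a constant l and its power \<tau> bounds the convolution, for every l > 0, by B (W l +
  l^(1 - \<tau>) T j), where T = t^N and j is the local integral of |f|^\<tau>; the choice l^\<tau>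
  = T j balances both terms.\<close>

lemma rconv_powr_le:
  assumes k: "profile B k" and \<tau>: "1 < \<tau>"
  shows "\<exists>C>0. \<forall>t>0. \<forall>f :: real ^ 'n::finite \<Rightarrow> complex. \<forall>y. locint f \<longrightarrow>
    ennreal (norm (rconv k t f y) powr \<tau>) \<le>
    ennreal (C * t ^ CARD('n)) * (\<integral>\<^sup>+x. ennreal (norm (f x) powr \<tau>) * indicator (ball y (2 / t)) x \<partial>lborel)"
proof -
  define W where "W = unit_ball_vol (real CARD('n)) * 2 ^ CARD('n)"
  have W: "0 \<le> W" by (simp add: W_def)
  have B: "0 \<le> B" by (rule profile_nonneg[OF k])
  \<comment> \<open>K l is the value of the bound at the balanced l. The summand 1 in C below makes
    C positive even when K is 0.\<close>
  define K where "K = B * (W + 1)"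
  have K: "0 \<le> K" using B W by (simp add: K_def)
  define C where "C = K powr \<tau> + 1"
  have C: "0 < C" by (simp add: C_def add_nonneg_pos)
  have main: "ennreal (norm (rconv k t f y) powr \<tau>) \<le>
    ennreal (C * t ^ CARD('n)) * (\<integral>\<^sup>+x. ennreal (norm (f x) powr \<tau>) * indicator (ball y (2 / t)) x \<partial>lborel)"
    if t: "0 < t" and f: "locint f" for t and f :: "real ^ 'n \<Rightarrow> complex" and y
  proof -
    define J where "J = (\<integral>\<^sup>+x. ennreal (norm (f x) powr \<tau>) * indicator (ball y (2 / t)) x \<partial>lborel)"
    define T where "T = t ^ CARD('n)"
    have T: "0 < T" using t by (simp add: T_def)
    have mf: "f \<in> borel_measurable borel" using f unfolding locint_def by blast
    show ?thesis
    proof (cases "J = \<infinity>")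
      case True
      have "0 < C * t ^ CARD('n)" using C t by simp
      then have "ennreal (C * t ^ CARD('n)) * J = \<infinity>" using True C t by (simp add: ennreal_mult_top)
      then show ?thesis unfolding J_def[symmetric] by simp
    next
      case False
      then obtain j where j: "J = ennreal j" "0 \<le> j" by (cases J) auto
      define A where "A = norm (rconv k t f y)"
      have A0: "0 \<le> A" by (simp add: A_def)
      have vol: "emeasure lborel (ball y (2 / t)) = ennreal (W / T)"
        using t by (simp add: emeasure_ball W_def T_def power_divide)
      have lam: "A \<le> B * (W * l + l powr (1 - \<tau>) * (T * j))" if l: "0 < l" for l
      proof -
        have "(\<integral>\<^sup>+x. ennreal (norm (f x)) * indicator (ball y (2 / t)) x \<partial>lborel)
          \<le> (\<integral>\<^sup>+x. ennreal l * indicator (ball y (2 / t)) x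
              + ennreal (l powr (1 - \<tau>)) * (ennreal (norm (f x) powr \<tau>) * indicator (ball y (2 / t)) x) \<partial>lborel)"
        proof (rule nn_integral_mono)
          fix x
          have "ennreal (norm (f x)) \<le> ennreal (l + l powr (1 - \<tau>) * norm (f x) powr \<tau>)"
            using le_interpolate_powr[OF l, of \<tau> "norm (f x)"] \<tau> by (intro ennreal_leI) simp
          also have "\<dots> = ennreal l + ennreal (l powr (1 - \<tau>)) * ennreal (norm (f x) powr \<tau>)"
            using l by (simp add: ennreal_mult)
          finally show "ennreal (norm (f x)) * indicator (ball y (2 / t)) x \<le> ennreal l * indicator (ball y (2 / t)) x
              + ennreal (l powr (1 - \<tau>)) * (ennreal (norm (f x) powr \<tau>) * indicator (ball y (2 / t)) x)"
            by (cases "x \<in> ball y (2 / t)") simp_all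
        qed
        also have "\<dots> = ennreal l * ennreal (W / T) + ennreal (l powr (1 - \<tau>)) * ennreal j"
        proof -
          have mp: "(\<lambda>x. ennreal (norm (f x) powr \<tau>)) \<in> borel_measurable lborel"
            using mf by measurable
          have m1: "(\<lambda>x. ennreal (norm (f x) powr \<tau>) * indicator (ball y (2 / t)) x) \<in> borel_measurable lborel"
            by (intro borel_measurable_times_ennreal mp borel_measurable_indicator) simp
          have m2: "(\<lambda>x. ennreal l * indicator (ball y (2 / t)) x) \<in> borel_measurable lborel"
            by (intro borel_measurable_times_ennreal borel_measurable_const borel_measurable_indicator) simp
          have "(\<integral>\<^sup>+x. ennreal l * indicator (ball y (2 / t)) x
              + ennreal (l powr (1 - \<tau>)) * (ennreal (norm (f x) powr \<tau>) * indicator (ball y (2 / t)) x) \<partial>lborel)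
              = (\<integral>\<^sup>+x. ennreal l * indicator (ball y (2 / t)) x \<partial>lborel) + (\<integral>\<^sup>+x. ennreal (l powr (1 - \<tau>)) * (ennreal (norm (f x) powr \<tau>) * indicator (ball y (2 / t)) x) \<partial>lborel)"
            by (intro nn_integral_add m2 borel_measurable_times_ennreal m1 borel_measurable_const)
          also have "(\<integral>\<^sup>+x. ennreal l * indicator (ball y (2 / t)) x \<partial>lborel) = ennreal l * ennreal (W / T)"
            unfolding vol[symmetric] by (intro nn_integral_cmult_indicator) simp
          also have "(\<integral>\<^sup>+x. ennreal (l powr (1 - \<tau>)) * (ennreal (norm (f x) powr \<tau>) * indicator (ball y (2 / t)) x) \<partial>lborel) = ennreal (l powr (1 - \<tau>)) * ennreal j"
            unfolding j(1)[symmetric] J_def by (rule nn_integral_cmult[OF m1])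
          finally show ?thesis .
        qed
        also have "\<dots> = ennreal (l * (W / T) + l powr (1 - \<tau>) * j)"
        proof -
          have e1: "ennreal l * ennreal (W / T) = ennreal (l * (W / T))"
            by (rule ennreal_mult[symmetric]) (use l W T in simp_all)
          have e2: "ennreal (l powr (1 - \<tau>)) * ennreal j = ennreal (l powr (1 - \<tau>) * j)"
            by (rule ennreal_mult[symmetric]) (use j(2) in simp_all)
          show ?thesis unfolding e1 e2
            by (rule ennreal_plus[symmetric]) (use l W T j(2) in simp_all)
        qed
        finally have 1: "(\<integral>\<^sup>+x. ennreal (norm (f x)) * indicator (ball y (2 / t)) x \<partial>lborel)
            \<le> ennreal (l * (W / T) + l powr (1 - \<tau>) * j)" .
        have nn: "0 \<le> l * (W / T) + l powr (1 - \<tau>) * j" using l W T j(2) by simp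
        have "ennreal A \<le> ennreal (B * T) * ennreal (l * (W / T) + l powr (1 - \<tau>) * j)"
          using order_trans[OF rconv_norm_le[OF k t f, of y] mult_left_mono[OF 1, of "ennreal (B * t ^ CARD('n))"]]
          unfolding A_def T_def by simp
        also have "\<dots> = ennreal (B * T * (l * (W / T) + l powr (1 - \<tau>) * j))"
          by (rule ennreal_mult[symmetric]) (use B T nn in simp_all)
        finally have "A \<le> B * T * (l * (W / T) + l powr (1 - \<tau>) * j)"
          using B T nn by (subst (asm) ennreal_le_iff) simp_all
        also have "\<dots> = B * (W * l + l powr (1 - \<tau>) * (T * j))"
          using T by (simp add: field_simps)
        finally show ?thesis .
      qed
      \<comment> \<open>The shift by d keeps l positive when the local integral j is 0; d is sent to
        0 afterwards.\<close>
      have step: "A powr \<tau> \<le> C * T * (j + d)" if d: "0 < d" for d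
      proof -
        define X where "X = T * (j + d)"
        have X: "0 < X" using T j(2) d by (simp add: X_def add_nonneg_pos)
        define l where "l = X powr (1 / \<tau>)"
        have l: "0 < l" using X by (simp add: l_def)
        have lt: "l powr \<tau> = X" using X \<tau> by (simp add: l_def powr_powr)
        have "T * j \<le> X" using T d by (simp add: X_def)
        then have "l powr (1 - \<tau>) * (T * j) \<le> l powr (1 - \<tau>) * l powr \<tau>"
          unfolding lt by (intro mult_left_mono) simp_all
        also have "\<dots> = l" using l by (simp add: powr_add[symmetric])
        finally have le: "l powr (1 - \<tau>) * (T * j) \<le> l" .
        have "A \<le> B * (W * l + l powr (1 - \<tau>) * (T * j))" by (rule lam[OF l])
        also have "\<dots> \<le> B * (W * l + l)" using le B by (intro mult_left_mono) simp_all
        also have "\<dots> = K * l" by (simp add: K_def distrib_left distrib_right mult.assoc)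
        finally have "A powr \<tau> \<le> (K * l) powr \<tau>" using A0 \<tau> by (intro powr_mono2) simp_all
        also have "\<dots> = K powr \<tau> * X" using K l lt by (simp add: powr_mult)
        also have "\<dots> \<le> C * X" using X by (intro mult_right_mono) (simp_all add: C_def)
        finally show ?thesis by (simp add: X_def mult.assoc)
      qed
      have "A powr \<tau> \<le> C * T * j"
      proof (rule field_le_epsilon)
        fix e :: real assume e: "0 < e"
        have CT: "0 < C * T" using C T by simp
        have "A powr \<tau> \<le> C * T * (j + e / (C * T))" using e CT by (intro step) simp
        also have "\<dots> = C * T * j + e" using CT C T by (simp add: distrib_left)
        finally show "A powr \<tau> \<le> C * T * j + e" .
      qed
      then have "ennreal (A powr \<tau>) \<le> ennreal (C * T * j)" by (rule ennreal_leI)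
      also have "\<dots> = ennreal (C * T) * J" using C T j by (simp add: ennreal_mult)
      finally show ?thesis unfolding A_def T_def J_def .
    qed
  qed
  show ?thesis
    by (rule exI[of _ C], intro conjI allI impI C main)
qed

text \<open>Tonelli with the symmetry of ball membership: after the exchange it is v that is
  integrated over balls, and only the largest mass S of such a ball enters.\<close>

lemma nn_integral_ball_swap:
  fixes v h :: "real ^ 'n::finite \<Rightarrow> ennreal"
  assumes v: "v \<in> borel_measurable borel" and h: "h \<in> borel_measurable borel"
    and S: "\<And>x. (\<integral>\<^sup>+y. v y * indicator (ball x r) y \<partial>lborel) \<le> S"
  shows "(\<integral>\<^sup>+y. v y * (\<integral>\<^sup>+x. h x * indicator (ball y r) x \<partial>lborel) \<partial>lborel) \<le> S * (\<integral>\<^sup>+x. h x \<partial>lborel)"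
proof -
  \<comment> \<open>Joint measurability of the moving indicator follows from openness of this
    set.\<close>
  define U where "U = {p :: (real ^ 'n) \<times> (real ^ 'n). dist (snd p) (fst p) < r}"
  have "open U" unfolding U_def
    by (intro open_Collect_less continuous_intros)
  then have mU: "U \<in> sets borel" by simp
  have mF: "(\<lambda>p :: (real ^ 'n) \<times> (real ^ 'n). v (snd p) * (h (fst p) * indicator U p)) \<in> borel_measurable borel"
    by (intro borel_measurable_times_ennreal measurable_compose[OF _ v] measurable_compose[OF _ h]
        borel_measurable_indicator mU borel_measurable_continuous_onI continuous_on_fst continuous_on_snd continuous_on_id)
  have m: "(\<lambda>(x, y). v y * (h x * indicator (ball y r) x)) \<in> borel_measurable (lborel \<Otimes>\<^sub>M lborel)"
  proof -
    have "(\<lambda>(x, y). v y * (h x * indicator (ball y r) x)) = (\<lambda>p. v (snd p) * (h (fst p) * indicator U p))"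
      by (auto simp: fun_eq_iff U_def indicator_def)
    with mF show ?thesis by (simp add: lborel_prod)
  qed
  have my: "(\<lambda>x. h x * indicator (ball y r) x) \<in> borel_measurable lborel" for y
    using h by (intro borel_measurable_times_ennreal borel_measurable_indicator) simp_all
  have mx: "(\<lambda>y. v y * indicator (ball x r) y) \<in> borel_measurable lborel" for x
    using v by (intro borel_measurable_times_ennreal borel_measurable_indicator) simp_all
  have "(\<integral>\<^sup>+y. v y * (\<integral>\<^sup>+x. h x * indicator (ball y r) x \<partial>lborel) \<partial>lborel)
      = (\<integral>\<^sup>+y. (\<integral>\<^sup>+x. v y * (h x * indicator (ball y r) x) \<partial>lborel) \<partial>lborel)"
    by (intro nn_integral_cong nn_integral_cmult[symmetric] my)
  also have "\<dots> = (\<integral>\<^sup>+x. (\<integral>\<^sup>+y. v y * (h x * indicator (ball y r) x) \<partial>lborel) \<partial>lborel)"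
    by (rule lborel_pair.Fubini'[OF m])
  also have "\<dots> \<le> (\<integral>\<^sup>+x. S * h x \<partial>lborel)"
  proof (rule nn_integral_mono)
    fix x
    have "(\<integral>\<^sup>+y. v y * (h x * indicator (ball y r) x) \<partial>lborel)
        = (\<integral>\<^sup>+y. h x * (v y * indicator (ball x r) y) \<partial>lborel)"
      by (intro nn_integral_cong) (auto simp: indicator_def dist_commute mult_ac)
    also have "\<dots> = h x * (\<integral>\<^sup>+y. v y * indicator (ball x r) y \<partial>lborel)"
      by (rule nn_integral_cmult[OF mx])
    also have "\<dots> \<le> h x * S" by (intro mult_left_mono S) simp
    finally show "(\<integral>\<^sup>+y. v y * (h x * indicator (ball y r) x) \<partial>lborel) \<le> S * h x" by (simp only: mult.commute)
  qed
  also have "\<dots> = S * (\<integral>\<^sup>+x. h x \<partial>lborel)" using h by (intro nn_integral_cmult) simp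
  finally show ?thesis .
qed

text \<open>C does not depend on t, f, v or q. One statement thus serves both for the Laplacian with
  the singular weight and for f with weight 1, where it bounds higher L^q norms of the mollified
  function.\<close>

definition kernel_bounds :: "'n::finite itself \<Rightarrow> (real \<Rightarrow> real) \<Rightarrow> real \<Rightarrow> real \<Rightarrow> bool" where
  "kernel_bounds TN k \<tau> C \<longleftrightarrow> 0 < C \<and> (\<forall>t>0. \<forall>f :: real ^ 'n \<Rightarrow> complex. Lp_fun \<tau> f \<longrightarrow>
    (\<forall>y. norm (rconv k t f y) powr \<tau> \<le> C * t ^ CARD('n) * mass \<tau> f) \<and>
    (\<forall>v S q. v \<in> borel_measurable borel \<longrightarrow> 0 \<le> S \<longrightarrow> \<tau> \<le> q \<longrightarrow>
      (\<forall>x. (\<integral>\<^sup>+y. v y * indicator (ball x (2 / t)) y \<partial>lborel) \<le> ennreal S) \<longrightarrow>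
      (\<integral>\<^sup>+y. v y * ennreal (norm (rconv k t f y) powr q) \<partial>lborel)
        \<le> ennreal ((C * t ^ CARD('n) * mass \<tau> f) powr (q / \<tau>) * S)))"

text \<open>Splitting the exponent as (q - \<tau>) + \<tau>, the first part is paid by the uniform
  bound and the second by the local average, whose weighted integral is exchanged by
  Tonelli.\<close>

lemma kernel_bounds_exist:
  assumes k: "profile B k" and \<tau>: "1 < \<tau>"
  shows "\<exists>C. kernel_bounds TYPE('n::finite) k \<tau> C"
proof -
  obtain C where CC: "C > 0 \<and> (\<forall>t>0. \<forall>f :: real ^ 'n \<Rightarrow> complex. \<forall>y. locint f \<longrightarrow>
    ennreal (norm (rconv k t f y) powr \<tau>) \<le>
    ennreal (C * t ^ CARD('n)) * (\<integral>\<^sup>+x. ennreal (norm (f x) powr \<tau>) * indicator (ball y (2 / t)) x \<partial>lborel))"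
    using rconv_powr_le[OF k \<tau>] ..
  note C = CC[THEN conjunct1] and avg = CC[THEN conjunct2, rule_format]
  {
    fix t :: real and f :: "real ^ 'n \<Rightarrow> complex"
    assume t: "0 < t" and f: "Lp_fun \<tau> f"
    have lf: "locint f" using Lp_fun_locint[OF _ f] \<tau> by simp
    have mf: "f \<in> borel_measurable borel" using f unfolding Lp_fun_def by blast
    define H where "H = mass \<tau> f"
    have H: "0 \<le> H" by (simp add: H_def mass_nonneg)
    define D where "D = C * t ^ CARD('n)"
    have D: "0 < D" using C t by (simp add: D_def)
    define J where "J y = (\<integral>\<^sup>+x. ennreal (norm (f x) powr \<tau>) * indicator (ball y (2 / t)) x \<partial>lborel)" for y
    have JH: "J y \<le> ennreal H" for y
    proof -
      have "J y \<le> (\<integral>\<^sup>+x. ennreal (norm (f x) powr \<tau>) \<partial>lborel)"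
        unfolding J_def by (intro nn_integral_mono) (simp add: indicator_def)
      then show ?thesis unfolding Lp_fun_mass[OF f] H_def .
    qed
    have AJ: "ennreal (norm (rconv k t f y) powr \<tau>) \<le> ennreal D * J y" for y
      unfolding D_def J_def by (rule avg[OF t lf])
    have sup: "norm (rconv k t f y) powr \<tau> \<le> D * H" for y
    proof -
      have "ennreal (norm (rconv k t f y) powr \<tau>) \<le> ennreal D * ennreal H"
        by (rule order_trans[OF AJ mult_left_mono[OF JH]]) simp
      also have "\<dots> = ennreal (D * H)" using D H by (simp add: ennreal_mult)
      finally show ?thesis using D H by (subst (asm) ennreal_le_iff) simp_all
    qed
    have wtd: "(\<integral>\<^sup>+y. v y * ennreal (norm (rconv k t f y) powr q) \<partial>lborel) \<le> ennreal ((D * H) powr (q / \<tau>) * S)"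
      if v: "v \<in> borel_measurable borel" and S0: "0 \<le> S" and q: "\<tau> \<le> q"
        and S: "\<forall>x. (\<integral>\<^sup>+y. v y * indicator (ball x (2 / t)) y \<partial>lborel) \<le> ennreal S"
      for v :: "real ^ 'n \<Rightarrow> ennreal" and S q
    proof -
      define L where "L = (D * H) powr (q / \<tau> - 1)"
      have L: "0 \<le> L" by (simp add: L_def)
      have mh: "(\<lambda>x. ennreal (norm (f x) powr \<tau>)) \<in> borel_measurable borel" using mf by measurable
      have pt: "ennreal (norm (rconv k t f y) powr q) \<le> ennreal (L * D) * J y" for y
      proof -
        define A where "A = norm (rconv k t f y)"
        have A: "0 \<le> A" by (simp add: A_def)
        have "A powr q = (A powr \<tau>) powr (q / \<tau> - 1) * A powr \<tau>"
        proof -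
          have "\<tau> * (q / \<tau> - 1) + \<tau> = q" using \<tau> by (simp add: right_diff_distrib)
          then show ?thesis by (simp only: powr_powr powr_add[symmetric])
        qed
        also have "\<dots> \<le> L * A powr \<tau>"
          unfolding L_def A_def using sup[of y] q \<tau>
          by (intro mult_right_mono powr_mono2) simp_all
        finally have "ennreal (A powr q) \<le> ennreal L * ennreal (A powr \<tau>)"
          using L by (simp add: ennreal_mult[symmetric] ennreal_leI)
        also have "\<dots> \<le> ennreal L * (ennreal D * J y)"
          unfolding A_def by (intro mult_left_mono AJ) simp
        also have "\<dots> = ennreal (L * D) * J y" using L D by (simp add: ennreal_mult mult.assoc)
        finally show ?thesis unfolding A_def .
      qed
      have "(\<integral>\<^sup>+y. v y * ennreal (norm (rconv k t f y) powr q) \<partial>lborel) \<le> (\<integral>\<^sup>+y. (ennreal (L * D) * v y) * J y \<partial>lborel)"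
      proof (rule nn_integral_mono)
        fix y
        have "v y * ennreal (norm (rconv k t f y) powr q) \<le> v y * (ennreal (L * D) * J y)"
          by (intro mult_left_mono pt) simp
        then show "v y * ennreal (norm (rconv k t f y) powr q) \<le> (ennreal (L * D) * v y) * J y"
          by (simp only: mult_ac)
      qed
      also have "\<dots> \<le> (ennreal (L * D) * ennreal S) * (\<integral>\<^sup>+x. ennreal (norm (f x) powr \<tau>) \<partial>lborel)"
        unfolding J_def
      proof (rule nn_integral_ball_swap[OF _ mh])
        show "(\<lambda>y. ennreal (L * D) * v y) \<in> borel_measurable borel"
          by (intro borel_measurable_times_ennreal borel_measurable_const v)
        fix x
        have "(\<integral>\<^sup>+y. ennreal (L * D) * v y * indicator (ball x (2 / t)) y \<partial>lborel)
            = ennreal (L * D) * (\<integral>\<^sup>+y. v y * indicator (ball x (2 / t)) y \<partial>lborel)"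
          unfolding mult.assoc
          by (intro nn_integral_cmult borel_measurable_times_ennreal borel_measurable_indicator) (use v in simp_all)
        also have "\<dots> \<le> ennreal (L * D) * ennreal S" using S by (intro mult_left_mono) simp_all
        finally show "(\<integral>\<^sup>+y. ennreal (L * D) * v y * indicator (ball x (2 / t)) y \<partial>lborel) \<le> ennreal (L * D) * ennreal S" .
      qed
      also have "\<dots> = ennreal (L * (D * H) * S)"
        unfolding Lp_fun_mass[OF f] H_def[symmetric] using L D H S0
        by (simp add: ennreal_mult[symmetric] mult_ac)
      also have "L * (D * H) = (D * H) powr (q / \<tau>)"
      proof (cases "D * H = 0")
        case False
        then have "0 < D * H" using D H by simp
        then have "L * (D * H) = (D * H) powr (q / \<tau> - 1) * (D * H) powr 1" by (simp add: L_def)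
        then show ?thesis by (simp only: powr_add[symmetric] diff_add_cancel)
      next
        case True
        show ?thesis unfolding True by simp
      qed
      finally show ?thesis .
    qed
    have "(\<forall>y. norm (rconv k t f y) powr \<tau> \<le> C * t ^ CARD('n) * mass \<tau> f) \<and>
      (\<forall>v S q. v \<in> borel_measurable borel \<longrightarrow> 0 \<le> S \<longrightarrow> \<tau> \<le> q \<longrightarrow>
      (\<forall>x. (\<integral>\<^sup>+y. v y * indicator (ball x (2 / t)) y \<partial>lborel) \<le> ennreal S) \<longrightarrow>
      (\<integral>\<^sup>+y. v y * ennreal (norm (rconv k t f y) powr q) \<partial>lborel)
        \<le> ennreal ((C * t ^ CARD('n) * mass \<tau> f) powr (q / \<tau>) * S))"
      unfolding D_def[symmetric] H_def[symmetric]
      by (intro conjI allI impI, rule sup, rule wtd)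
  }
  note main = this
  show ?thesis unfolding kernel_bounds_def
    by (rule exI[of _ C], rule conjI[OF C], intro allI impI, rule main)
qed

section \<open>Estimates in the weighted space\<close>

text \<open>The q-th power of the weighted norm, kept in \<open>ennreal\<close> so that finiteness
  can be a conclusion.\<close>

definition wenergy :: "real \<Rightarrow> real \<Rightarrow> (real ^ 'n \<Rightarrow> complex) \<Rightarrow> ennreal" where
  "wenergy b q u = (\<integral>\<^sup>+y. weight b y * ennreal (norm (u y) powr q) \<partial>lborel)"

lemma weight_measurable: "(\<lambda>y :: real ^ 'n::finite. weight b y) \<in> borel_measurable borel"
  by measurable

text \<open>The exponent of t collects - 2 q from the prefactor, N q / 2 from the L^2 bound of the
  convolution, and b - N from the weight of a ball of radius 2/t. For q = 2 \<sigma> + 2 the sum is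
  - (4 - b - \<sigma> (N - 4)).\<close>

lemma wenergy_rconv_le:
  assumes k: "profile B k" and b: "0 \<le> b" "b < real CARD('n::finite)" and q: "2 \<le> q"
  shows "\<exists>K\<ge>0. \<forall>t>0. \<forall>g :: real ^ 'n \<Rightarrow> complex. Lp_fun 2 g \<longrightarrow>
    wenergy b q (\<lambda>y. (1 / t^2) *\<^sub>R rconv k t g y) \<le>
      ennreal (K * t powr (- (2 * q - real CARD('n) * q / 2 + real CARD('n) - b)) * mass 2 g powr (q / 2))"
proof -
  define n where "n = real CARD('n)"
  have two: "(1::real) < 2" by simp
  obtain C where "kernel_bounds TYPE('n) k 2 C"
    using kernel_bounds_exist[OF k two] ..
  note CC = this[unfolded kernel_bounds_def]
  note C = CC[THEN conjunct1]
  have bN: "b < real DIM(real ^ 'n)" using b by simp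
  obtain C' where CC': "0 \<le> C' \<and> (\<forall>a>0. \<forall>x :: real ^ 'n. (\<integral>\<^sup>+y. weight b y * indicator (ball x a) y \<partial>lborel)
    \<le> ennreal (C' * a powr (real DIM(real ^ 'n) - b)))"
    using powr_ball_nn_integral[OF b(1) bN] ..
  note C' = CC'[THEN conjunct1]
  define K where "K = C powr (q / 2) * (C' * 2 powr (n - b))"
  have K: "0 \<le> K" using C' by (simp add: K_def)
  have main: "wenergy b q (\<lambda>y. (1 / t^2) *\<^sub>R rconv k t g y) \<le>
      ennreal (K * t powr (- (2 * q - n * q / 2 + n - b)) * mass 2 g powr (q / 2))"
    if t: "0 < t" and g: "Lp_fun 2 g" for t and g :: "real ^ 'n \<Rightarrow> complex"
  proof -
    define S where "S = C' * (2 / t) powr (n - b)"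
    have S: "0 \<le> S" using C' by (simp add: S_def)
    define H where "H = mass 2 g"
    have H: "0 \<le> H" by (simp add: H_def mass_nonneg)
    have v: "\<forall>x :: real ^ 'n. (\<integral>\<^sup>+y. weight b y * indicator (ball x (2 / t)) y \<partial>lborel) \<le> ennreal S"
      using CC'[THEN conjunct2] t unfolding S_def n_def by simp
    have m: "rconv k t g \<in> borel_measurable borel"
      by (rule rconv_measurable[OF k]) (use g in \<open>simp add: Lp_fun_def\<close>)
    have "wenergy b q (\<lambda>y. (1 / t^2) *\<^sub>R rconv k t g y)
        = (\<integral>\<^sup>+y. ennreal (t powr (- 2 * q)) * (weight b y * ennreal (norm (rconv k t g y) powr q)) \<partial>lborel)"
      unfolding wenergy_def
    proof (rule nn_integral_cong)
      fix y :: "real ^ 'n"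
      have "(1 / t^2) powr q = t powr (- 2 * q)"
      proof -
        have "1 / t^2 = t powr (- 2)"
          using t by (simp add: powr_minus divide_inverse)
        then show ?thesis by (simp only: powr_powr)
      qed
      moreover have "norm ((1 / t^2) *\<^sub>R rconv k t g y) = (1 / t^2) * norm (rconv k t g y)"
        using t by simp
      ultimately have "norm ((1 / t^2) *\<^sub>R rconv k t g y) powr q = t powr (- 2 * q) * norm (rconv k t g y) powr q"
        by (simp only: powr_mult)
      then show "weight b y * ennreal (norm ((1 / t^2) *\<^sub>R rconv k t g y) powr q)
          = ennreal (t powr (- 2 * q)) * (weight b y * ennreal (norm (rconv k t g y) powr q))"
        by (simp only: ennreal_mult powr_ge_zero mult.left_commute)
    qed
    also have "\<dots> = ennreal (t powr (- 2 * q)) * (\<integral>\<^sup>+y. weight b y * ennreal (norm (rconv k t g y) powr q) \<partial>lborel)"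
    proof (rule nn_integral_cmult)
      have "(\<lambda>y. ennreal (norm (rconv k t g y) powr q)) \<in> borel_measurable borel" using m by measurable
      then show "(\<lambda>y. weight b y * ennreal (norm (rconv k t g y) powr q)) \<in> borel_measurable lborel"
        using weight_measurable by (intro borel_measurable_times_ennreal) simp_all
    qed
    also have "\<dots> \<le> ennreal (t powr (- 2 * q)) * ennreal ((C * t ^ CARD('n) * H) powr (q / 2) * S)"
    proof (rule mult_left_mono)
      show "(\<integral>\<^sup>+y. weight b y * ennreal (norm (rconv k t g y) powr q) \<partial>lborel)
        \<le> ennreal ((C * t ^ CARD('n) * H) powr (q / 2) * S)"
        using CC[THEN conjunct2, rule_format, OF t g, THEN conjunct2, rule_format, OF weight_measurable S q] v
        unfolding H_def by blast
    qed simp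
    also have "\<dots> = ennreal (t powr (- 2 * q) * ((C * t ^ CARD('n) * H) powr (q / 2) * S))"
      using S by (simp add: ennreal_mult)
    also have "t powr (- 2 * q) * ((C * t ^ CARD('n) * H) powr (q / 2) * S)
        = K * t powr (- (2 * q - n * q / 2 + n - b)) * H powr (q / 2)"
    proof -
      have e1: "t ^ CARD('n) = t powr n" using t by (simp add: n_def powr_realpow)
      have e2: "(C * t powr n * H) powr (q / 2) = C powr (q / 2) * t powr (n * (q / 2)) * H powr (q / 2)"
        by (simp only: powr_mult powr_powr)
      have e3: "(2 / t) powr (n - b) = 2 powr (n - b) * t powr (- (n - b))"
      proof -
        have "(2 / t) powr (n - b) = 2 powr (n - b) / t powr (n - b)"
          using t by (simp only: powr_divide)
        then show ?thesis by (simp only: powr_minus divide_inverse)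
      qed
      have "- 2 * q + n * (q / 2) + - (n - b) = - (2 * q - n * q / 2 + n - b)" by simp
      then have e4: "t powr (- 2 * q) * t powr (n * (q / 2)) * t powr (- (n - b)) = t powr (- (2 * q - n * q / 2 + n - b))"
        by (simp only: powr_add[symmetric])
      have "t powr (- 2 * q) * ((C * t ^ CARD('n) * H) powr (q / 2) * S)
          = K * (t powr (- 2 * q) * t powr (n * (q / 2)) * t powr (- (n - b))) * H powr (q / 2)"
        unfolding e1 e2 S_def e3 K_def by (simp only: mult_ac)
      then show ?thesis unfolding e4 .
    qed
    finally show ?thesis unfolding H_def .
  qed
  show ?thesis unfolding n_def[symmetric]
    by (rule exI[of _ K], rule conjI[OF K], intro allI impI, rule main)
qed

text \<open>The scale is fixed and K may depend on it. In the tail bound L is free: a large L makes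
  the second term small, after which a large R makes the first one small, uniformly for f of bounded
  mass.\<close>

definition avg_bounds :: "'n::finite itself \<Rightarrow> real \<Rightarrow> real \<Rightarrow> real \<Rightarrow> (real \<Rightarrow> real) \<Rightarrow> real \<Rightarrow> real \<Rightarrow> real \<Rightarrow> real \<Rightarrow> bool" where
  "avg_bounds TN b q p k t K a e \<longleftrightarrow> 0 \<le> K \<and> 0 < a \<and> 0 < e \<and> (\<forall>f :: real ^ 'n \<Rightarrow> complex. Lp_fun p f \<longrightarrow>
    (\<forall>y. norm (rconv k t f y) powr p \<le> K * mass p f) \<and>
    (\<forall>R>0. (\<integral>\<^sup>+y. weight b y * ennreal (norm (rconv k t f y) powr q) * indicator (ball 0 R) y \<partial>lborel)
      \<le> ennreal (K * mass p f powr (q / p) * R powr (real CARD('n) - b))) \<and>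
    (\<forall>R>0. \<forall>L>0. (\<integral>\<^sup>+y. weight b y * ennreal (norm (rconv k t f y) powr q) * indicator {y. R \<le> norm y} y \<partial>lborel)
      \<le> ennreal (K * mass p f powr (q / p) * (L * R powr (- a) + L powr (- e)))))"

text \<open>The tail is Hoelder's inequality with exponent s / q between the weight and the L^s
  bound of the mollified function. The conjugate weight |y|^(-b s / (s - q)) is integrable at
  infinity exactly when s (N - b) < q N, and the L^s bound from L^p requires s \<ge> p.\<close>

lemma avg_bounds_exist:
  assumes k: "profile B k" and b: "0 < b" "b < real CARD('n::finite)" and q: "0 < q" and p: "1 < p"
    and pq: "p < q * real CARD('n) / (real CARD('n) - b)" and t: "0 < t"
  shows "\<exists>K a e. avg_bounds TYPE('n) b q p k t K a e"
proof -
  define n where "n = real CARD('n)"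
  have n: "0 < n" "b < n" using b by (simp_all add: n_def)
  have "q < q * n / (n - b)" using q b n by (simp add: less_divide_eq)
  with pq have "max p q < q * n / (n - b)" unfolding n_def by simp
  \<comment> \<open>The room above p is the hypothesis on p; the room above q comes from b >
    0.\<close>
  then obtain s where s0: "max p q < s" "s < q * n / (n - b)" using dense by blast
  then have s: "p < s" "q < s" by simp_all
  have sN: "s * (n - b) < q * n" using s0(2) n by (simp add: less_divide_eq)
  define e where "e = s / q - 1"
  have e: "0 < e" using s q by (simp add: e_def)
  \<comment> \<open>With this choice b + d = b s / (s - q), the exponent of the conjugate
    weight.\<close>
  define d where "d = b / e"
  have d: "0 < d" using b e by (simp add: d_def)
  have de: "d * e = b" using e by (simp add: d_def)
  have qe: "q * e = s - q" using q by (simp add: e_def right_diff_distrib)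
  have c: "n < b + d"
  proof -
    have "n * (s - q) < b * s" using sN by (simp add: algebra_simps)
    then have "n * (q * e) < b * (q * e + q)" unfolding qe by simp
    then have "(n * e) * q < (b * e + b) * q" by (simp add: algebra_simps)
    then have "n * e < b * e + b" using q by (simp only: mult_less_cancel_right_pos)
    then have "n * e < (b + d) * e" using de by (simp add: distrib_right)
    then show ?thesis using e by (simp only: mult_less_cancel_right_pos)
  qed
  define a where "a = b + d - n"
  have a: "0 < a" using c by (simp add: a_def)
  obtain C where "kernel_bounds TYPE('n) k p C"
    using kernel_bounds_exist[OF k p] ..
  note CC = this[unfolded kernel_bounds_def]
  note C = CC[THEN conjunct1]
  have bN: "b < real DIM(real ^ 'n)" "0 \<le> b" using b by simp_all
  obtain C' where CC': "0 \<le> C' \<and> (\<forall>a>0. \<forall>x :: real ^ 'n. (\<integral>\<^sup>+y. weight b y * indicator (ball x a) y \<partial>lborel)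
    \<le> ennreal (C' * a powr (real DIM(real ^ 'n) - b)))"
    using powr_ball_nn_integral[OF bN(2,1)] ..
  note C' = CC'[THEN conjunct1]
  have cN: "real DIM(real ^ 'n) < b + d" using c by (simp add: n_def)
  obtain C2 where CC2: "0 \<le> C2 \<and> (\<forall>R>0. (\<integral>\<^sup>+y. weight (b + d) y * indicator {y. R \<le> norm y} (y :: real ^ 'n) \<partial>lborel)
    \<le> ennreal (C2 * R powr (real DIM(real ^ 'n) - (b + d))))"
    using powr_outer_nn_integral[OF cN] ..
  note C2 = CC2[THEN conjunct1]
  define D where "D = C * t ^ CARD('n)"
  have D: "0 < D" using C t by (simp add: D_def)
  define S where "S = unit_ball_vol (real CARD('n)) * (2 / t) ^ CARD('n)"
  have S: "0 \<le> S" using t by (simp add: S_def)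
  define K where "K = D + D powr (q / p) * C' + C2 + D powr (s / p) * S"
  have Kparts: "0 \<le> D powr (q / p) * C'" "0 \<le> D powr (s / p) * S" using C' S by simp_all
  then have Kge: "D \<le> K" "D powr (q / p) * C' \<le> K" "C2 \<le> K" "D powr (s / p) * S \<le> K"
    using D C2 unfolding K_def by linarith+
  have K: "0 \<le> K" using Kge(1) D by linarith
  have main: "(\<forall>y. norm (rconv k t f y) powr p \<le> K * mass p f) \<and>
    (\<forall>R>0. (\<integral>\<^sup>+y. weight b y * ennreal (norm (rconv k t f y) powr q) * indicator (ball 0 R) y \<partial>lborel)
      \<le> ennreal (K * mass p f powr (q / p) * R powr (real CARD('n) - b))) \<and>
    (\<forall>R>0. \<forall>L>0. (\<integral>\<^sup>+y. weight b y * ennreal (norm (rconv k t f y) powr q) * indicator {y. R \<le> norm y} y \<partial>lborel)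
      \<le> ennreal (K * mass p f powr (q / p) * (L * R powr (- a) + L powr (- e))))"
    if f: "Lp_fun p f" for f :: "real ^ 'n \<Rightarrow> complex"
  proof -
    define F where "F = mass p f"
    have F: "0 \<le> F" by (simp add: F_def mass_nonneg)
    define A where "A y = norm (rconv k t f y)" for y
    have A0: "0 \<le> A y" for y by (simp add: A_def)
    have mf: "f \<in> borel_measurable borel" using f by (simp add: Lp_fun_def)
    have mA: "A \<in> borel_measurable borel"
      unfolding A_def using rconv_measurable[OF k mf] by measurable
    note W = CC[THEN conjunct2, rule_format, OF t f, folded D_def F_def A_def]
    have Ap: "A y powr p \<le> D * F" for y using W[THEN conjunct1] by blast
    have Aq: "A y powr q \<le> D powr (q / p) * F powr (q / p)" for y
    proof -
      have "A y powr q = (A y powr p) powr (q / p)" using p by (simp add: powr_powr)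
      also have "\<dots> \<le> (D * F) powr (q / p)" using Ap[of y] q p by (intro powr_mono2) simp_all
      finally show ?thesis by (simp only: powr_mult)
    qed
    have sup: "A y powr p \<le> K * F" for y
      using Ap[of y] mult_right_mono[OF Kge(1) F] by linarith
    have inner: "(\<integral>\<^sup>+y. weight b y * ennreal (A y powr q) * indicator (ball 0 R) y \<partial>lborel)
      \<le> ennreal (K * F powr (q / p) * R powr (n - b))" if R: "0 < R" for R
    proof -
      define X where "X = D powr (q / p) * F powr (q / p)"
      have X: "0 \<le> X" by (simp add: X_def)
      have "(\<integral>\<^sup>+y. weight b y * ennreal (A y powr q) * indicator (ball 0 R) y \<partial>lborel)
        \<le> (\<integral>\<^sup>+y. ennreal X * (weight b y * indicator (ball 0 R) y) \<partial>(lborel :: (real ^ 'n) measure))"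
      proof (rule nn_integral_mono)
        fix y :: "real ^ 'n"
        have "weight b y * ennreal (A y powr q) * indicator (ball 0 R) y
          \<le> (weight b y * ennreal X) * indicator (ball 0 R) y"
          using Aq[of y] unfolding X_def by (intro mult_right_mono mult_left_mono ennreal_leI) simp_all
        then show "weight b y * ennreal (A y powr q) * indicator (ball 0 R) y
          \<le> ennreal X * (weight b y * indicator (ball 0 R) y)" by (simp only: mult_ac)
      qed
      also have "\<dots> = ennreal X * (\<integral>\<^sup>+y. weight b y * indicator (ball 0 R) (y :: real ^ 'n) \<partial>lborel)"
        by (intro nn_integral_cmult borel_measurable_times_ennreal borel_measurable_indicator)
           (use weight_measurable in simp_all)
      also have "\<dots> \<le> ennreal X * ennreal (C' * R powr (n - b))"
        using CC'[THEN conjunct2, rule_format, OF R, of 0] by (intro mult_left_mono) (simp_all add: n_def)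
      also have "\<dots> = ennreal (X * (C' * R powr (n - b)))" by (rule ennreal_mult[symmetric]) (use X C' in simp_all)
      also have "\<dots> \<le> ennreal (K * F powr (q / p) * R powr (n - b))"
      proof (rule ennreal_leI)
        have "(D powr (q / p) * C') * (F powr (q / p) * R powr (n - b)) \<le> K * (F powr (q / p) * R powr (n - b))"
          by (intro mult_right_mono Kge) simp
        then show "X * (C' * R powr (n - b)) \<le> K * F powr (q / p) * R powr (n - b)"
          unfolding X_def by (simp only: mult_ac)
      qed
      finally show ?thesis .
    qed
    have outer: "(\<integral>\<^sup>+y. weight b y * ennreal (A y powr q) * indicator {y. R \<le> norm y} y \<partial>lborel)
      \<le> ennreal (K * F powr (q / p) * (L * R powr (- a) + L powr (- e)))" if R: "0 < R" and L: "0 < L" for R L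
    proof (cases "F = 0")
      \<comment> \<open>The constants of the other case contain a negative power of the norm M of f;
        here the mollified function is identically 0.\<close>
      case True
      have "A y powr p \<le> 0" for y using Ap[of y] True by simp
      then have "A y = 0" for y by (metis antisym powr_eq_0_iff powr_ge_zero)
      then show ?thesis by simp
    next
      case False
      then have F0: "0 < F" using F by simp
      define M where "M = F powr (1 / p)"
      have M: "0 < M" using F0 by (simp add: M_def)
      have Mq: "M powr r = F powr (r / p)" for r by (simp add: M_def powr_powr)
      define c1 where "c1 = L * M powr q"
      define c2 where "c2 = L powr (- e) * M powr (q - s)"
      have c12: "0 \<le> c1" "0 \<le> c2" using L by (simp_all add: c1_def c2_def)
      have pt: "norm y powr (- b) * A y powr q \<le> c1 * norm y powr (- (b + d)) + c2 * A y powr s"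
        if y: "R \<le> norm y" for y
      proof -
        define r where "r = norm y"
        have r: "0 < r" using y R unfolding r_def by linarith
        \<comment> \<open>The interpolation level depends on |y|: its decay r^(-d) turns the weight
          into the integrable one, while \<mu>^(-e) produces r^b, which cancels the weight in front
          of the L^s term.\<close>
        define \<mu> where "\<mu> = c1 * r powr (- d)"
        have \<mu>: "0 < \<mu>" using L M r by (simp add: \<mu>_def c1_def)
        have sq: "s / q = 1 + e" by (simp add: e_def)
        have "A y powr q \<le> \<mu> + \<mu> powr (1 - (1 + e)) * (A y powr q) powr (1 + e)"
          using e by (intro le_interpolate_powr[OF \<mu>]) simp_all
        also have "(A y powr q) powr (1 + e) = A y powr s"
          using q by (simp only: powr_powr sq[symmetric]) simp
        also have "\<mu> powr (1 - (1 + e)) = c2 * r powr b"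
        proof -
          have "1 - (1 + e) = - e" by simp
          then have "\<mu> powr (1 - (1 + e)) = \<mu> powr (- e)" by (simp only:)
          also have "\<dots> = L powr (- e) * (M powr q) powr (- e) * (r powr (- d)) powr (- e)"
            unfolding \<mu>_def c1_def by (simp only: powr_mult)
          also have "(M powr q) powr (- e) = M powr (q - s)"
          proof -
            have "q * - e = q - s" using qe by simp
            then show ?thesis by (simp only: powr_powr)
          qed
          also have "(r powr (- d)) powr (- e) = r powr b"
          proof -
            have "- d * - e = b" using de by simp
            then show ?thesis by (simp only: powr_powr)
          qed
          finally show ?thesis unfolding c2_def .
        qed
        finally have "A y powr q \<le> \<mu> + (c2 * r powr b) * A y powr s" .
        then have "r powr (- b) * A y powr q \<le> r powr (- b) * (\<mu> + (c2 * r powr b) * A y powr s)"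
          by (intro mult_left_mono) simp_all
        also have "\<dots> = c1 * (r powr (- b) * r powr (- d)) + c2 * (r powr (- b) * r powr b) * A y powr s"
          unfolding \<mu>_def by (simp add: algebra_simps)
        also have "r powr (- b) * r powr (- d) = r powr (- (b + d))" by (simp add: powr_add[symmetric])
        also have "r powr (- b) * r powr b = 1" using r by (simp add: powr_add[symmetric])
        finally show ?thesis unfolding r_def by simp
      qed
      have mAs: "(\<lambda>y. ennreal (A y powr s)) \<in> borel_measurable borel" using mA by measurable
      have mw: "(\<lambda>y :: real ^ 'n. weight (b + d) y * indicator {y. R \<le> norm y} y) \<in> borel_measurable lborel"
        by (intro borel_measurable_times_ennreal borel_measurable_indicator)
           (use weight_measurable[of "b + d"] in \<open>simp_all add: closed_Collect_le\<close>)
      have "(\<integral>\<^sup>+y. weight b y * ennreal (A y powr q) * indicator {y. R \<le> norm y} y \<partial>lborel)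
        \<le> (\<integral>\<^sup>+y. ennreal c1 * (weight (b + d) y * indicator {y. R \<le> norm y} y) + ennreal c2 * (1 * ennreal (A y powr s)) \<partial>lborel)"
      proof (rule nn_integral_mono)
        fix y :: "real ^ 'n"
        show "weight b y * ennreal (A y powr q) * indicator {y. R \<le> norm y} y
          \<le> ennreal c1 * (weight (b + d) y * indicator {y. R \<le> norm y} y) + ennreal c2 * (1 * ennreal (A y powr s))"
        proof (cases "R \<le> norm y")
          case True
          have "weight b y * ennreal (A y powr q) = ennreal (norm y powr (- b) * A y powr q)"
            by (rule ennreal_mult[symmetric]) simp_all
          also have "\<dots> \<le> ennreal (c1 * norm y powr (- (b + d)) + c2 * A y powr s)" by (rule ennreal_leI[OF pt[OF True]])
          also have "\<dots> = ennreal (c1 * norm y powr (- (b + d))) + ennreal (c2 * A y powr s)"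
            by (rule ennreal_plus) (use c12 in simp_all)
          also have "ennreal (c1 * norm y powr (- (b + d))) = ennreal c1 * weight (b + d) y"
            by (rule ennreal_mult) (use c12 in simp_all)
          also have "ennreal (c2 * A y powr s) = ennreal c2 * ennreal (A y powr s)"
            by (rule ennreal_mult) (use c12 in simp_all)
          finally show ?thesis using True by simp
        qed simp
      qed
      also have "\<dots> = ennreal c1 * (\<integral>\<^sup>+y. weight (b + d) y * indicator {y. R \<le> norm y} (y :: real ^ 'n) \<partial>lborel)
          + ennreal c2 * (\<integral>\<^sup>+y. 1 * ennreal (A y powr s) \<partial>lborel)"
      proof -
        have m1: "(\<lambda>y. 1 * ennreal (A y powr s)) \<in> borel_measurable lborel" using mAs by simp
        have "(\<integral>\<^sup>+y. ennreal c1 * (weight (b + d) y * indicator {y. R \<le> norm y} y) + ennreal c2 * (1 * ennreal (A y powr s)) \<partial>lborel)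
          = (\<integral>\<^sup>+y. ennreal c1 * (weight (b + d) y * indicator {y. R \<le> norm y} (y :: real ^ 'n)) \<partial>lborel)
            + (\<integral>\<^sup>+y. ennreal c2 * (1 * ennreal (A y powr s)) \<partial>lborel)"
          by (rule nn_integral_add; rule borel_measurable_times_ennreal[OF borel_measurable_const]; rule mw m1)
        then show ?thesis unfolding nn_integral_cmult[OF mw] nn_integral_cmult[OF m1] .
      qed
      also have "\<dots> \<le> ennreal c1 * ennreal (C2 * R powr (- a)) + ennreal c2 * ennreal ((D * F) powr (s / p) * S)"
      proof (intro add_mono mult_left_mono)
        have "real DIM(real ^ 'n) - (b + d) = - a" by (simp add: a_def n_def)
        then show "(\<integral>\<^sup>+y. weight (b + d) y * indicator {y. R \<le> norm y} (y :: real ^ 'n) \<partial>lborel) \<le> ennreal (C2 * R powr (- a))"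
          using CC2[THEN conjunct2, rule_format, OF R] by (simp only:)
        have ps: "p \<le> s" using s by simp
        have one: "(\<lambda>_ :: real ^ 'n. 1 :: ennreal) \<in> borel_measurable borel" by simp
        have "\<forall>x. (\<integral>\<^sup>+y. (\<lambda>_ :: real ^ 'n. 1 :: ennreal) y * indicator (ball x (2 / t)) y \<partial>lborel) \<le> ennreal S"
          using t by (simp add: emeasure_ball S_def)
        from W[THEN conjunct2, rule_format, OF one S ps this[rule_format]]
        show "(\<integral>\<^sup>+y. 1 * ennreal (A y powr s) \<partial>lborel) \<le> ennreal ((D * F) powr (s / p) * S)" .
      qed simp_all
      also have "\<dots> = ennreal (c1 * (C2 * R powr (- a)) + c2 * ((D * F) powr (s / p) * S))"
      proof -
        have x1: "ennreal c1 * ennreal (C2 * R powr (- a)) = ennreal (c1 * (C2 * R powr (- a)))"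
          by (rule ennreal_mult[symmetric]) (use c12 C2 in simp_all)
        have x2: "ennreal c2 * ennreal ((D * F) powr (s / p) * S) = ennreal (c2 * ((D * F) powr (s / p) * S))"
          by (rule ennreal_mult[symmetric]) (use c12 S in simp_all)
        show ?thesis unfolding x1 x2 by (rule ennreal_plus[symmetric]) (use c12 C2 S in simp_all)
      qed
      also have "\<dots> \<le> ennreal (K * F powr (q / p) * (L * R powr (- a) + L powr (- e)))"
      proof (rule ennreal_leI)
        have "M powr (q - s) * M powr s = M powr q" using M by (simp add: powr_add[symmetric])
        then have cs: "c2 * ((D * F) powr (s / p) * S) = (D powr (s / p) * S) * (M powr q * L powr (- e))"
          unfolding c2_def by (simp add: powr_mult Mq[symmetric] mult_ac)
        have c1s: "c1 * (C2 * R powr (- a)) = C2 * (M powr q * (L * R powr (- a)))"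
          unfolding c1_def by (simp only: mult_ac)
        have y1: "C2 * (M powr q * (L * R powr (- a))) \<le> K * (M powr q * (L * R powr (- a)))"
          using L by (intro mult_right_mono Kge) simp
        have y2: "(D powr (s / p) * S) * (M powr q * L powr (- e)) \<le> K * (M powr q * L powr (- e))"
          by (intro mult_right_mono Kge) simp
        have "K * (M powr q * (L * R powr (- a))) + K * (M powr q * L powr (- e)) = K * M powr q * (L * R powr (- a) + L powr (- e))"
          by (simp only: distrib_left mult.assoc)
        with y1 y2 show "c1 * (C2 * R powr (- a)) + c2 * ((D * F) powr (s / p) * S) \<le> K * F powr (q / p) * (L * R powr (- a) + L powr (- e))"
          unfolding cs c1s Mq[of q, symmetric] by linarith
      qed
      finally show ?thesis .
    qed
    show ?thesis
      unfolding F_def[symmetric] A_def[symmetric] n_def[symmetric]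
      by (intro conjI allI impI sup inner outer)
  qed
  have "avg_bounds TYPE('n) b q p k t K a e"
    unfolding avg_bounds_def
    by (rule conjI[OF K], rule conjI[OF a], rule conjI[OF e], intro allI impI, rule main)
  then show ?thesis by blast
qed

section \<open>Rapidly convergent sequences in the weighted space\<close>

lemma powr_add_le:
  fixes x y q :: real
  assumes "0 \<le> x" "0 \<le> y" "0 \<le> q"
  shows "(x + y) powr q \<le> 2 powr q * (x powr q + y powr q)"
proof -
  have "(x + y) powr q \<le> (2 * max x y) powr q"
    using assms by (intro powr_mono2) simp_all
  also have "\<dots> = 2 powr q * max x y powr q" by (simp only: powr_mult)
  also have "\<dots> \<le> 2 powr q * (x powr q + y powr q)"
  proof (rule mult_left_mono)
    show "max x y powr q \<le> x powr q + y powr q" by (cases "x \<le> y") (simp_all add: max_def)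
  qed simp
  finally show ?thesis .
qed

lemma wenergy_measurable:
  assumes "u \<in> borel_measurable (borel :: (real ^ 'n::finite) measure)"
  shows "(\<lambda>y. weight b y * ennreal (norm (u y) powr q)) \<in> borel_measurable borel"
proof -
  have "(\<lambda>y. ennreal (norm (u y) powr q)) \<in> borel_measurable borel" using assms by measurable
  then show ?thesis by (intro borel_measurable_times_ennreal weight_measurable)
qed

text \<open>The q-th power of a norm obeys the triangle inequality up to the factor 2^q, which is
  harmless for smallness and finiteness.\<close>

lemma wenergy_triangle:
  fixes u v z :: "real ^ 'n::finite \<Rightarrow> complex"
  assumes "u \<in> borel_measurable borel" "v \<in> borel_measurable borel" "z \<in> borel_measurable borel" "0 \<le> q"
  shows "wenergy b q (\<lambda>y. u y - v y) \<le> ennreal (2 powr q) * (wenergy b q (\<lambda>y. u y - z y) + wenergy b q (\<lambda>y. z y - v y))"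
proof -
  define w where "w y = weight b y" for y :: "real ^ 'n"
  have m: "(\<lambda>y. w y * ennreal (norm (u y - z y) powr q)) \<in> borel_measurable lborel"
    "(\<lambda>y. w y * ennreal (norm (z y - v y) powr q)) \<in> borel_measurable lborel"
    unfolding w_def measurable_lborel2
    by (intro wenergy_measurable borel_measurable_diff assms)+
  have "wenergy b q (\<lambda>y. u y - v y) \<le> (\<integral>\<^sup>+y. ennreal (2 powr q) * (w y * ennreal (norm (u y - z y) powr q) + w y * ennreal (norm (z y - v y) powr q)) \<partial>lborel)"
    unfolding wenergy_def w_def[symmetric]
  proof (rule nn_integral_mono)
    fix y
    have "norm (u y - v y) powr q \<le> (norm (u y - z y) + norm (z y - v y)) powr q"
      using norm_triangle_ineq[of "u y - z y" "z y - v y"] assms(4) by (intro powr_mono2) simp_all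
    also have "\<dots> \<le> 2 powr q * (norm (u y - z y) powr q + norm (z y - v y) powr q)"
      using assms(4) by (intro powr_add_le) simp_all
    finally have "ennreal (norm (u y - v y) powr q) \<le> ennreal (2 powr q * (norm (u y - z y) powr q + norm (z y - v y) powr q))"
      by (rule ennreal_leI)
    also have "\<dots> = ennreal (2 powr q) * (ennreal (norm (u y - z y) powr q) + ennreal (norm (z y - v y) powr q))"
      by (simp only: ennreal_mult ennreal_plus powr_ge_zero add_nonneg_nonneg)
    finally have "w y * ennreal (norm (u y - v y) powr q) \<le> w y * (ennreal (2 powr q) * (ennreal (norm (u y - z y) powr q) + ennreal (norm (z y - v y) powr q)))"
      by (intro mult_left_mono) simp_all
    then show "w y * ennreal (norm (u y - v y) powr q)
      \<le> ennreal (2 powr q) * (w y * ennreal (norm (u y - z y) powr q) + w y * ennreal (norm (z y - v y) powr q))"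
      by (simp only: distrib_left mult.left_commute)
  qed
  also have "\<dots> = ennreal (2 powr q) * (\<integral>\<^sup>+y. (w y * ennreal (norm (u y - z y) powr q) + w y * ennreal (norm (z y - v y) powr q)) \<partial>lborel)"
    by (rule nn_integral_cmult[OF borel_measurable_add[OF m]])
  also have "\<dots> = ennreal (2 powr q) * (wenergy b q (\<lambda>y. u y - z y) + wenergy b q (\<lambda>y. z y - v y))"
    by (simp only: nn_integral_add[OF m] wenergy_def w_def[symmetric])
  finally show ?thesis .
qed

text \<open>
  The geometric weights bound the sum by a supremum, so that the energies of the terms can be summed
  without Minkowski's inequality.
\<close>

lemma geometric_norm_sum:
  fixes r :: "nat \<Rightarrow> complex" and \<rho> q :: real
  assumes \<rho>: "0 < \<rho>" "\<rho> < 1" and q: "0 < q"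
    and V: "V = (\<Sum>k. ennreal ((inverse \<rho> ^ k * norm (r k)) powr q))" and fin: "V \<noteq> \<infinity>"
  defines "X \<equiv> enn2real V powr (1 / q) * (1 / (1 - \<rho>))"
  shows "summable r" "norm (suminf r) \<le> X" "norm (\<Sum>k<m. r k) \<le> X"
    "ennreal (X powr q) = ennreal ((1 / (1 - \<rho>)) powr q) * V"
proof -
  define v where "v = enn2real V"
  have v: "0 \<le> v" by (simp add: v_def)
  have Vv: "V = ennreal v" unfolding v_def using fin by (simp add: less_top)
  have le: "norm (r k) \<le> v powr (1 / q) * \<rho> ^ k" for k
  proof -
    have "ennreal ((inverse \<rho> ^ k * norm (r k)) powr q) \<le> ennreal v"
      unfolding Vv[symmetric] V by (rule le_suminf_ennreal)
    then have "(inverse \<rho> ^ k * norm (r k)) powr q \<le> v" using v by (subst (asm) ennreal_le_iff)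
    then have "((inverse \<rho> ^ k * norm (r k)) powr q) powr (1 / q) \<le> v powr (1 / q)"
      using q by (intro powr_mono2) simp_all
    also have "((inverse \<rho> ^ k * norm (r k)) powr q) powr (1 / q) = inverse \<rho> ^ k * norm (r k)"
      using q \<rho> by (simp add: powr_powr)
    finally have "\<rho> ^ k * (inverse \<rho> ^ k * norm (r k)) \<le> \<rho> ^ k * v powr (1 / q)"
      using \<rho> by (intro mult_left_mono) simp_all
    moreover have "\<rho> ^ k * inverse \<rho> ^ k = 1" using \<rho> by (simp add: power_mult_distrib[symmetric])
    ultimately show ?thesis by (simp add: mult.assoc[symmetric] mult.commute)
  qed
  have geo: "(\<lambda>k. v powr (1 / q) * \<rho> ^ k) sums X"
    unfolding X_def v_def[symmetric] using \<rho> by (intro sums_mult geometric_sums) simp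
  have sn: "summable (\<lambda>k. norm (r k))"
    by (rule summable_comparison_test'[OF sums_summable[OF geo], of 0]) (use le in simp)
  then show "summable r" by (rule summable_norm_cancel)
  have sX: "(\<Sum>k. norm (r k)) \<le> X"
    unfolding sums_unique[OF geo] by (rule suminf_le[OF le sn sums_summable[OF geo]])
  show "norm (suminf r) \<le> X" using summable_norm[OF sn] sX by linarith
  have "norm (\<Sum>k<m. r k) \<le> (\<Sum>k<m. norm (r k))" by (rule norm_sum)
  also have "\<dots> \<le> (\<Sum>k. norm (r k))" by (rule sum_le_suminf[OF sn]) simp_all
  finally show "norm (\<Sum>k<m. r k) \<le> X" using sX by linarith
  have "X powr q = (1 / (1 - \<rho>)) powr q * v"
  proof -
    have "X powr q = v powr (1 / q * q) * (1 / (1 - \<rho>)) powr q"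
      unfolding X_def v_def[symmetric] by (simp only: powr_mult powr_powr)
    also have "v powr (1 / q * q) = v" using q v by simp
    finally show ?thesis by (simp only: mult.commute)
  qed
  then show "ennreal (X powr q) = ennreal ((1 / (1 - \<rho>)) powr q) * V"
    unfolding Vv using v by (simp add: ennreal_mult)
qed

lemma AE_finite_of_weighted:
  fixes V :: "real ^ 'n::finite \<Rightarrow> ennreal"
  assumes V: "V \<in> borel_measurable borel"
    and fin: "(\<integral>\<^sup>+y. weight b y * V y \<partial>lborel) \<noteq> \<infinity>"
  shows "AE y in lborel. V y \<noteq> \<infinity>"
proof -
  have m: "(\<lambda>y. weight b y * V y) \<in> borel_measurable lborel"
    using V weight_measurable by (intro borel_measurable_times_ennreal) simp_all
  have "AE y in lborel. weight b y * V y \<noteq> \<infinity>"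
    using nn_integral_PInf_AE[OF m] fin by simp
  \<comment> \<open>The weight vanishes at the origin by the convention for \<open>powr\<close>, so
    finiteness of the product says nothing about V there.\<close>
  moreover have "AE y in lborel. y \<noteq> (0 :: real ^ 'n)"
    by (rule AE_lborel_singleton)
  ultimately show ?thesis
  proof eventually_elim
    case (elim y)
    have "0 < norm y powr (- b)" using elim(2) by simp
    then have "weight b y \<noteq> 0" by (simp add: ennreal_eq_0_iff)
    with elim(1) show ?case by (auto simp: ennreal_mult_eq_top_iff)
  qed
qed

text \<open>On the ball of radius R the weight is at least R^(-b) away from the origin, and v^(1/q)
  \<le> 1 + v. This makes the majorant found in the weighted space locally integrable, as needed to
  identify the limit.\<close>

lemma locint_of_weighted:
  fixes V :: "real ^ 'n::finite \<Rightarrow> ennreal"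
  assumes V: "V \<in> borel_measurable borel" and b: "0 \<le> b" and q: "1 \<le> q"
    and fin: "(\<integral>\<^sup>+y. weight b y * V y \<partial>lborel) \<noteq> \<infinity>"
  shows "locint (\<lambda>y. enn2real (V y) powr (1 / q))"
  unfolding locint_def
proof (intro conjI allI)
  show m: "(\<lambda>y. enn2real (V y) powr (1 / q)) \<in> borel_measurable borel" using V by measurable
  fix R :: real
  have mI: "(\<lambda>y. indicator (ball 0 R) y *\<^sub>R enn2real (V y) powr (1 / q)) \<in> borel_measurable lborel"
    using m by (intro borel_measurable_scaleR borel_measurable_indicator) simp_all
  show "integrable lborel (\<lambda>y. indicator (ball 0 R) y *\<^sub>R enn2real (V y) powr (1 / q))"
  proof (rule integrableI_bounded[OF mI])
    define c where "c = R powr b"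
    have mw: "(\<lambda>y. weight b y * V y) \<in> borel_measurable lborel"
      using V weight_measurable by (intro borel_measurable_times_ennreal) simp_all
    have "(\<integral>\<^sup>+y. ennreal (norm (indicator (ball 0 R) y *\<^sub>R enn2real (V y) powr (1 / q))) \<partial>lborel)
      \<le> (\<integral>\<^sup>+y. indicator (ball 0 R) y + ennreal c * (weight b y * V y) \<partial>lborel)"
    proof (rule nn_integral_mono_AE)
      have "AE y in lborel. y \<noteq> (0 :: real ^ 'n)" by (rule AE_lborel_singleton)
      moreover have "AE y in lborel. V y \<noteq> \<infinity>" by (rule AE_finite_of_weighted[OF V fin])
      ultimately show "AE y in lborel. ennreal (norm (indicator (ball 0 R) y *\<^sub>R enn2real (V y) powr (1 / q)))
        \<le> indicator (ball 0 R) y + ennreal c * (weight b y * V y)"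
      proof eventually_elim
        case (elim y)
        show ?case
        proof (cases "y \<in> ball 0 R")
          case True
          define v where "v = enn2real (V y)"
          have v: "0 \<le> v" "V y = ennreal v" unfolding v_def using elim by (simp_all add: less_top)
          have y: "0 < norm y" "norm y < R" using elim True by simp_all
          have "v powr (1 / q) \<le> 1 + v"
          proof (cases "v \<le> 1")
            case True
            then have "v powr (1 / q) \<le> 1 powr (1 / q)" using v q by (intro powr_mono2) simp_all
            then show ?thesis using v by simp
          next
            case False
            then have "v powr (1 / q) \<le> v powr 1" using q by (intro powr_mono) (simp_all add: divide_le_eq)
            then show ?thesis using False by simp
          qed
          also have "v \<le> c * (norm y powr (- b) * v)"
          proof -
            have "1 = norm y powr b * norm y powr (- b)" using y by (simp add: powr_add[symmetric])
            also have "\<dots> \<le> c * norm y powr (- b)"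
              unfolding c_def using y b by (intro mult_right_mono powr_mono2) simp_all
            finally have "1 * v \<le> (c * norm y powr (- b)) * v" using v by (intro mult_right_mono) simp_all
            then show ?thesis by (simp add: mult.assoc)
          qed
          finally have "v powr (1 / q) \<le> 1 + c * (norm y powr (- b) * v)" by simp
          then have "ennreal (v powr (1 / q)) \<le> ennreal (1 + c * (norm y powr (- b) * v))" by (rule ennreal_leI)
          also have "\<dots> = 1 + ennreal c * (weight b y * ennreal v)"
          proof -
            have c0: "0 \<le> c" by (simp add: c_def)
            have "ennreal (1 + c * (norm y powr (- b) * v)) = ennreal 1 + ennreal (c * (norm y powr (- b) * v))"
              by (rule ennreal_plus) (use c0 v in simp_all)
            also have "ennreal (c * (norm y powr (- b) * v)) = ennreal c * ennreal (norm y powr (- b) * v)"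
              by (rule ennreal_mult) (use c0 v in simp_all)
            also have "ennreal (norm y powr (- b) * v) = weight b y * ennreal v"
              by (rule ennreal_mult) (use v in simp_all)
            finally show ?thesis by simp
          qed
          finally show ?thesis unfolding v(2)[symmetric] using True by (simp add: v_def)
        qed simp
      qed
    qed
    also have "\<dots> = emeasure lborel (ball (0 :: real ^ 'n) R) + ennreal c * (\<integral>\<^sup>+y. weight b y * V y \<partial>lborel)"
    proof -
      have mi: "(indicator (ball 0 R) :: real ^ 'n \<Rightarrow> ennreal) \<in> borel_measurable lborel"
        by (intro borel_measurable_indicator) simp
      show ?thesis
        unfolding nn_integral_add[OF mi borel_measurable_times_ennreal[OF borel_measurable_const mw]]
          nn_integral_cmult[OF mw] by simp
    qed
    also have "\<dots> < \<infinity>"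
      using fin emeasure_lborel_ball_finite[of "0 :: real ^ 'n" R]
      by (simp add: ennreal_mult_less_top less_top)
    finally show "(\<integral>\<^sup>+y. ennreal (norm (indicator (ball 0 R) y *\<^sub>R enn2real (V y) powr (1 / q))) \<partial>lborel) < \<infinity>" .
  qed
qed

text \<open>The energies of the differences decay like \<rho>^(2 q k). Half of this pays for the
  weights \<rho>^(- q k) in V, and the other half is still summable. Finiteness of V at a point
  gives convergence of u there and the majorant D; the remainders V j give the rate for the
  limit.\<close>

lemma rapid_convergence:
  fixes u :: "nat \<Rightarrow> real ^ 'n::finite \<Rightarrow> complex"
  assumes u: "\<And>k. u k \<in> borel_measurable borel" and b: "0 \<le> b" and q: "1 \<le> q"
    and \<rho>: "0 < \<rho>" "\<rho> < 1" and A: "0 \<le> A"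
    and step: "\<And>k. wenergy b q (\<lambda>y. u k y - u (Suc k) y) \<le> ennreal (A * (\<rho> ^ k) powr (2 * q))"
  shows "\<exists>l D. l \<in> borel_measurable borel \<and> (AE y in lborel. (\<lambda>k. u k y) \<longlonglongrightarrow> l y) \<and> locint D \<and>
    (\<forall>k. AE y in lborel. norm (u k y) \<le> norm (u 0 y) + D y) \<and>
    (\<forall>j. wenergy b q (\<lambda>y. u j y - l y) \<le> ennreal ((1 / (1 - \<rho>)) powr q * (1 / (1 - \<rho> powr q)) * A * (\<rho> ^ j) powr (2 * q)))"
proof -
  define w where "w y = weight b y" for y :: "real ^ 'n"
  define r where "r k y = u k y - u (Suc k) y" for k y
  have mr: "r k \<in> borel_measurable borel" for k unfolding r_def by (intro borel_measurable_diff u)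
  define V where "V j y = (\<Sum>k. ennreal ((inverse \<rho> ^ k * norm (r (j + k) y)) powr q))" for j y
  have mterm: "(\<lambda>y. ennreal ((inverse \<rho> ^ k * norm (r i y)) powr q)) \<in> borel_measurable borel" for k i
    using mr[of i] by measurable
  have mV: "V j \<in> borel_measurable borel" for j
    unfolding V_def by (intro borel_measurable_suminf_order mterm)
  have \<rho>q: "0 < \<rho> powr q" "\<rho> powr q < 1" using \<rho> q powr_less_mono2[of q \<rho> 1] by simp_all
  define A1 where "A1 = (1 / (1 - \<rho> powr q)) * A"
  have A1: "0 \<le> A1" using A \<rho>q by (simp add: A1_def)
  have intV: "(\<integral>\<^sup>+y. w y * V j y \<partial>lborel) \<le> ennreal (A1 * (\<rho> ^ j) powr (2 * q))" for j
  proof -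
    define c where "c k = (inverse \<rho> ^ k) powr q" for k
    have "(\<integral>\<^sup>+y. w y * V j y \<partial>lborel) = (\<integral>\<^sup>+y. (\<Sum>k. w y * ennreal ((inverse \<rho> ^ k * norm (r (j + k) y)) powr q)) \<partial>lborel)"
      unfolding V_def by (simp only: ennreal_suminf_cmult)
    also have "\<dots> = (\<Sum>k. \<integral>\<^sup>+y. w y * ennreal ((inverse \<rho> ^ k * norm (r (j + k) y)) powr q) \<partial>lborel)"
    proof (rule nn_integral_suminf)
      show "(\<lambda>y. w y * ennreal ((inverse \<rho> ^ k * norm (r (j + k) y)) powr q)) \<in> borel_measurable lborel" for k
        unfolding w_def measurable_lborel2 by (intro borel_measurable_times_ennreal weight_measurable mterm)
    qed
    also have "\<dots> \<le> (\<Sum>k. ennreal (A * (\<rho> ^ j) powr (2 * q) * (\<rho> powr q) ^ k))"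
    proof (rule suminf_le)
      fix k
      have "(\<integral>\<^sup>+y. w y * ennreal ((inverse \<rho> ^ k * norm (r (j + k) y)) powr q) \<partial>lborel)
          = (\<integral>\<^sup>+y. ennreal (c k) * (w y * ennreal (norm (r (j + k) y) powr q)) \<partial>lborel)"
      proof (rule nn_integral_cong)
        fix y
        have "(inverse \<rho> ^ k * norm (r (j + k) y)) powr q = c k * norm (r (j + k) y) powr q"
          unfolding c_def by (simp only: powr_mult)
        then have "ennreal ((inverse \<rho> ^ k * norm (r (j + k) y)) powr q) = ennreal (c k) * ennreal (norm (r (j + k) y) powr q)"
          unfolding c_def by (simp only: ennreal_mult powr_ge_zero)
        then show "w y * ennreal ((inverse \<rho> ^ k * norm (r (j + k) y)) powr q) = ennreal (c k) * (w y * ennreal (norm (r (j + k) y) powr q))"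
          by (simp only: mult.left_commute)
      qed
      also have "\<dots> = ennreal (c k) * wenergy b q (r (j + k))"
        unfolding wenergy_def w_def
        by (intro nn_integral_cmult) (use wenergy_measurable[OF mr] in simp)
      also have "\<dots> \<le> ennreal (c k) * ennreal (A * (\<rho> ^ (j + k)) powr (2 * q))"
        using step[of "j + k"] unfolding r_def by (intro mult_left_mono) simp_all
      also have "\<dots> = ennreal (c k * (A * (\<rho> ^ (j + k)) powr (2 * q)))"
        by (rule ennreal_mult[symmetric]) (use A in \<open>simp_all add: c_def\<close>)
      also have "c k * (A * (\<rho> ^ (j + k)) powr (2 * q)) = A * (\<rho> ^ j) powr (2 * q) * (\<rho> powr q) ^ k"
      proof -
        have e1: "(\<rho> ^ (j + k)) powr (2 * q) = (\<rho> ^ j) powr (2 * q) * (\<rho> ^ k) powr (2 * q)"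
          by (simp only: power_add powr_mult)
        have "(\<rho> ^ k) powr (2 * q) = (\<rho> ^ k) powr q * (\<rho> ^ k) powr q"
          by (simp only: mult_2 powr_add)
        moreover have "c k * (\<rho> ^ k) powr q = 1"
        proof -
          have "inverse \<rho> ^ k * \<rho> ^ k = 1" using \<rho> by (simp add: power_mult_distrib[symmetric])
          then have "(inverse \<rho> ^ k * \<rho> ^ k) powr q = 1" by simp
          then show ?thesis unfolding c_def by (simp only: powr_mult)
        qed
        moreover have "(\<rho> ^ k) powr q = (\<rho> powr q) ^ k"
          using \<rho> by (simp add: powr_power powr_realpow[symmetric] powr_powr mult.commute)
        ultimately have "c k * (\<rho> ^ k) powr (2 * q) = (\<rho> powr q) ^ k" by (simp only: mult.assoc[symmetric] mult_1_left)
        then show ?thesis unfolding e1 by (metis mult.assoc mult.left_commute)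
      qed
      finally show "(\<integral>\<^sup>+y. w y * ennreal ((inverse \<rho> ^ k * norm (r (j + k) y)) powr q) \<partial>lborel)
        \<le> ennreal (A * (\<rho> ^ j) powr (2 * q) * (\<rho> powr q) ^ k)" .
    qed simp_all
    also have "\<dots> = ennreal (A * (\<rho> ^ j) powr (2 * q) * (1 / (1 - \<rho> powr q)))"
    proof (rule suminf_ennreal_eq)
      show "0 \<le> A * (\<rho> ^ j) powr (2 * q) * (\<rho> powr q) ^ k" for k using A by simp
      show "(\<lambda>k. A * (\<rho> ^ j) powr (2 * q) * (\<rho> powr q) ^ k) sums (A * (\<rho> ^ j) powr (2 * q) * (1 / (1 - \<rho> powr q)))"
        using \<rho>q by (intro sums_mult geometric_sums) simp
    qed
    also have "A * (\<rho> ^ j) powr (2 * q) * (1 / (1 - \<rho> powr q)) = A1 * (\<rho> ^ j) powr (2 * q)"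
      unfolding A1_def by (simp only: mult_ac)
    finally show ?thesis .
  qed
  have fin: "(\<integral>\<^sup>+y. weight b y * V j y \<partial>lborel) \<noteq> \<infinity>" for j
    using le_less_trans[OF intV[of j] ennreal_less_top] unfolding w_def by (simp add: less_top)
  have q0: "0 < q" using q by simp
  define D where "D y = enn2real (V 0 y) powr (1 / q) * (1 / (1 - \<rho>))" for y
  have lD: "locint D"
  proof -
    have "locint (\<lambda>y. (1 / (1 - \<rho>)) * (enn2real (V 0 y) powr (1 / q)))"
      by (rule locint_bounded_linear[OF bounded_linear_mult_right locint_of_weighted[OF mV b q fin]])
    then show ?thesis unfolding D_def by (simp only: mult.commute)
  qed
  have sumr: "(\<Sum>k<m. r (j + k) y) = u j y - u (j + m) y" for j m y
    by (induction m) (simp_all add: r_def)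
  \<comment> \<open>\<open>lim\<close> has a value at every point, which gives measurability
    outright; it is the limit wherever V 0 is finite.\<close>
  define l where "l y = lim (\<lambda>k. u k y)" for y
  have ml: "l \<in> borel_measurable borel"
    unfolding l_def by (intro borel_measurable_lim_metric u)
  have conv: "(\<lambda>k. u k y) \<longlonglongrightarrow> l y" if "V 0 y \<noteq> \<infinity>" for y
  proof -
    have "summable (\<lambda>k. r (0 + k) y)"
      by (rule geometric_norm_sum(1)[OF \<rho> q0 V_def[of 0 y] that])
    then have "convergent (\<lambda>m. u 0 y - u m y)"
      using summable_iff_convergent[of "\<lambda>k. r (0 + k) y"] sumr[where j=0 and y=y] by simp
    then obtain c where "(\<lambda>m. u 0 y - u m y) \<longlonglongrightarrow> c" unfolding convergent_def ..
    then have "(\<lambda>m. u 0 y - (u 0 y - u m y)) \<longlonglongrightarrow> u 0 y - c"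
      by (intro tendsto_diff tendsto_const)
    then have "convergent (\<lambda>m. u m y)" unfolding convergent_def by auto
    then show ?thesis unfolding l_def by (simp add: convergent_LIMSEQ_iff)
  qed
  have AE0: "AE y in lborel. V 0 y \<noteq> \<infinity>" by (rule AE_finite_of_weighted[OF mV fin])
  have limAE: "AE y in lborel. (\<lambda>k. u k y) \<longlonglongrightarrow> l y"
    using AE0 by eventually_elim (rule conv)
  have dom: "AE y in lborel. norm (u k y) \<le> norm (u 0 y) + D y" for k
    using AE0
  proof eventually_elim
    case (elim y)
    have "norm (u 0 y - u k y) \<le> D y"
      using geometric_norm_sum(3)[OF \<rho> q0 V_def[of 0 y] elim, of k] sumr[where j=0 and m=k and y=y] unfolding D_def by simp
    then show ?case using norm_triangle_ineq4[of "u 0 y" "u 0 y - u k y"] by simp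
  qed
  have en: "wenergy b q (\<lambda>y. u j y - l y) \<le> ennreal ((1 / (1 - \<rho>)) powr q * A1 * (\<rho> ^ j) powr (2 * q))" for j
  proof -
    define d where "d = (1 / (1 - \<rho>)) powr q"
    have d: "0 \<le> d" by (simp add: d_def)
    have mwV: "(\<lambda>y. w y * V j y) \<in> borel_measurable lborel"
      unfolding w_def measurable_lborel2 by (intro borel_measurable_times_ennreal weight_measurable mV)
    have AEj: "AE y in lborel. V j y \<noteq> \<infinity>" by (rule AE_finite_of_weighted[OF mV fin])
    have "wenergy b q (\<lambda>y. u j y - l y) \<le> (\<integral>\<^sup>+y. ennreal d * (w y * V j y) \<partial>lborel)"
      unfolding wenergy_def w_def[symmetric]
    proof (rule nn_integral_mono_AE)
      show "AE y in lborel. w y * ennreal (norm (u j y - l y) powr q) \<le> ennreal d * (w y * V j y)"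
        using AEj limAE
      proof eventually_elim
        case (elim y)
        define X where "X = enn2real (V j y) powr (1 / q) * (1 / (1 - \<rho>))"
        note G = geometric_norm_sum[OF \<rho> q0 V_def[of j y] elim(1), folded X_def]
        have "(\<lambda>m. u (j + m) y) \<longlonglongrightarrow> l y" using LIMSEQ_ignore_initial_segment[OF elim(2), of j] by (simp add: add.commute)
        then have "(\<lambda>m. u j y - u (j + m) y) \<longlonglongrightarrow> u j y - l y" by (intro tendsto_diff tendsto_const)
        then have "(\<lambda>k. r (j + k) y) sums (u j y - l y)" unfolding sums_def sumr .
        then have "suminf (\<lambda>k. r (j + k) y) = u j y - l y" by (rule sums_unique[symmetric])
        then have "norm (u j y - l y) \<le> X" using G(2) by simp
        then have "norm (u j y - l y) powr q \<le> X powr q" using q0 by (intro powr_mono2) simp_all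
        then have "ennreal (norm (u j y - l y) powr q) \<le> ennreal d * V j y"
          unfolding d_def G(4)[symmetric] by (rule ennreal_leI)
        then have "w y * ennreal (norm (u j y - l y) powr q) \<le> w y * (ennreal d * V j y)"
          by (intro mult_left_mono) simp_all
        then show ?case by (simp only: mult.left_commute)
      qed
    qed
    also have "\<dots> = ennreal d * (\<integral>\<^sup>+y. w y * V j y \<partial>lborel)" by (rule nn_integral_cmult[OF mwV])
    also have "\<dots> \<le> ennreal d * ennreal (A1 * (\<rho> ^ j) powr (2 * q))" by (intro mult_left_mono intV) simp
    also have "\<dots> = ennreal (d * (A1 * (\<rho> ^ j) powr (2 * q)))"
      by (rule ennreal_mult[symmetric]) (use d A1 in simp_all)
    finally show ?thesis unfolding d_def by (simp only: mult.assoc)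
  qed
  show ?thesis
    by (intro exI[of _ l] exI[of _ D] conjI allI ml limAE lD dom)
       (use en in \<open>simp only: A1_def mult.assoc\<close>)
qed

section \<open>Approximation by mollification and compactness\<close>

text \<open>At the scales 2^j the telescoping identity expresses consecutive differences through the
  Laplacian, with energies decaying like 2^(- j \<kappa>). Positivity of \<kappa> is what turns this
  into convergence.\<close>

lemma mollifier_approx:
  assumes m: "mollifier_pair TYPE('n::finite) B \<Phi> w" and b: "0 \<le> b" "b < real CARD('n)" and p: "1 < p" and q: "2 \<le> q"
    and \<kappa>: "0 < 2 * q - real CARD('n) * q / 2 + real CARD('n) - b"
  shows "\<exists>K \<rho>. 0 \<le> K \<and> 0 < \<rho> \<and> \<rho> < 1 \<and> (\<forall>(f :: real ^ 'n \<Rightarrow> complex) g. Lp_fun p f \<longrightarrow> Lp_fun 2 g \<longrightarrow> weak_lap f g \<longrightarrow>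
    (\<forall>j. wenergy b q (\<lambda>y. rconv \<Phi> (2 ^ j) f y - f y) \<le> ennreal (K * mass 2 g powr (q / 2) * (\<rho> ^ j) powr (2 * q))))"
proof -
  define kap where "kap = 2 * q - real CARD('n) * q / 2 + real CARD('n) - b"
  have kap: "0 < kap" using \<kappa> by (simp add: kap_def)
  have k: "profile B \<Phi>" "profile B w" "(\<integral>z. \<Phi> (z \<bullet> z) \<partial>(lborel :: (real ^ 'n) measure)) = 1"
    using m unfolding mollifier_pair_def by blast+
  obtain K0 where KK: "0 \<le> K0 \<and> (\<forall>t>0. \<forall>g :: real ^ 'n \<Rightarrow> complex. Lp_fun 2 g \<longrightarrow>
    wenergy b q (\<lambda>y. (1 / t^2) *\<^sub>R rconv w t g y) \<le> ennreal (K0 * t powr (- kap) * mass 2 g powr (q / 2)))"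
    using wenergy_rconv_le[OF k(2) b q] unfolding kap_def ..
  note K0 = KK[THEN conjunct1]
  obtain C where "kernel_bounds TYPE('n) \<Phi> p C"
    using kernel_bounds_exist[OF k(1) p] ..
  note CC = this[unfolded kernel_bounds_def]
  \<comment> \<open>Chosen so that (2^j)^(- kap) equals (\<rho>^j)^(2 q), the rate that
    \<open>rapid_convergence\<close> expects.\<close>
  define \<rho> where "\<rho> = 2 powr (- kap / (2 * q))"
  have q0: "0 < q" "1 \<le> q" using q by simp_all
  have "- kap / (2 * q) < 0" using kap q0 by (simp add: divide_neg_pos)
  then have \<rho>: "0 < \<rho>" "\<rho> < 1"
    using powr_less_cancel_iff[of 2 "- kap / (2 * q)" 0] by (simp_all add: \<rho>_def)
  have rate: "(2 ^ j) powr (- kap) = (\<rho> ^ j) powr (2 * q)" for j :: nat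
  proof -
    have "\<rho> ^ j = \<rho> powr real j" using \<rho> by (simp add: powr_realpow)
    then have "(\<rho> ^ j) powr (2 * q) = 2 powr (- kap / (2 * q) * real j * (2 * q))"
      by (simp only: \<rho>_def powr_powr)
    also have "- kap / (2 * q) * real j * (2 * q) = real j * - kap" using q0 by simp
    also have "2 powr (real j * - kap) = (2 powr real j) powr (- kap)" by (simp only: powr_powr)
    also have "2 powr real j = 2 ^ j" by (simp add: powr_realpow)
    finally show ?thesis by simp
  qed
  define K where "K = (1 / (1 - \<rho>)) powr q * (1 / (1 - \<rho> powr q)) * K0"
  have "\<rho> powr q < 1" using \<rho> q0 powr_less_mono2[of q \<rho> 1] by simp
  then have K: "0 \<le> K" using K0 by (simp add: K_def)
  have main: "wenergy b q (\<lambda>y. rconv \<Phi> (2 ^ j) f y - f y) \<le> ennreal (K * mass 2 g powr (q / 2) * (\<rho> ^ j) powr (2 * q))"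
    if f: "Lp_fun p f" and g: "Lp_fun 2 g" and wl: "weak_lap f g" for f g :: "real ^ 'n \<Rightarrow> complex" and j
  proof -
    have lf: "locint f" using Lp_fun_locint[OF _ f] p by simp
    have mf: "f \<in> borel_measurable borel" using f by (simp add: Lp_fun_def)
    define u where "u j = rconv \<Phi> (2 ^ j) f" for j :: nat
    define G where "G = mass 2 g powr (q / 2)"
    have mu: "u i \<in> borel_measurable borel" for i unfolding u_def by (rule rconv_measurable[OF k(1) mf])
    have step: "wenergy b q (\<lambda>y. u i y - u (Suc i) y) \<le> ennreal ((K0 * G) * (\<rho> ^ i) powr (2 * q))" for i
    proof -
      have "u i y - u (Suc i) y = (1 / (2 ^ i)^2) *\<^sub>R rconv w (2 ^ i) g y" for y
        using rconv_telescope[OF m lf wl, of "2 ^ i" y] by (simp add: u_def)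
      then have "wenergy b q (\<lambda>y. u i y - u (Suc i) y) \<le> ennreal (K0 * (2 ^ i) powr (- kap) * G)"
        using KK[THEN conjunct2, rule_format, of "2 ^ i" g] g unfolding G_def by simp
      then show ?thesis unfolding rate by (simp only: mult_ac)
    qed
    have A: "0 \<le> K0 * G" using K0 by (simp add: G_def)
    from rapid_convergence[of u, OF mu b(1) q0(2) \<rho> A step]
    obtain l D where l: "l \<in> borel_measurable borel" "AE y in lborel. (\<lambda>k. u k y) \<longlonglongrightarrow> l y" "locint D"
      "\<And>k. AE y in lborel. norm (u k y) \<le> norm (u 0 y) + D y"
      "\<And>j. wenergy b q (\<lambda>y. u j y - l y) \<le> ennreal ((1 / (1 - \<rho>)) powr q * (1 / (1 - \<rho> powr q)) * (K0 * G) * (\<rho> ^ j) powr (2 * q))"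
      by (elim exE conjE) blast
    define c where "c = (C * mass p f) powr (1 / p)"
    have u0: "norm (u 0 y) \<le> c" for y
    proof -
      have "norm (u 0 y) powr p \<le> C * mass p f"
        using CC[THEN conjunct2, rule_format, of 1 f, THEN conjunct1] f by (simp add: u_def)
      then have "(norm (u 0 y) powr p) powr (1 / p) \<le> c" unfolding c_def using p by (intro powr_mono2) simp_all
      then show ?thesis using p by (simp add: powr_powr)
    qed
    \<comment> \<open>The majorant of all mollifications: \<open>u 0\<close> is bounded by the
      constant c, and D controls the distance to \<open>u 0\<close>.\<close>
    have lD: "locint (\<lambda>y. c + D y)"
    proof -
      have "locint (\<lambda>y. D y - (- c))" by (rule locint_diff[OF l(3) locint_const])
      then show ?thesis by (simp add: add.commute)
    qed
    have dom: "AE y in lborel. norm (rconv \<Phi> (2 ^ i) f y) \<le> c + D y" for i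
      using l(4)[of i]
    proof eventually_elim
      case (elim y)
      then show ?case using u0[of y] unfolding u_def by linarith
    qed
    have "AE y in lborel. l y = f y"
      by (rule rconv_limit_AE[OF k(1,3) lf l(1) l(2)[unfolded u_def] lD dom])
    then have "wenergy b q (\<lambda>y. u j y - f y) = wenergy b q (\<lambda>y. u j y - l y)"
      unfolding wenergy_def by (intro nn_integral_cong_AE) (auto elim!: eventually_mono)
    also have "\<dots> \<le> ennreal ((1 / (1 - \<rho>)) powr q * (1 / (1 - \<rho> powr q)) * (K0 * G) * (\<rho> ^ j) powr (2 * q))" by (rule l(5))
    also have "(1 / (1 - \<rho>)) powr q * (1 / (1 - \<rho> powr q)) * (K0 * G) * (\<rho> ^ j) powr (2 * q) = K * G * (\<rho> ^ j) powr (2 * q)"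
      unfolding K_def by (simp only: mult_ac)
    finally show ?thesis unfolding u_def G_def .
  qed
  show ?thesis
    by (rule exI[of _ K], rule exI[of _ \<rho>], rule conjI[OF K], rule conjI[OF \<rho>(1)], rule conjI[OF \<rho>(2)],
        intro allI impI, rule main)
qed

section \<open>Compactness at a fixed scale\<close>

text \<open>The modulus comes from uniform continuity of the kernel on a compact set of pairs. The
  function f enters only through |f| \<le> 1 + |f|^p on a ball, so d depends on f through F0
  alone.\<close>

lemma rconv_equicontinuous:
  assumes k: "profile B k" and t: "0 < t" and p: "1 \<le> p" and e: "0 < e"
  shows "\<exists>d>0. \<forall>(f :: real ^ 'n::finite \<Rightarrow> complex) y y'. Lp_fun p f \<longrightarrow> mass p f \<le> F0 \<longrightarrow>
    y \<in> cball 0 R \<longrightarrow> y' \<in> cball 0 R \<longrightarrow> norm (y - y') < d \<longrightarrow> norm (rconv k t f y - rconv k t f y') < e"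
proof -
  define R' where "R' = R + 2 / t"
  define vol where "vol = measure lborel (ball (0 :: real ^ 'n) (R' + 1))"
  define Q where "Q = vol + \<bar>F0\<bar> + 1"
  have Q: "0 < Q" by (simp add: Q_def vol_def add_nonneg_pos)
  define \<eta> where "\<eta> = e / (2 * Q)"
  have \<eta>: "0 < \<eta>" using e Q by (simp add: \<eta>_def)
  define S where "S = cball (0 :: real ^ 'n) R' \<times> cball (0 :: real ^ 'n) R"
  have "uniformly_continuous_on S (\<lambda>p. kern k t (snd p) (fst p))"
    unfolding S_def
    by (intro compact_uniformly_continuous compact_Times compact_cball
        continuous_on_subset[OF kern_continuous[OF k]]) simp
  then obtain d where d: "d > 0" "\<And>P P'. P \<in> S \<Longrightarrow> P' \<in> S \<Longrightarrow> dist P' P < d \<Longrightarrow>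
      dist (kern k t (snd P') (fst P')) (kern k t (snd P) (fst P)) < \<eta>"
    using \<eta> unfolding uniformly_continuous_on_def by blast
  have main: "norm (rconv k t f y - rconv k t f y') < e"
    if f: "Lp_fun p f" and F: "mass p f \<le> F0" and y: "y \<in> cball 0 R" "y' \<in> cball 0 R" "norm (y - y') < d"
    for f :: "real ^ 'n \<Rightarrow> complex" and y y'
  proof -
    have lf: "locint f" by (rule Lp_fun_locint[OF p f])
    \<comment> \<open>Radius R' + 1 because the open ball in the majorant must contain the closed
      ball of radius R', outside of which both kernels vanish.\<close>
    have kd: "\<bar>kern k t y x - kern k t y' x\<bar> \<le> \<eta> * indicator (ball 0 (R' + 1)) x" for x
    proof (cases "x \<in> cball 0 R'")
      case True
      have "dist (kern k t (snd (x, y)) (fst (x, y))) (kern k t (snd (x, y')) (fst (x, y'))) < \<eta>"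
        by (rule d(2)) (use True y in \<open>simp_all add: S_def dist_Pair_Pair dist_norm\<close>)
      then show ?thesis using True by (simp add: dist_real_def)
    next
      case False
      have "x \<notin> ball z (2 / t)" if "z \<in> cball 0 R" for z
        using that False norm_triangle_ineq2[of x z] by (simp add: R'_def dist_norm norm_minus_commute)
      then have "kern k t y x = 0" "kern k t y' x = 0"
        using y kern_bound[OF k t, of y x] kern_bound[OF k t, of y' x] by simp_all
      then show ?thesis using \<eta> by simp
    qed
    have ip: "integrable lborel (\<lambda>x. norm (f x) powr p)" using f by (simp add: Lp_fun_def)
    have ii: "integrable lborel (indicator (ball 0 (R' + 1)) :: real ^ 'n \<Rightarrow> real)"
    proof -
      have "locint (\<lambda>x :: real ^ 'n. 1 :: real)" by (rule locint_const)
      then show ?thesis unfolding locint_def by simp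
    qed
    have isum: "integrable lborel (\<lambda>x. \<eta> * (indicator (ball 0 (R' + 1)) x + norm (f x) powr p))"
      by (intro integrable_mult_right Bochner_Integration.integrable_add ii ip)
    have i1: "integrable lborel (\<lambda>x. kern k t y x *\<^sub>R f x)" "integrable lborel (\<lambda>x. kern k t y' x *\<^sub>R f x)"
      by (rule kern_integrable[OF k t lf])+
    have "rconv k t f y - rconv k t f y' = (\<integral>x. kern k t y x *\<^sub>R f x - kern k t y' x *\<^sub>R f x \<partial>lborel)"
      unfolding rconv_def by (rule Bochner_Integration.integral_diff[symmetric, OF i1])
    also have "norm \<dots> \<le> (\<integral>x. \<eta> * (indicator (ball 0 (R' + 1)) x + norm (f x) powr p) \<partial>lborel)"
    proof (rule Bochner_Integration.integral_norm_bound_integral[OF Bochner_Integration.integrable_diff[OF i1] isum])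
      fix x
      have "norm (kern k t y x *\<^sub>R f x - kern k t y' x *\<^sub>R f x) = \<bar>kern k t y x - kern k t y' x\<bar> * norm (f x)"
        by (simp add: scaleR_diff_left[symmetric])
      also have "\<dots> \<le> (\<eta> * indicator (ball 0 (R' + 1)) x) * norm (f x)" by (intro mult_right_mono kd) simp
      also have "\<dots> = \<eta> * (indicator (ball 0 (R' + 1)) x * norm (f x))" by (simp only: mult.assoc)
      also have "\<dots> \<le> \<eta> * (indicator (ball 0 (R' + 1)) x + norm (f x) powr p)"
      proof (rule mult_left_mono)
        show "indicator (ball 0 (R' + 1)) x * norm (f x) \<le> indicator (ball 0 (R' + 1)) x + norm (f x) powr p"
          using le_interpolate_powr[of 1 p "norm (f x)"] p by (cases "x \<in> ball 0 (R' + 1)") simp_all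
      qed (use \<eta> in simp)
      finally show "norm (kern k t y x *\<^sub>R f x - kern k t y' x *\<^sub>R f x) \<le> \<eta> * (indicator (ball 0 (R' + 1)) x + norm (f x) powr p)" .
    qed
    also have "\<dots> = \<eta> * (vol + mass p f)"
      unfolding vol_def mass_def using ii ip by simp
    also have "\<dots> \<le> \<eta> * Q" using F \<eta> unfolding Q_def by (intro mult_left_mono) simp_all
    also have "\<dots> < e" using e Q by (simp add: \<eta>_def)
    finally show ?thesis .
  qed
  show ?thesis by (rule exI[of _ d], rule conjI[OF d(1)], intro allI impI, rule main)
qed

text \<open>Arzela-Ascoli on a ball: the uniform bound and the equicontinuity both come from the
  bound on the L^p mass.\<close>

lemma rconv_uniform_subsequence:
  fixes f :: "nat \<Rightarrow> real ^ 'n::finite \<Rightarrow> complex"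
  assumes k: "profile B k" and t: "0 < t" and p: "1 < p"
    and f: "\<And>i. Lp_fun p (f i)" "\<And>i. mass p (f i) \<le> F0" and \<eta>: "0 < \<eta>"
  shows "\<exists>r :: nat \<Rightarrow> nat. strict_mono r \<and> (\<forall>i j. \<forall>y\<in>cball 0 R. norm (rconv k t (f (r i)) y - rconv k t (f (r j)) y) \<le> \<eta>)"
proof -
  obtain C where "kernel_bounds TYPE('n) k p C"
    using kernel_bounds_exist[OF k p] ..
  note CC = this[unfolded kernel_bounds_def]
  define M where "M = (C * t ^ CARD('n) * F0) powr (1 / p)"
  have bound: "norm (rconv k t (f i) y) \<le> M" for i y
  proof -
    have D: "0 \<le> C * t ^ CARD('n)" using CC t by simp
    have "norm (rconv k t (f i) y) powr p \<le> C * t ^ CARD('n) * mass p (f i)"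
      using CC[THEN conjunct2, rule_format, OF t f(1)[of i], THEN conjunct1] by blast
    also have "\<dots> \<le> C * t ^ CARD('n) * F0" by (rule mult_left_mono[OF f(2) D])
    finally have "(norm (rconv k t (f i) y) powr p) powr (1 / p) \<le> M"
      unfolding M_def using p by (intro powr_mono2) simp_all
    then show ?thesis using p by (simp add: powr_powr)
  qed
  have p1: "1 \<le> p" using p by simp
  have equi: "\<exists>d>0. \<forall>n y. y \<in> cball 0 R \<and> norm (x - y) < d \<longrightarrow> norm (rconv k t (f n) x - rconv k t (f n) y) < e"
    if xR: "x \<in> cball 0 R" and e0: "0 < e" for x e
  proof -
    obtain d where dd: "d > 0 \<and> (\<forall>(f :: real ^ 'n \<Rightarrow> complex) y y'. Lp_fun p f \<longrightarrow> mass p f \<le> F0 \<longrightarrow>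
      y \<in> cball 0 R \<longrightarrow> y' \<in> cball 0 R \<longrightarrow> norm (y - y') < d \<longrightarrow> norm (rconv k t f y - rconv k t f y') < e)"
      using rconv_equicontinuous[OF k t p1 e0] ..
    show ?thesis
    proof (intro exI[of _ d] conjI allI impI)
      show "0 < d" using dd ..
      fix n y assume "y \<in> cball 0 R \<and> norm (x - y) < d"
      then show "norm (rconv k t (f n) x - rconv k t (f n) y) < e"
        using dd[THEN conjunct2, rule_format, OF f(1)[of n] f(2)[of n] xR, of y] by simp
    qed
  qed
  obtain g r where gr: "strict_mono (r :: nat \<Rightarrow> nat)"
    "\<And>e. 0 < e \<Longrightarrow> \<exists>N. \<forall>n x. n \<ge> N \<and> x \<in> cball 0 R \<longrightarrow> norm (rconv k t (f (r n)) x - g x) < e"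
  proof (rule Arzela_Ascoli[of "cball (0 :: real ^ 'n) R" "\<lambda>n. rconv k t (f n)" M])
    fix g :: "real ^ 'n \<Rightarrow> complex" and r :: "nat \<Rightarrow> nat"
    assume a: "strict_mono r"
      and b: "\<And>e. 0 < e \<Longrightarrow> \<exists>N. \<forall>n x. n \<ge> N \<and> x \<in> cball 0 R \<longrightarrow> norm (rconv k t (f (r n)) x - g x) < e"
    show thesis by (rule that[OF a b])
  qed (rule compact_cball bound equi; assumption)+
  obtain N where N: "\<forall>n x. n \<ge> N \<and> x \<in> cball 0 R \<longrightarrow> norm (rconv k t (f (r n)) x - g x) < \<eta> / 2"
    using gr(2)[of "\<eta> / 2"] \<eta> by auto
  \<comment> \<open>Dropping the first N indices makes the bound hold for all pairs, not only
    eventually; only this form passes to every further subsequence.\<close>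
  have sm: "strict_mono (\<lambda>i. r (i + N))"
    using gr(1) unfolding strict_mono_def by simp
  have cl: "norm (rconv k t (f (r (i + N))) y - rconv k t (f (r (j + N))) y) \<le> \<eta>" if "y \<in> cball 0 R" for i j y
  proof -
    have "norm (rconv k t (f (r (i + N))) y - g y) < \<eta> / 2" "norm (rconv k t (f (r (j + N))) y - g y) < \<eta> / 2"
      using N that by simp_all
    then show ?thesis
      using norm_triangle_ineq4[of "rconv k t (f (r (i + N))) y - g y" "rconv k t (f (r (j + N))) y - g y"] by simp
  qed
  show ?thesis
    by (rule exI[of _ "\<lambda>i. r (i + N)"], rule conjI[OF sm], intro allI ballI, rule cl)
qed

lemma small_powr_exists:
  fixes c e a :: real
  assumes "0 \<le> c" "0 < e" "0 < a"
  shows "\<exists>L>0. c * L powr (- e) \<le> a"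
proof -
  define x where "x = c / a + 1"
  have x: "1 \<le> x" using assms by (simp add: x_def)
  define L where "L = x powr (1 / e)"
  have "L powr (- e) = inverse x" using x assms by (simp add: L_def powr_powr powr_minus)
  moreover have "c * inverse x \<le> a"
  proof -
    have "c \<le> a * x" using assms by (simp add: x_def distrib_left)
    then show ?thesis using x by (simp add: field_simps)
  qed
  ultimately show ?thesis using x by (intro exI[of _ L]) (simp add: L_def)
qed

section \<open>Extraction of a convergent subsequence\<close>

lemma wenergy_split_le:
  fixes u v :: "real ^ 'n::finite \<Rightarrow> complex"
  assumes m: "u \<in> borel_measurable borel" "v \<in> borel_measurable borel" and q: "0 \<le> q" and \<eta>: "0 \<le> \<eta>"
    and close: "\<And>y. y \<in> cball 0 R \<Longrightarrow> norm (u y - v y) \<le> \<eta>"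
    and inner: "(\<integral>\<^sup>+y. weight b y * indicator (ball 0 R) (y :: real ^ 'n) \<partial>lborel) \<le> ennreal I" "0 \<le> I"
    and outer: "(\<integral>\<^sup>+y. weight b y * ennreal (norm (u y) powr q) * indicator {y. R \<le> norm y} y \<partial>lborel) \<le> ennreal T"
      "(\<integral>\<^sup>+y. weight b y * ennreal (norm (v y) powr q) * indicator {y. R \<le> norm y} y \<partial>lborel) \<le> ennreal T" "0 \<le> T"
  shows "wenergy b q (\<lambda>y. u y - v y) \<le> ennreal (\<eta> powr q * I + 2 powr q * (T + T))"
proof -
  define w where "w y = weight b y" for y :: "real ^ 'n"
  define O' where "O' = {y :: real ^ 'n. R \<le> norm y}"
  have mO: "O' \<in> sets borel" unfolding O'_def
    by (intro borel_closed closed_Collect_le continuous_intros)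
  have mi: "(\<lambda>y. w y * indicator (ball 0 R) y) \<in> borel_measurable lborel"
    unfolding w_def by (intro borel_measurable_times_ennreal borel_measurable_indicator)
      (use weight_measurable in simp_all)
  have mu: "(\<lambda>y. (w y * ennreal (norm (u y) powr q)) * indicator O' y) \<in> borel_measurable lborel"
    "(\<lambda>y. (w y * ennreal (norm (v y) powr q)) * indicator O' y) \<in> borel_measurable lborel"
    unfolding w_def measurable_lborel2
    by (intro borel_measurable_times_ennreal[OF wenergy_measurable[OF m(1)]] borel_measurable_times_ennreal[OF wenergy_measurable[OF m(2)]] borel_measurable_indicator mO)+
  define a where "a = ennreal (\<eta> powr q)"
  define c where "c = ennreal (2 powr q)"
  have "wenergy b q (\<lambda>y. u y - v y) \<le> (\<integral>\<^sup>+y. a * (w y * indicator (ball 0 R) y)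
      + c * ((w y * ennreal (norm (u y) powr q)) * indicator O' y + (w y * ennreal (norm (v y) powr q)) * indicator O' y) \<partial>lborel)"
    unfolding wenergy_def w_def[symmetric]
  proof (rule nn_integral_mono)
    fix y
    show "w y * ennreal (norm (u y - v y) powr q) \<le> a * (w y * indicator (ball 0 R) y)
      + c * ((w y * ennreal (norm (u y) powr q)) * indicator O' y + (w y * ennreal (norm (v y) powr q)) * indicator O' y)"
    proof (cases "R \<le> norm y")
      case False
      then have "norm (u y - v y) powr q \<le> \<eta> powr q" using close[of y] q by (intro powr_mono2) simp_all
      then have "w y * ennreal (norm (u y - v y) powr q) \<le> w y * a"
        unfolding a_def by (intro mult_left_mono ennreal_leI) simp_all
      then show ?thesis using False by (simp add: O'_def mult.commute)
    next
      case True
      have "norm (u y - v y) powr q \<le> (norm (u y) + norm (v y)) powr q"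
        using norm_triangle_ineq4[of "u y" "v y"] q by (intro powr_mono2) simp_all
      also have "\<dots> \<le> 2 powr q * (norm (u y) powr q + norm (v y) powr q)"
        using q by (intro powr_add_le) simp_all
      finally have "ennreal (norm (u y - v y) powr q) \<le> ennreal (2 powr q * (norm (u y) powr q + norm (v y) powr q))"
        by (rule ennreal_leI)
      also have "\<dots> = c * (ennreal (norm (u y) powr q) + ennreal (norm (v y) powr q))"
        unfolding c_def by (simp only: ennreal_mult ennreal_plus powr_ge_zero add_nonneg_nonneg)
      finally have "w y * ennreal (norm (u y - v y) powr q) \<le> w y * (c * (ennreal (norm (u y) powr q) + ennreal (norm (v y) powr q)))"
        by (intro mult_left_mono) simp_all
      also have "\<dots> = c * (w y * ennreal (norm (u y) powr q) + w y * ennreal (norm (v y) powr q))"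
        by (simp only: distrib_left mult.left_commute)
      finally show ?thesis using True by (simp add: O'_def)
    qed
  qed
  also have "\<dots> = a * (\<integral>\<^sup>+y. w y * indicator (ball 0 R) y \<partial>lborel)
      + c * ((\<integral>\<^sup>+y. (w y * ennreal (norm (u y) powr q)) * indicator O' y \<partial>lborel) + (\<integral>\<^sup>+y. (w y * ennreal (norm (v y) powr q)) * indicator O' y \<partial>lborel))"
    unfolding nn_integral_add[OF borel_measurable_times_ennreal[OF borel_measurable_const mi]
        borel_measurable_times_ennreal[OF borel_measurable_const borel_measurable_add[OF mu]]]
      nn_integral_cmult[OF mi] nn_integral_cmult[OF borel_measurable_add[OF mu]] nn_integral_add[OF mu] ..
  also have "\<dots> \<le> a * ennreal I + c * (ennreal T + ennreal T)"
    using inner(1) outer(1,2) unfolding w_def O'_def by (intro add_mono mult_left_mono) simp_all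
  also have "\<dots> = ennreal (\<eta> powr q * I + 2 powr q * (T + T))"
  proof -
    have 1: "a * ennreal I = ennreal (\<eta> powr q * I)"
      unfolding a_def by (rule ennreal_mult[symmetric]) (use inner(2) in simp_all)
    have 2: "ennreal T + ennreal T = ennreal (T + T)" by (rule ennreal_plus[symmetric]) (use outer(3) in simp_all)
    have 3: "c * ennreal (T + T) = ennreal (2 powr q * (T + T))"
      unfolding c_def by (rule ennreal_mult[symmetric]) (use outer(3) in simp_all)
    show ?thesis unfolding 1 2 3
      by (rule ennreal_plus[symmetric]) (use inner(2) outer(3) in simp_all)
  qed
  finally show ?thesis .
qed

text \<open>The parameters are chosen in a fixed order, each uniform over the sequence: the scale
  from the mollification error, then L and R from the tail at that scale, then the uniform tolerance
  \<eta> on the ball of radius R.\<close>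

lemma close_subsequence:
  fixes f g :: "nat \<Rightarrow> real ^ 'n::finite \<Rightarrow> complex"
  assumes mp: "mollifier_pair TYPE('n) B \<Phi> w" and b: "0 < b" "b < real CARD('n)" and p: "1 < p" and q: "2 \<le> q"
    and \<kappa>: "0 < 2 * q - real CARD('n) * q / 2 + real CARD('n) - b"
    and pq: "p < q * real CARD('n) / (real CARD('n) - b)"
    and f: "\<And>i. Lp_fun p (f i)" "\<And>i. mass p (f i) \<le> F0"
    and g: "\<And>i. Lp_fun 2 (g i)" "\<And>i. mass 2 (g i) \<le> G0" and wl: "\<And>i. weak_lap (f i) (g i)"
    and \<delta>: "0 < \<delta>"
  shows "\<exists>r :: nat \<Rightarrow> nat. strict_mono r \<and> (\<forall>i j. wenergy b q (\<lambda>y. f (r i) y - f (r j) y) \<le> ennreal \<delta>)"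
proof -
  have k: "profile B \<Phi>" using mp unfolding mollifier_pair_def by blast
  have b0: "0 \<le> b" and q0: "0 < q" "0 \<le> q" using b q by simp_all
  have mf: "f i \<in> borel_measurable borel" for i using f(1)[of i] by (simp add: Lp_fun_def)
  define X where "X = 2 powr q"
  have X: "0 < X" by (simp add: X_def)
  \<comment> \<open>The triangle inequality with constant X is used twice, around f, T, T, f; with
    each piece at most a the total is X (a + X (a + a)) = \<delta>.\<close>
  define a where "a = \<delta> / (X * (1 + 2 * X))"
  have a: "0 < a" using \<delta> X by (simp add: a_def add_pos_pos)
  \<comment> \<open>The ball contributes at most h and the two tails X (h + h), which together stay
    below h (1 + 4 X) = a.\<close>
  define h where "h = a / (1 + 4 * X)"
  have h: "0 < h" using a X by (simp add: h_def add_pos_pos)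
  obtain K \<rho> where K: "0 \<le> K" and \<rho>: "0 < \<rho>" "\<rho> < 1"
    and app: "\<forall>(f :: real ^ 'n \<Rightarrow> complex) g. Lp_fun p f \<longrightarrow> Lp_fun 2 g \<longrightarrow> weak_lap f g \<longrightarrow>
    (\<forall>j. wenergy b q (\<lambda>y. rconv \<Phi> (2 ^ j) f y - f y) \<le> ennreal (K * mass 2 g powr (q / 2) * (\<rho> ^ j) powr (2 * q)))"
    using mollifier_approx[OF mp b0 b(2) p q \<kappa>] by (elim exE conjE) blast
  define G where "G = K * G0 powr (q / 2)"
  have G0: "0 \<le> G0" using g(2)[of 0] mass_nonneg[of 2 "g 0"] by linarith
  have G: "0 \<le> G" using K by (simp add: G_def)
  have "0 < a / (G + 1)" using a G by simp
  moreover have "\<rho> powr (2 * q) < 1" using \<rho> q0 powr_less_mono2[of "2 * q" \<rho> 1] by simp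
  ultimately obtain j0 where j0: "(\<rho> powr (2 * q)) ^ j0 < a / (G + 1)" using real_arch_pow_inv by blast
  define t :: real where "t = 2 ^ j0"
  have t: "0 < t" by (simp add: t_def)
  define T where "T i = rconv \<Phi> t (f i)" for i
  have mT: "T i \<in> borel_measurable borel" for i unfolding T_def by (rule rconv_measurable[OF k mf])
  have appT: "wenergy b q (\<lambda>y. T i y - f i y) \<le> ennreal a" for i
  proof -
    have "mass 2 (g i) powr (q / 2) \<le> G0 powr (q / 2)"
      using g(2)[of i] mass_nonneg[of 2 "g i"] q0 by (intro powr_mono2) simp_all
    then have "K * mass 2 (g i) powr (q / 2) \<le> G" unfolding G_def by (rule mult_left_mono[OF _ K])
    then have "K * mass 2 (g i) powr (q / 2) * (\<rho> ^ j0) powr (2 * q) \<le> G * (\<rho> ^ j0) powr (2 * q)"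
      by (rule mult_right_mono) simp
    also have "G * (\<rho> ^ j0) powr (2 * q) = G * (\<rho> powr (2 * q)) ^ j0"
      using \<rho> by (simp add: powr_power powr_realpow[symmetric] powr_powr mult.commute)
    also have "G * (\<rho> powr (2 * q)) ^ j0 \<le> G * (a / (G + 1))" using j0 G by (intro mult_left_mono) simp_all
    also have "\<dots> \<le> a" using G a by (simp add: field_simps)
    finally have "ennreal (K * mass 2 (g i) powr (q / 2) * (\<rho> ^ j0) powr (2 * q)) \<le> ennreal a" by (rule ennreal_leI)
    with app[rule_format, OF f(1)[of i] g(1)[of i] wl[of i], of j0] show ?thesis
      unfolding T_def t_def by (rule order_trans)
  qed
  have appT': "wenergy b q (\<lambda>y. f i y - T i y) \<le> ennreal a" for i
    using appT[of i] unfolding wenergy_def by (simp only: norm_minus_commute)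
  obtain K1 a1 e1 where ab: "avg_bounds TYPE('n) b q p \<Phi> t K1 a1 e1"
    using avg_bounds_exist[OF k b q0(1) p pq t] by blast
  then have K1: "0 \<le> K1" "0 < a1" "0 < e1" unfolding avg_bounds_def by blast+
  define Z where "Z = K1 * F0 powr (q / p)"
  have Z: "0 \<le> Z" using K1 by (simp add: Z_def)
  \<comment> \<open>L is fixed before R, because R has to absorb the factor L of the other
    term.\<close>
  obtain L where L: "0 < L" "Z * L powr (- e1) \<le> h / 2" using small_powr_exists[OF Z K1(3), of "h / 2"] h by auto
  have ZL: "0 \<le> Z * L" using Z L by simp
  obtain R where R: "0 < R" "(Z * L) * R powr (- a1) \<le> h / 2" using small_powr_exists[OF ZL K1(2), of "h / 2"] h by auto
  have tail: "(\<integral>\<^sup>+y. weight b y * ennreal (norm (T i y) powr q) * indicator {y. R \<le> norm y} y \<partial>lborel) \<le> ennreal h" for i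
  proof -
    define V where "V = L * R powr (- a1) + L powr (- e1)"
    have V: "0 \<le> V" using L by (simp add: V_def)
    have "mass p (f i) powr (q / p) \<le> F0 powr (q / p)"
      using f(2)[of i] mass_nonneg[of p "f i"] q0 p by (intro powr_mono2) simp_all
    then have "K1 * mass p (f i) powr (q / p) \<le> Z" unfolding Z_def by (rule mult_left_mono[OF _ K1(1)])
    then have "K1 * mass p (f i) powr (q / p) * V \<le> Z * V" by (rule mult_right_mono[OF _ V])
    also have "Z * V = (Z * L) * R powr (- a1) + Z * L powr (- e1)" unfolding V_def by (simp only: distrib_left mult.assoc)
    also have "\<dots> \<le> h" using R(2) L(2) by linarith
    finally have "ennreal (K1 * mass p (f i) powr (q / p) * V) \<le> ennreal h" by (rule ennreal_leI)
    moreover have "(\<integral>\<^sup>+y. weight b y * ennreal (norm (T i y) powr q) * indicator {y. R \<le> norm y} y \<partial>lborel)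
      \<le> ennreal (K1 * mass p (f i) powr (q / p) * V)"
      using ab[unfolded avg_bounds_def, THEN conjunct2, THEN conjunct2, THEN conjunct2, rule_format, OF f(1)[of i],
        THEN conjunct2, THEN conjunct2, rule_format, OF R(1) L(1)] unfolding V_def T_def .
    ultimately show ?thesis by (rule order_trans[rotated])
  qed
  have bN: "b < real DIM(real ^ 'n)" using b by simp
  obtain C where CC: "0 \<le> C \<and> (\<forall>a>0. \<forall>x :: real ^ 'n. (\<integral>\<^sup>+y. weight b y * indicator (ball x a) y \<partial>lborel)
    \<le> ennreal (C * a powr (real DIM(real ^ 'n) - b)))"
    using powr_ball_nn_integral[OF b0 bN] ..
  define I where "I = C * R powr (real DIM(real ^ 'n) - b)"
  have I: "0 \<le> I" using CC by (simp add: I_def)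
  have inner: "(\<integral>\<^sup>+y. weight b y * indicator (ball 0 R) (y :: real ^ 'n) \<partial>lborel) \<le> ennreal I"
    unfolding I_def using CC R(1) by blast
  obtain M where M: "0 < M" "I * M powr (- q) \<le> h" using small_powr_exists[OF I q0(1) h] by blast
  define \<eta> where "\<eta> = inverse M"
  have \<eta>: "0 < \<eta>" "0 \<le> \<eta>" using M by (simp_all add: \<eta>_def)
  have \<eta>I: "\<eta> powr q * I \<le> h" using M by (simp add: \<eta>_def powr_minus inverse_powr mult.commute)
  obtain r :: "nat \<Rightarrow> nat" where r: "strict_mono r" "\<forall>i j. \<forall>y\<in>cball 0 R. norm (rconv \<Phi> t (f (r i)) y - rconv \<Phi> t (f (r j)) y) \<le> \<eta>"
    using rconv_uniform_subsequence[of B \<Phi> t p f F0 \<eta> R, OF k t p f \<eta>(1)] by (elim exE conjE) blast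
  have "wenergy b q (\<lambda>y. f (r i) y - f (r j) y) \<le> ennreal \<delta>" for i j
  proof -
    have TT: "wenergy b q (\<lambda>y. T (r i) y - T (r j) y) \<le> ennreal a"
    proof -
      have "wenergy b q (\<lambda>y. T (r i) y - T (r j) y) \<le> ennreal (\<eta> powr q * I + 2 powr q * (h + h))"
        by (rule wenergy_split_le[OF mT mT q0(2) \<eta>(2) _ inner I tail tail])
           (use r(2) h in \<open>simp_all add: T_def\<close>)
      also have "\<dots> \<le> ennreal a"
      proof (rule ennreal_leI)
        have "X * (h + h) \<le> X * (4 * h)" using X h by (intro mult_left_mono) simp_all
        then have "\<eta> powr q * I + X * (h + h) \<le> h * (1 + 4 * X)" using \<eta>I by (simp add: distrib_left mult_ac)
        also have "\<dots> = a" using X by (simp add: h_def add_pos_pos less_imp_neq[symmetric])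
        finally show "\<eta> powr q * I + 2 powr q * (h + h) \<le> a" unfolding X_def .
      qed
      finally show ?thesis .
    qed
    have "wenergy b q (\<lambda>y. T (r i) y - f (r j) y) \<le> ennreal X * (wenergy b q (\<lambda>y. T (r i) y - T (r j) y) + wenergy b q (\<lambda>y. T (r j) y - f (r j) y))"
      unfolding X_def by (rule wenergy_triangle[OF mT mf mT q0(2)])
    also have "\<dots> \<le> ennreal X * (ennreal a + ennreal a)" by (intro mult_left_mono add_mono TT appT) simp
    also have "\<dots> = ennreal (X * (a + a))" using X a by (simp add: ennreal_mult ennreal_plus[symmetric] del: ennreal_plus)
    finally have 2: "wenergy b q (\<lambda>y. T (r i) y - f (r j) y) \<le> ennreal (X * (a + a))" .
    have "wenergy b q (\<lambda>y. f (r i) y - f (r j) y) \<le> ennreal X * (wenergy b q (\<lambda>y. f (r i) y - T (r i) y) + wenergy b q (\<lambda>y. T (r i) y - f (r j) y))"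
      unfolding X_def by (rule wenergy_triangle[OF mf mf mT q0(2)])
    also have "\<dots> \<le> ennreal X * (ennreal a + ennreal (X * (a + a)))" by (intro mult_left_mono add_mono 2 appT') simp
    also have "ennreal a + ennreal (X * (a + a)) = ennreal (a + X * (a + a))"
      by (rule ennreal_plus[symmetric]) (use X a in simp_all)
    also have "ennreal X * \<dots> = ennreal (X * (a + X * (a + a)))"
      by (rule ennreal_mult[symmetric]) (use X a in simp_all)
    also have "X * (a + X * (a + a)) = a * (X * (1 + 2 * X))" by (simp add: algebra_simps)
    also have "\<dots> = \<delta>" using X by (simp add: a_def add_pos_pos less_imp_neq[symmetric])
    finally show ?thesis .
  qed
  with r(1) show ?thesis by (intro exI[of _ r] conjI allI)
qed

text \<open>The tolerances of the diagonal argument are set to (1/2)^(2 q n), so that consecutive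
  members of the diagonal sequence satisfy the hypothesis of \<open>rapid_convergence\<close> with
  ratio 1/2, which also supplies completeness.\<close>

lemma convergent_subsequence:
  fixes f g :: "nat \<Rightarrow> real ^ 'n::finite \<Rightarrow> complex"
  assumes mp: "mollifier_pair TYPE('n) B \<Phi> w" and b: "0 < b" "b < real CARD('n)" and p: "1 < p" and q: "2 \<le> q"
    and \<kappa>: "0 < 2 * q - real CARD('n) * q / 2 + real CARD('n) - b"
    and pq: "p < q * real CARD('n) / (real CARD('n) - b)"
    and f: "\<And>i. Lp_fun p (f i)" "\<And>i. mass p (f i) \<le> F0"
    and g: "\<And>i. Lp_fun 2 (g i)" "\<And>i. mass 2 (g i) \<le> G0" and wl: "\<And>i. weak_lap (f i) (g i)"
  shows "\<exists>r l. strict_mono r \<and> l \<in> borel_measurable borel \<and> (\<lambda>k. wenergy b q (\<lambda>y. f (r k) y - l y)) \<longlonglongrightarrow> 0"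
proof -
  define \<delta> where "\<delta> n = ((1 / 2) ^ n) powr (2 * q)" for n :: nat
  have \<delta>: "0 < \<delta> n" for n by (simp add: \<delta>_def)
  \<comment> \<open>Quantifying over all pairs of indices makes the property inherited by every
    subsequence.\<close>
  define P where "P n s \<longleftrightarrow> (\<forall>i j. wenergy b q (\<lambda>y. f (s i) y - f (s j) y) \<le> ennreal (\<delta> n))" for n :: nat and s :: "nat \<Rightarrow> nat"
  have P_D: "wenergy b q (\<lambda>y. f (s i) y - f (s j) y) \<le> ennreal (\<delta> n)" if "P n s" for n s i j
    using that unfolding P_def by blast
  interpret subseqs P
  proof
    fix n :: nat and s :: "nat \<Rightarrow> nat" assume "strict_mono s"
    obtain r :: "nat \<Rightarrow> nat" where "strict_mono r \<and> (\<forall>i j. wenergy b q (\<lambda>y. f (s (r i)) y - f (s (r j)) y) \<le> ennreal (\<delta> n))"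
      using close_subsequence[of B \<Phi> w b p q "\<lambda>i. f (s i)" F0 "\<lambda>i. g (s i)" G0 "\<delta> n",
        OF mp b p q \<kappa> pq f g wl \<delta>] ..
    then show "\<exists>r'. strict_mono r' \<and> P n (s \<circ> r')" unfolding P_def by auto
  qed
  \<comment> \<open>Property P k is only guaranteed for the diagonal sequence from index
    \<open>Suc k\<close> on, hence the shift.\<close>
  define r where "r k = diagseq (Suc k)" for k
  have sr: "strict_mono r" using subseq_diagseq unfolding r_def strict_mono_def by simp
  define u where "u k = f (r k)" for k
  have hold: "P k (diagseq \<circ> ((+) (Suc k)))" for k
    by (rule diagseq_holds) (simp add: P_def)
  have step: "wenergy b q (\<lambda>y. u k y - u (Suc k) y) \<le> ennreal (1 * ((1 / 2) ^ k) powr (2 * q))" for k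
    using P_D[OF hold[of k], of 0 1] by (simp add: u_def r_def \<delta>_def)
  have mu: "u k \<in> borel_measurable borel" for k using f(1) by (simp add: u_def Lp_fun_def)
  have b0: "0 \<le> b" and q1: "1 \<le> q" using b q by simp_all
  from rapid_convergence[of u b q "1 / 2" 1, OF mu b0 q1 _ _ _ step]
  obtain l where l: "l \<in> borel_measurable borel"
    "\<And>j. wenergy b q (\<lambda>y. u j y - l y) \<le> ennreal ((1 / (1 - 1 / 2)) powr q * (1 / (1 - (1 / 2) powr q)) * 1 * ((1 / 2) ^ j) powr (2 * q))"
    by auto
  define D where "D = (1 / (1 - 1 / 2)) powr q * (1 / (1 - (1 / 2) powr q)) * 1"
  have lim: "(\<lambda>j. ennreal (D * ((1 / 2) ^ j) powr (2 * q))) \<longlonglongrightarrow> ennreal 0"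
  proof (rule tendsto_ennrealI)
    have "(1 / 2 :: real) powr (2 * q) < 1" using q powr_less_mono2[of "2 * q" "1 / 2" 1] by simp
    then have "(\<lambda>j. ((1 / 2 :: real) powr (2 * q)) ^ j) \<longlonglongrightarrow> 0" by (intro LIMSEQ_realpow_zero) simp_all
    moreover have "((1 / 2 :: real) powr (2 * q)) ^ j = ((1 / 2) ^ j) powr (2 * q)" for j
      by (simp add: powr_power powr_realpow[symmetric] powr_powr mult.commute)
    ultimately have "(\<lambda>j. ((1 / 2 :: real) ^ j) powr (2 * q)) \<longlonglongrightarrow> 0" by (simp only:)
    then show "(\<lambda>j. D * ((1 / 2) ^ j) powr (2 * q)) \<longlonglongrightarrow> 0" using tendsto_mult_right_zero by blast
  qed
  have "(\<lambda>k. wenergy b q (\<lambda>y. u k y - l y)) \<longlonglongrightarrow> 0"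
  proof (rule tendsto_sandwich[OF _ _ tendsto_const])
    show "(\<lambda>j. ennreal (D * ((1 / 2) ^ j) powr (2 * q))) \<longlonglongrightarrow> 0" using lim by simp
    show "\<forall>\<^sub>F k in sequentially. wenergy b q (\<lambda>y. u k y - l y) \<le> ennreal (D * ((1 / 2) ^ k) powr (2 * q))"
      unfolding D_def by (intro always_eventually allI l(2))
  qed simp
  with sr l(1) show ?thesis unfolding u_def by blast
qed

text \<open>f is compared with its mollification at scale 1: the difference is controlled by the
  Laplacian, the mollification itself by the L^p norm.\<close>

lemma wenergy_bound:
  assumes mp: "mollifier_pair TYPE('n::finite) B \<Phi> w" and b: "0 < b" "b < real CARD('n)" and p: "1 < p" and q: "2 \<le> q"
    and \<kappa>: "0 < 2 * q - real CARD('n) * q / 2 + real CARD('n) - b"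
    and pq: "p < q * real CARD('n) / (real CARD('n) - b)"
  shows "\<exists>K\<ge>0. \<forall>(f :: real ^ 'n \<Rightarrow> complex) g. Lp_fun p f \<longrightarrow> Lp_fun 2 g \<longrightarrow> weak_lap f g \<longrightarrow>
    wenergy b q f \<le> ennreal (K * (mass 2 g powr (q / 2) + mass p f powr (q / p)))"
proof -
  have k: "profile B \<Phi>" using mp unfolding mollifier_pair_def by blast
  have b0: "0 \<le> b" and q0: "0 < q" "0 \<le> q" using b q by simp_all
  obtain K \<rho> where K: "0 \<le> K" and \<rho>: "0 < \<rho>" "\<rho> < 1"
    and app: "\<forall>(f :: real ^ 'n \<Rightarrow> complex) g. Lp_fun p f \<longrightarrow> Lp_fun 2 g \<longrightarrow> weak_lap f g \<longrightarrow>
    (\<forall>j. wenergy b q (\<lambda>y. rconv \<Phi> (2 ^ j) f y - f y) \<le> ennreal (K * mass 2 g powr (q / 2) * (\<rho> ^ j) powr (2 * q)))"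
    using mollifier_approx[OF mp b0 b(2) p q \<kappa>] by (elim exE conjE) blast
  obtain K1 a1 e1 where ab: "avg_bounds TYPE('n) b q p \<Phi> 1 K1 a1 e1"
    using avg_bounds_exist[OF k b q0(1) p pq zero_less_one] by blast
  then have K1: "0 \<le> K1" unfolding avg_bounds_def by blast
  define X where "X = 2 powr q"
  have X: "0 < X" by (simp add: X_def)
  \<comment> \<open>With R = L = 1 the ball contributes K1 and the exterior 2 K1.\<close>
  define C where "C = X * (K + 3 * K1)"
  have C: "0 \<le> C" using X K K1 by (simp add: C_def)
  have main: "wenergy b q f \<le> ennreal (C * (mass 2 g powr (q / 2) + mass p f powr (q / p)))"
    if f: "Lp_fun p f" and g: "Lp_fun 2 g" and wl: "weak_lap f g" for f g :: "real ^ 'n \<Rightarrow> complex"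
  proof -
    define T where "T = rconv \<Phi> 1 f"
    have mf: "f \<in> borel_measurable borel" using f by (simp add: Lp_fun_def)
    have mT: "T \<in> borel_measurable borel" unfolding T_def by (rule rconv_measurable[OF k mf])
    define F where "F = mass p f powr (q / p)"
    define G where "G = mass 2 g powr (q / 2)"
    have FG: "0 \<le> F" "0 \<le> G" by (simp_all add: F_def G_def)
    have "wenergy b q (\<lambda>y. T y - f y) \<le> ennreal (K * G)"
      using app[rule_format, OF f g wl, of 0] unfolding T_def G_def by simp
    then have 1: "wenergy b q (\<lambda>y. f y - T y) \<le> ennreal (K * G)"
      unfolding wenergy_def by (simp only: norm_minus_commute)
    define v where "v y = weight b y * ennreal (norm (T y) powr q)" for y
    have mv: "v \<in> borel_measurable lborel" unfolding v_def using wenergy_measurable[OF mT] by simp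
    note A = ab[unfolded avg_bounds_def, THEN conjunct2, THEN conjunct2, THEN conjunct2, rule_format, OF f, THEN conjunct2,
        folded T_def, folded v_def, folded F_def]
    have 2: "wenergy b q (\<lambda>y. T y - 0) \<le> ennreal (3 * K1 * F)"
    proof -
      define O' where "O' = {y :: real ^ 'n. 1 \<le> norm y}"
      have mO: "O' \<in> sets lborel" unfolding O'_def sets_lborel
        by (intro borel_closed closed_Collect_le continuous_intros)
      have i1: "(\<integral>\<^sup>+y. v y * indicator (ball 0 1) y \<partial>lborel) \<le> ennreal (K1 * F)"
        using A[THEN conjunct1, rule_format, of 1] by simp
      have i2: "(\<integral>\<^sup>+y. v y * indicator O' y \<partial>lborel) \<le> ennreal (K1 * F * 2)"
        using A[THEN conjunct2, rule_format, of 1 1] unfolding O'_def by simp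
      have "wenergy b q (\<lambda>y. T y - 0) = (\<integral>\<^sup>+y. v y * indicator (ball 0 1) y + v y * indicator O' y \<partial>lborel)"
        unfolding wenergy_def v_def
        by (intro nn_integral_cong) (auto simp: O'_def indicator_def)
      also have "\<dots> = (\<integral>\<^sup>+y. v y * indicator (ball 0 1) y \<partial>lborel) + (\<integral>\<^sup>+y. v y * indicator O' y \<partial>lborel)"
        by (intro nn_integral_add borel_measurable_times_ennreal mv borel_measurable_indicator mO) simp
      also have "\<dots> \<le> ennreal (K1 * F) + ennreal (K1 * F * 2)" by (intro add_mono i1 i2)
      also have "\<dots> = ennreal (K1 * F + K1 * F * 2)" by (rule ennreal_plus[symmetric]) (use K1 FG in simp_all)
      also have "K1 * F + K1 * F * 2 = 3 * K1 * F" by simp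
      finally show ?thesis .
    qed
    have "wenergy b q (\<lambda>y. f y - 0) \<le> ennreal X * (wenergy b q (\<lambda>y. f y - T y) + wenergy b q (\<lambda>y. T y - 0))"
      unfolding X_def by (rule wenergy_triangle[OF mf borel_measurable_const mT q0(2)])
    also have "\<dots> \<le> ennreal X * (ennreal (K * G) + ennreal (3 * K1 * F))" by (intro mult_left_mono add_mono 1 2) simp
    also have "ennreal (K * G) + ennreal (3 * K1 * F) = ennreal (K * G + 3 * K1 * F)"
      by (rule ennreal_plus[symmetric]) (use K K1 FG in simp_all)
    also have "ennreal X * \<dots> = ennreal (X * (K * G + 3 * K1 * F))"
      by (rule ennreal_mult[symmetric]) (use X K K1 FG in simp_all)
    also have "\<dots> \<le> ennreal (C * (G + F))"
    proof (rule ennreal_leI)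
      have "K * G \<le> (K + 3 * K1) * G" using K1 FG by (intro mult_right_mono) simp_all
      moreover have "3 * K1 * F \<le> (K + 3 * K1) * F" using K FG by (intro mult_right_mono) simp_all
      ultimately have "K * G + 3 * K1 * F \<le> (K + 3 * K1) * (G + F)" unfolding distrib_left by linarith
      then have "X * (K * G + 3 * K1 * F) \<le> X * ((K + 3 * K1) * (G + F))" using X by (intro mult_left_mono) simp_all
      then show "X * (K * G + 3 * K1 * F) \<le> C * (G + F)" unfolding C_def by (simp only: mult.assoc)
    qed
    finally show ?thesis unfolding F_def G_def by simp
  qed
  show ?thesis by (rule exI[of _ C], rule conjI[OF C], intro allI impI, rule main)
qed

section \<open>Representatives and weak derivatives\<close>

text \<open>
  The estimates above are for Borel functions, since Tonelli's theorem is applied to the product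
  measure of \<open>lborel\<close> with itself, which is not complete.
\<close>

lemma borel_representative:
  fixes f :: "real ^ 'n::finite \<Rightarrow> complex"
  assumes "f \<in> borel_measurable lebesgue"
  shows "\<exists>f'. f' \<in> borel_measurable borel \<and> (AE x in lborel. f x = f' x)"
proof -
  have re: "(\<lambda>x. Re (f x)) \<in> borel_measurable lebesgue" and im: "(\<lambda>x. Im (f x)) \<in> borel_measurable lebesgue"
    using assms by (simp_all add: borel_measurable_complex_iff)
  obtain r where r: "r \<in> borel_measurable lborel" "AE x in lborel. Re (f x) = r x"
    using completion_ex_borel_measurable_real[OF re] by blast
  obtain i where i: "i \<in> borel_measurable lborel" "AE x in lborel. Im (f x) = i x"
    using completion_ex_borel_measurable_real[OF im] by blast
  have 1: "(\<lambda>x. Complex (r x) (i x)) \<in> borel_measurable borel"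
    using r(1) i(1) by (simp add: borel_measurable_complex_iff)
  have 2: "AE x in lborel. f x = Complex (r x) (i x)"
    using r(2) i(2) by eventually_elim (simp add: complex_eq_iff)
  show ?thesis by (rule exI, rule conjI[OF 1 2])
qed

lemma measurable_lebesgueI:
  fixes f :: "real ^ 'n::finite \<Rightarrow> 'b::topological_space"
  shows "f \<in> borel_measurable borel \<Longrightarrow> f \<in> borel_measurable lebesgue"
  by (rule measurable_completion) (simp only: measurable_lborel2)

text \<open>Integrability on each closed ball makes the truncated function measurable, and f is the
  pointwise limit of its truncations.\<close>

lemma locally_integrable_measurable:
  fixes f :: "real ^ 'n::finite \<Rightarrow> complex"
  assumes "locally_integrable f"
  shows "f \<in> borel_measurable lebesgue"
proof (rule borel_measurable_LIMSEQ_metric)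
  show "(\<lambda>x. indicator (cball 0 (real n)) x *\<^sub>R f x) \<in> borel_measurable lebesgue" for n :: nat
    using assms compact_cball[of "0 :: real ^ 'n" "real n"]
    unfolding locally_integrable_def set_integrable_def by (blast intro: borel_measurable_integrable)
  fix x :: "real ^ 'n"
  obtain n0 :: nat where n0: "norm x \<le> real n0" using real_arch_simple by blast
  have "indicator (cball 0 (real n)) x *\<^sub>R f x = f x" if "n0 \<le> n" for n
    using n0 that by simp
  then show "(\<lambda>n. indicator (cball 0 (real n)) x *\<^sub>R f x) \<longlonglongrightarrow> f x"
    by (intro tendsto_eventually) (auto simp: eventually_sequentially)
qed

lemma locally_integrable_representative:
  fixes f :: "real ^ 'n::finite \<Rightarrow> complex"
  assumes f: "locally_integrable f" and f': "f' \<in> borel_measurable borel" "AE x in lborel. f x = f' x"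
  shows "locint f'"
  unfolding locint_def
proof (intro conjI allI)
  show "f' \<in> borel_measurable borel" by (rule f'(1))
  fix R
  have mi: "(\<lambda>x. indicator (ball 0 R) x *\<^sub>R f' x) \<in> borel_measurable borel"
    using f'(1) by (intro borel_measurable_scaleR borel_measurable_indicator) simp_all
  have "integrable lebesgue (\<lambda>x. indicator (cball 0 R) x *\<^sub>R f x)"
    using f compact_cball[of "0 :: real ^ 'n" R] unfolding locally_integrable_def set_integrable_def by blast
  then have "integrable lebesgue (\<lambda>x. indicator (ball 0 R) x *\<^sub>R f' x)"
  proof (rule Bochner_Integration.integrable_bound)
    show "(\<lambda>x. indicator (ball 0 R) x *\<^sub>R f' x) \<in> borel_measurable lebesgue" by (rule measurable_lebesgueI[OF mi])
    show "AE x in lebesgue. norm (indicator (ball 0 R) x *\<^sub>R f' x) \<le> norm (indicator (cball 0 R) x *\<^sub>R f x)"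
      using AE_completion[OF f'(2)]
    proof eventually_elim
      case (elim x)
      then show ?case by (cases "x \<in> ball 0 R") simp_all
    qed
  qed
  then show "integrable lborel (\<lambda>x. indicator (ball 0 R) x *\<^sub>R f' x)"
    using integrable_completion[of "\<lambda>x. indicator (ball 0 R) x *\<^sub>R f' x" lborel] mi by simp
qed

lemma lebesgue_integral_representative:
  fixes f :: "real ^ 'n::finite \<Rightarrow> complex"
  assumes "\<phi> \<in> borel_measurable borel" "f \<in> borel_measurable lebesgue"
    and f': "f' \<in> borel_measurable borel" "AE x in lborel. f x = f' x"
  shows "(\<integral>x. \<phi> x *\<^sub>R f x \<partial>lebesgue) = (\<integral>x. \<phi> x *\<^sub>R f' x \<partial>lborel)"
proof -
  have m': "(\<lambda>x. \<phi> x *\<^sub>R f' x) \<in> borel_measurable borel"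
    using assms by (intro borel_measurable_scaleR)
  have "(\<integral>x. \<phi> x *\<^sub>R f x \<partial>lebesgue) = (\<integral>x. \<phi> x *\<^sub>R f' x \<partial>lebesgue)"
  proof (rule integral_cong_AE)
    show "(\<lambda>x. \<phi> x *\<^sub>R f x) \<in> borel_measurable lebesgue"
      using measurable_lebesgueI[OF assms(1)] assms(2) by (rule borel_measurable_scaleR)
    show "(\<lambda>x. \<phi> x *\<^sub>R f' x) \<in> borel_measurable lebesgue" by (rule measurable_lebesgueI[OF m'])
    show "AE x in lebesgue. \<phi> x *\<^sub>R f x = \<phi> x *\<^sub>R f' x"
      using AE_completion[OF f'(2)] by eventually_elim simp
  qed
  also have "\<dots> = (\<integral>x. \<phi> x *\<^sub>R f' x \<partial>lborel)" by (rule integral_completion) (use m' in simp)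
  finally show ?thesis .
qed

lemma test_function_partial_deriv:
  fixes \<psi> :: "real ^ 'n::finite \<Rightarrow> real"
  assumes "test_function \<psi>"
  shows "test_function (partial_deriv i \<psi>)"
  unfolding test_function_def
proof (intro conjI allI)
  fix k
  show "C_k k (partial_deriv i \<psi>)" using assms unfolding test_function_def by (metis C_k.simps(2))
next
  define S where "S = closure {x. \<psi> x \<noteq> 0}"
  have S: "compact S" using assms unfolding test_function_def S_def by blast
  have "partial_deriv i \<psi> x = 0" if "x \<notin> S" for x
  proof -
    have "\<psi> z = 0" if "z \<notin> S" for z
      using that subsetD[OF closure_subset, of z "{x. \<psi> x \<noteq> 0}"] unfolding S_def by auto
    then have "(\<psi> has_derivative (\<lambda>_. 0)) (at x)"
      using \<open>x \<notin> S\<close>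
      by (intro has_derivative_transform_within_open[OF has_derivative_const[of 0]
            open_Compl[OF compact_imp_closed[OF S]]]) simp_all
    then show ?thesis by (rule partial_deriv_eq)
  qed
  then have "{x. partial_deriv i \<psi> x \<noteq> 0} \<subseteq> S" by auto
  then have "closure {x. partial_deriv i \<psi> x \<noteq> 0} \<subseteq> S"
    by (intro closure_minimal compact_imp_closed S)
  then show "compact (closure {x. partial_deriv i \<psi> x \<noteq> 0})"
    using compact_Int_closed[OF S, of "closure {x. partial_deriv i \<psi> x \<noteq> 0}"] by (simp add: Int_absorb1)
qed

text \<open>The choice in \<open>weak_deriv2\<close> does not ask for square integrability.
  Uniqueness transfers it from the derivative given by membership in
  \<open>H2dot_Lp\<close>.\<close>

lemma weak_deriv2_unique:
  fixes f g h :: "real ^ 'n::finite \<Rightarrow> complex"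
  assumes g: "has_weak_deriv2 i j f g" and h: "has_weak_deriv2 i j f h"
  shows "AE x in lborel. g x = h x"
proof -
  have lg: "locally_integrable g" "locally_integrable h" using g h unfolding has_weak_deriv2_def by blast+
  note mg = locally_integrable_measurable[OF lg(1)] and mh = locally_integrable_measurable[OF lg(2)]
  obtain g' where g': "g' \<in> borel_measurable borel" "AE x in lborel. g x = g' x"
    using borel_representative[OF mg] by blast
  obtain h' where h': "h' \<in> borel_measurable borel" "AE x in lborel. h x = h' x"
    using borel_representative[OF mh] by blast
  have l: "locint g'" "locint h'"
    by (rule locally_integrable_representative[OF lg(1) g'], rule locally_integrable_representative[OF lg(2) h'])
  have "AE x in lborel. g' x - h' x = 0"
  proof (rule fundamental_lemma[OF locint_diff[OF l]])
    fix \<psi> :: "real ^ 'n \<Rightarrow> real" assume t: "test_function \<psi>"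
    have m\<psi>: "\<psi> \<in> borel_measurable borel"
      using test_function_bounds(1)[OF t] by (rule borel_measurable_continuous_onI)
    obtain M R where M: "\<And>x. \<bar>\<psi> x\<bar> \<le> M * indicator (ball 0 R) x" using test_function_bounds(2)[OF t] by blast
    have "(\<integral>x. \<psi> x *\<^sub>R g x \<partial>lebesgue) = (\<integral>x. \<psi> x *\<^sub>R h x \<partial>lebesgue)"
      using g h t unfolding has_weak_deriv2_def by metis
    then have "(\<integral>x. \<psi> x *\<^sub>R g' x \<partial>lborel) = (\<integral>x. \<psi> x *\<^sub>R h' x \<partial>lborel)"
      by (simp only: lebesgue_integral_representative[OF m\<psi> mg g'] lebesgue_integral_representative[OF m\<psi> mh h'])
    moreover have "integrable lborel (\<lambda>x. \<psi> x *\<^sub>R g' x)" "integrable lborel (\<lambda>x. \<psi> x *\<^sub>R h' x)"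
      by (rule locint_bounded_integrable[OF l(1) m\<psi> M], rule locint_bounded_integrable[OF l(2) m\<psi> M])
    ultimately show "(\<integral>x. \<psi> x *\<^sub>R (g' x - h' x) \<partial>lborel) = 0" by (simp add: scaleR_diff_right)
  qed
  with g'(2) h'(2) show ?thesis by eventually_elim simp
qed

lemma Lp_fun_add:
  assumes q: "0 \<le> q" and "Lp_fun q f" "Lp_fun q g"
  shows "Lp_fun q (\<lambda>x. f x + g x)"
proof -
  have m: "(\<lambda>x. f x + g x) \<in> borel_measurable borel" using assms unfolding Lp_fun_def by (intro borel_measurable_add) blast+
  have "integrable lborel (\<lambda>x. norm (f x + g x) powr q)"
  proof (rule Bochner_Integration.integrable_bound)
    show "integrable lborel (\<lambda>x. 2 powr q * (norm (f x) powr q + norm (g x) powr q))"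
      using assms unfolding Lp_fun_def by (intro integrable_mult_right Bochner_Integration.integrable_add) blast+
    show "(\<lambda>x. norm (f x + g x) powr q) \<in> borel_measurable lborel" using m by measurable
    show "AE x in lborel. norm (norm (f x + g x) powr q) \<le> norm (2 powr q * (norm (f x) powr q + norm (g x) powr q))"
    proof (rule AE_I2)
      fix x
      have "norm (f x + g x) powr q \<le> (norm (f x) + norm (g x)) powr q"
        using q by (intro powr_mono2 norm_triangle_ineq) simp_all
      also have "\<dots> \<le> 2 powr q * (norm (f x) powr q + norm (g x) powr q)" using q by (intro powr_add_le) simp_all
      finally show "norm (norm (f x + g x) powr q) \<le> norm (2 powr q * (norm (f x) powr q + norm (g x) powr q))" by simp
    qed
  qed
  with m show ?thesis unfolding Lp_fun_def by blast
qed

lemma Lp_fun_sum: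
  assumes "0 \<le> q" "finite I" "\<And>i. i \<in> I \<Longrightarrow> Lp_fun q (f i)"
  shows "Lp_fun q (\<lambda>x. \<Sum>i\<in>I. f i x)"
  using assms(2,3)
proof (induction I rule: finite_induct)
  case empty
  show ?case by (simp add: Lp_fun_def)
next
  case (insert i I)
  then show ?case using Lp_fun_add[OF assms(1), of "f i" "\<lambda>x. \<Sum>i\<in>I. f i x"] by simp
qed

lemma Lp_space_representative:
  fixes f :: "real ^ 'n::finite \<Rightarrow> complex"
  assumes f: "f \<in> Lp_space q lebesgue" and f': "f' \<in> borel_measurable borel" "AE x in lborel. f x = f' x"
  shows "Lp_fun q f'"
proof -
  have mp: "(\<lambda>x. norm (f' x) powr q) \<in> borel_measurable borel" using f'(1) by measurable
  have mf: "f \<in> borel_measurable lebesgue" and i: "integrable lebesgue (\<lambda>x. norm (f x) powr q)"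
    using f unfolding Lp_space_def by blast+
  have "integrable lebesgue (\<lambda>x. norm (f' x) powr q)"
  proof (rule integrable_cong_AE_imp[OF i measurable_lebesgueI[OF mp]])
    show "AE x in lebesgue. norm (f x) powr q = norm (f' x) powr q"
      using AE_completion[OF f'(2)] by eventually_elim simp
  qed
  then show ?thesis
    using integrable_completion[of "\<lambda>x. norm (f' x) powr q" lborel] mp f'(1) by (simp add: Lp_fun_def)
qed

lemma Lp_norm_representative:
  fixes f :: "real ^ 'n::finite \<Rightarrow> complex"
  assumes f: "f \<in> borel_measurable lebesgue" and f': "f' \<in> borel_measurable borel" "AE x in lborel. f x = f' x"
  shows "Lp_norm q lebesgue f = mass q f' powr (1 / q)"
proof -
  have mp: "(\<lambda>x. norm (f' x) powr q) \<in> borel_measurable borel" using f'(1) by measurable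
  have mp': "(\<lambda>x. norm (f x) powr q) \<in> borel_measurable lebesgue" using f by measurable
  have "(\<integral>x. norm (f x) powr q \<partial>lebesgue) = (\<integral>x. norm (f' x) powr q \<partial>lebesgue)"
  proof (rule integral_cong_AE[OF mp' measurable_lebesgueI[OF mp]])
    show "AE x in lebesgue. norm (f x) powr q = norm (f' x) powr q"
      using AE_completion[OF f'(2)] by eventually_elim simp
  qed
  also have "\<dots> = mass q f'" unfolding mass_def by (rule integral_completion) (use mp in simp)
  finally show ?thesis unfolding Lp_norm_def by simp
qed

text \<open>The passage from the stated space to the Borel setting: g is the sum of Borel
  representatives of the pure second derivatives, and it agrees almost everywhere with the chosen
  Laplacian, so the norm is unchanged.\<close>

lemma H2dot_Lp_representative:
  fixes f :: "real ^ 'n::finite \<Rightarrow> complex"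
  assumes p: "1 < p" and f: "f \<in> H2dot_Lp p"
  shows "\<exists>f' g. Lp_fun p f' \<and> Lp_fun 2 g \<and> weak_lap f' g \<and> (AE x in lborel. f x = f' x) \<and>
    H2dot_Lp_norm p f = mass 2 g powr (1 / 2) + mass p f' powr (1 / p)"
proof -
  have fp: "f \<in> Lp_space p lebesgue" and ex: "\<And>i. \<exists>g. has_weak_deriv2 i i f g \<and> g \<in> Lp_space 2 lebesgue"
    using f unfolding H2dot_Lp_def by blast+
  have mf: "f \<in> borel_measurable lebesgue" using fp unfolding Lp_space_def by blast
  obtain f' where f': "f' \<in> borel_measurable borel" "AE x in lborel. f x = f' x"
    using borel_representative[OF mf] by blast
  obtain h where h: "\<And>i. has_weak_deriv2 i i f (h i)" "\<And>i. h i \<in> Lp_space 2 lebesgue" using ex by metis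
  have mh: "h i \<in> borel_measurable lebesgue" for i using h(2) unfolding Lp_space_def by blast
  have "\<exists>h'. h' \<in> borel_measurable borel \<and> (AE x in lborel. h i x = h' x)" for i
    by (rule borel_representative[OF mh])
  then obtain h' where h': "\<And>i. h' i \<in> borel_measurable borel" "\<And>i. AE x in lborel. h i x = h' i x" by metis
  have lf: "Lp_fun p f'" by (rule Lp_space_representative[OF fp f'])
  have lh: "Lp_fun 2 (h' i)" for i by (rule Lp_space_representative[OF h(2) h'])
  define g where "g x = (\<Sum>i\<in>UNIV. h' i x)" for x
  have lg: "Lp_fun 2 g" unfolding g_def by (rule Lp_fun_sum) (simp_all add: lh)
  have locf: "locint f'" using Lp_fun_locint[OF _ lf] p by simp
  have loch: "locint (h' i)" for i using Lp_fun_locint[OF _ lh] by simp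
  have wd: "has_weak_deriv2 i i f (weak_deriv2 i i f)" for i
    unfolding weak_deriv2_def by (rule someI[of "has_weak_deriv2 i i f", OF h(1)])
  have "AE x in lborel. \<forall>i\<in>UNIV. weak_deriv2 i i f x = h' i x"
  proof (rule AE_finite_allI)
    fix i :: 'n
    show "AE x in lborel. weak_deriv2 i i f x = h' i x"
      using weak_deriv2_unique[OF wd[of i] h(1)[of i]] h'(2)[of i] by eventually_elim simp
  qed simp
  then have lap: "AE x in lborel. weak_laplacian f x = g x"
    by eventually_elim (simp add: weak_laplacian_def g_def)
  have mlap: "weak_laplacian f \<in> borel_measurable lebesgue"
  proof -
    have "weak_deriv2 i i f \<in> borel_measurable lebesgue" for i
      using wd[of i] unfolding has_weak_deriv2_def by (intro locally_integrable_measurable) blast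
    then have "(\<lambda>x. \<Sum>i\<in>UNIV. weak_deriv2 i i f x) \<in> borel_measurable lebesgue"
      by (intro borel_measurable_sum)
    then show ?thesis unfolding weak_laplacian_def[abs_def] .
  qed
  have mg: "g \<in> borel_measurable borel" using lg by (simp add: Lp_fun_def)
  have wl: "weak_lap f' g"
    unfolding weak_lap_def
  proof (intro allI impI)
    fix \<psi> :: "real ^ 'n \<Rightarrow> real" assume t: "test_function \<psi>"
    define d where "d i = partial_deriv i (partial_deriv i \<psi>)" for i
    have td: "test_function (d i)" for i unfolding d_def by (intro test_function_partial_deriv t)
    have int: "integrable lborel (\<lambda>x. \<phi> x *\<^sub>R F x)" and mt: "\<phi> \<in> borel_measurable borel"
      if tt: "test_function \<phi>" and lF: "locint F" for \<phi> and F :: "real ^ 'n \<Rightarrow> complex"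
    proof -
      show m: "\<phi> \<in> borel_measurable borel"
        using test_function_bounds(1)[OF tt] by (rule borel_measurable_continuous_onI)
      obtain M R where M: "\<And>x. \<bar>\<phi> x\<bar> \<le> M * indicator (ball 0 R) x" using test_function_bounds(2)[OF tt] by blast
      show "integrable lborel (\<lambda>x. \<phi> x *\<^sub>R F x)" by (rule locint_bounded_integrable[OF lF m M])
    qed
    have eq: "(\<integral>x. d i x *\<^sub>R f' x \<partial>lborel) = (\<integral>x. \<psi> x *\<^sub>R h' i x \<partial>lborel)" for i
    proof -
      have "(\<integral>x. d i x *\<^sub>R f x \<partial>lebesgue) = (\<integral>x. \<psi> x *\<^sub>R h i x \<partial>lebesgue)"
        using h(1)[of i] t unfolding has_weak_deriv2_def d_def by blast
      then show ?thesis
        by (simp only: lebesgue_integral_representative[OF mt[OF td locf] mf f']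
            lebesgue_integral_representative[OF mt[OF t locf] mh h'])
    qed
    have "(\<integral>x. (\<Sum>i\<in>UNIV. d i x) *\<^sub>R f' x \<partial>lborel) = (\<integral>x. (\<Sum>i\<in>UNIV. d i x *\<^sub>R f' x) \<partial>lborel)"
      by (simp only: scaleR_sum_left)
    also have "\<dots> = (\<Sum>i\<in>UNIV. \<integral>x. d i x *\<^sub>R f' x \<partial>lborel)"
      by (rule Bochner_Integration.integral_sum) (rule int[OF td locf])
    also have "\<dots> = (\<Sum>i\<in>UNIV. \<integral>x. \<psi> x *\<^sub>R h' i x \<partial>lborel)" by (simp only: eq)
    also have "\<dots> = (\<integral>x. (\<Sum>i\<in>UNIV. \<psi> x *\<^sub>R h' i x) \<partial>lborel)"
      by (rule Bochner_Integration.integral_sum[symmetric]) (rule int[OF t loch])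
    also have "\<dots> = (\<integral>x. \<psi> x *\<^sub>R g x \<partial>lborel)" by (simp only: g_def scaleR_sum_right)
    finally show "(\<integral>x. (\<Sum>i\<in>UNIV. partial_deriv i (partial_deriv i \<psi>) x) *\<^sub>R f' x \<partial>lborel) = (\<integral>x. \<psi> x *\<^sub>R g x \<partial>lborel)"
      unfolding d_def .
  qed
  have "H2dot_Lp_norm p f = mass 2 g powr (1 / 2) + mass p f' powr (1 / p)"
    unfolding H2dot_Lp_norm_def Lp_norm_representative[OF mf f'] Lp_norm_representative[OF mlap mg lap] ..
  with lf lg wl f'(2) show ?thesis by (intro exI[of _ f'] exI[of _ g] conjI)
qed

section \<open>The weighted Lebesgue space in terms of the weighted energy\<close>

lemma weighted_nn_integral:
  fixes u :: "real ^ 'n::finite \<Rightarrow> complex"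
  assumes u: "u \<in> borel_measurable lebesgue" and u': "AE x in lborel. u x = u' x"
  shows "(\<integral>\<^sup>+x. ennreal (norm (u x) powr q) \<partial>weighted_lebesgue b) = wenergy b q u'"
proof -
  have mw: "(\<lambda>x :: real ^ 'n. weight b x) \<in> borel_measurable lebesgue"
    by (rule measurable_lebesgueI[OF weight_measurable])
  have mu: "(\<lambda>x. ennreal (norm (u x) powr q)) \<in> borel_measurable lebesgue" using u by measurable
  have "(\<integral>\<^sup>+x. ennreal (norm (u x) powr q) \<partial>weighted_lebesgue b)
      = (\<integral>\<^sup>+x. weight b x * ennreal (norm (u x) powr q) \<partial>lebesgue)"
    unfolding weighted_lebesgue_def by (rule nn_integral_density[OF mw mu])
  also have "\<dots> = (\<integral>\<^sup>+x. weight b x * ennreal (norm (u x) powr q) \<partial>lborel)"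
    by (rule nn_integral_completion)
  also have "\<dots> = wenergy b q u'"
    unfolding wenergy_def
  proof (rule nn_integral_cong_AE)
    show "AE x in lborel. weight b x * ennreal (norm (u x) powr q) = weight b x * ennreal (norm (u' x) powr q)"
      using u' by eventually_elim simp
  qed
  finally show ?thesis .
qed

lemma weighted_measurable:
  "borel_measurable (weighted_lebesgue b) = (borel_measurable lebesgue :: (real ^ 'n::finite \<Rightarrow> 'b::topological_space) set)"
  unfolding weighted_lebesgue_def by (rule measurable_density_eq2 measurable_cong_sets; simp)

lemma weighted_Lp_norm:
  fixes u :: "real ^ 'n::finite \<Rightarrow> complex"
  assumes u: "u \<in> borel_measurable lebesgue" and u': "AE x in lborel. u x = u' x"
  shows "Lp_norm q (weighted_lebesgue b) u = enn2real (wenergy b q u') powr (1 / q)"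
proof -
  have "(\<lambda>x. norm (u x) powr q) \<in> borel_measurable lebesgue" using u by measurable
  then have m: "(\<lambda>x. norm (u x) powr q) \<in> borel_measurable (weighted_lebesgue b)"
    unfolding weighted_measurable .
  have "(\<integral>x. norm (u x) powr q \<partial>weighted_lebesgue b) = enn2real (wenergy b q u')"
    unfolding weighted_nn_integral[OF u u', symmetric]
    by (rule integral_eq_nn_integral[OF m]) simp
  then show ?thesis unfolding Lp_norm_def by simp
qed

lemma weighted_Lp_space:
  fixes u :: "real ^ 'n::finite \<Rightarrow> complex"
  assumes u: "u \<in> borel_measurable lebesgue" and u': "AE x in lborel. u x = u' x"
    and fin: "wenergy b q u' < \<infinity>"
  shows "u \<in> Lp_space q (weighted_lebesgue b)"
proof -
  have "(\<lambda>x. norm (u x) powr q) \<in> borel_measurable lebesgue" using u by measurable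
  then have m: "(\<lambda>x. norm (u x) powr q) \<in> borel_measurable (weighted_lebesgue b)"
    unfolding weighted_measurable .
  have "integrable (weighted_lebesgue b) (\<lambda>x. norm (u x) powr q)"
    by (rule integrableI_nonneg[OF m]) (use fin weighted_nn_integral[OF u u'] in simp_all)
  with u show ?thesis unfolding Lp_space_def weighted_measurable by blast
qed

text \<open>The expression equals 4 - b - \<sigma> (N - 4). For N \<ge> 5 its positivity is the
  bound \<sigma> < (4 - b) / (N - 4); for smaller N the last term has a favourable sign and b < 4
  suffices.\<close>

lemma subcritical_exponent:
  fixes b \<sigma> :: real
  assumes b: "b < min (real N) 4" and \<sigma>: "0 < \<sigma>" "ereal \<sigma> < four_star N b"
  shows "0 < 2 * (2 * \<sigma> + 2) - real N * (2 * \<sigma> + 2) / 2 + real N - b"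
proof -
  have "2 * (2 * \<sigma> + 2) - real N * (2 * \<sigma> + 2) / 2 + real N - b = 4 - b - \<sigma> * (real N - 4)"
    by (simp add: algebra_simps)
  moreover have "\<sigma> * (real N - 4) < 4 - b"
  proof (cases "N \<ge> 5")
    case True
    then have "\<sigma> < (4 - b) / (real N - 4)" using \<sigma>(2) by (simp add: four_star_def)
    then show ?thesis using True by (simp add: less_divide_eq)
  next
    case False
    then have "\<sigma> * (real N - 4) \<le> 0" using \<sigma>(1) by (intro mult_nonneg_nonpos) simp_all
    then show ?thesis using b by simp
  qed
  ultimately show ?thesis by linarith
qed

theorem proposition4p2:
  fixes b \<sigma> p :: real
  assumes "0 < b" and "b < min (real CARD('n::finite)) 4"
    and "0 < \<sigma>" and "ereal \<sigma> < four_star CARD('n) b"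
    and "1 < p" and "p < (2 * \<sigma> + 2) * real CARD('n) / (real CARD('n) - b)"
  shows "compact_embedding
           (H2dot_Lp p :: (real ^ 'n \<Rightarrow> complex) set) (H2dot_Lp_norm p)
           (Lp_space (2 * \<sigma> + 2) (weighted_lebesgue b))
           (Lp_norm (2 * \<sigma> + 2) (weighted_lebesgue b))"
proof -
  define q where "q = 2 * \<sigma> + 2"
  have b: "0 < b" "b < real CARD('n)" using assms by simp_all
  have q: "2 \<le> q" "0 < q" "0 \<le> q" using assms(3) by (simp_all add: q_def)
  have \<kappa>: "0 < 2 * q - real CARD('n) * q / 2 + real CARD('n) - b"
    unfolding q_def by (rule subcritical_exponent[OF assms(2-4)])
  have pq: "p < q * real CARD('n) / (real CARD('n) - b)" unfolding q_def by (rule assms(6))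
  have p: "1 < p" "0 < p" using assms(5) by simp_all
  obtain B \<Phi> w where mp: "mollifier_pair TYPE('n) B \<Phi> w" using mollifier_pair_exists by blast
  define X where "X = (H2dot_Lp p :: (real ^ 'n \<Rightarrow> complex) set)"
  define N where "N g = mass 2 g powr (1 / 2)" for g :: "real ^ 'n \<Rightarrow> complex"
  define P where "P f = mass p f powr (1 / p)" for f :: "real ^ 'n \<Rightarrow> complex"
  have mX: "f \<in> borel_measurable lebesgue" if "f \<in> X" for f
    using that unfolding X_def H2dot_Lp_def Lp_space_def by blast
  have NP: "0 \<le> N g" "0 \<le> P f" for g f by (simp_all add: N_def P_def)
  have Npow: "mass 2 g powr (q / 2) = N g powr q" "mass p f powr (q / p) = P f powr q"
    "mass 2 g = N g powr 2" "mass p f = P f powr p" for g f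
    using p mass_nonneg[of 2 g] mass_nonneg[of p f] by (simp_all add: N_def P_def powr_powr)
  define Q where "Q f f' g \<longleftrightarrow> Lp_fun p f' \<and> Lp_fun 2 g \<and> weak_lap f' g \<and> (AE x in lborel. f x = f' x) \<and>
      H2dot_Lp_norm p f = N g + P f'" for f f' g :: "real ^ 'n \<Rightarrow> complex"
  \<comment> \<open>Fixed choices of a Borel representative of f and of its Laplacian, so that
    sequences can be transferred term by term.\<close>
  define r where "r f = (SOME f'. \<exists>g. Q f f' g)" for f
  define s where "s f = (SOME g. Q f (r f) g)" for f
  have "Q f (r f) (s f)" if "f \<in> X" for f
  proof -
    have "\<exists>f' g. Q f f' g"
      unfolding Q_def N_def P_def by (rule H2dot_Lp_representative[OF p(1) that[unfolded X_def]])
    then have "\<exists>g. Q f (r f) g" unfolding r_def by (rule someI_ex)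
    then show ?thesis unfolding s_def by (rule someI_ex)
  qed
  then have rs: "\<And>f. f \<in> X \<Longrightarrow> Lp_fun p (r f)" "\<And>f. f \<in> X \<Longrightarrow> Lp_fun 2 (s f)"
    "\<And>f. f \<in> X \<Longrightarrow> weak_lap (r f) (s f)" "\<And>f. f \<in> X \<Longrightarrow> (AE x in lborel. f x = r f x)"
    "\<And>f. f \<in> X \<Longrightarrow> H2dot_Lp_norm p f = N (s f) + P (r f)"
    unfolding Q_def by blast+
  obtain K where K: "0 \<le> K" and Kb: "\<forall>(f :: real ^ 'n \<Rightarrow> complex) g. Lp_fun p f \<longrightarrow> Lp_fun 2 g \<longrightarrow> weak_lap f g \<longrightarrow>
    wenergy b q f \<le> ennreal (K * (mass 2 g powr (q / 2) + mass p f powr (q / p)))"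
    using wenergy_bound[OF mp b p(1) q(1) \<kappa> pq] by (elim exE conjE) blast
  \<comment> \<open>The two parts of the norm enter with different roots of masses, but both with
    power q, so each is at most the q-th power of their sum; hence the factor 2.\<close>
  have energy: "wenergy b q (r f) \<le> ennreal (2 * K * H2dot_Lp_norm p f powr q)" if f: "f \<in> X" for f
  proof -
    have "N (s f) powr q \<le> (N (s f) + P (r f)) powr q" "P (r f) powr q \<le> (N (s f) + P (r f)) powr q"
      using NP q by (auto intro!: powr_mono2)
    then have "K * (N (s f) powr q + P (r f) powr q) \<le> K * (2 * (N (s f) + P (r f)) powr q)"
      using K by (intro mult_left_mono) simp_all
    then have "ennreal (K * (N (s f) powr q + P (r f) powr q)) \<le> ennreal (2 * K * H2dot_Lp_norm p f powr q)"
      unfolding rs(5)[OF f] by (intro ennreal_leI) (simp only: mult_ac)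
    with Kb[rule_format, OF rs(1-3)[OF f]] show ?thesis unfolding Npow(1,2) by (rule order_trans)
  qed
  have fin: "wenergy b q (r f) < \<infinity>" if "f \<in> X" for f
    using le_less_trans[OF energy[OF that] ennreal_less_top] by simp
  show ?thesis
    unfolding compact_embedding_def q_def[symmetric] X_def[symmetric]
  proof (intro conjI allI impI)
    show "X \<subseteq> Lp_space q (weighted_lebesgue b)"
      using weighted_Lp_space[OF mX rs(4) fin] by blast
    show "\<exists>C. \<forall>f\<in>X. Lp_norm q (weighted_lebesgue b) f \<le> C * H2dot_Lp_norm p f"
    proof (intro exI ballI)
      fix f assume f: "f \<in> X"
      have H: "0 \<le> H2dot_Lp_norm p f" unfolding rs(5)[OF f] using NP by simp
      have "enn2real (wenergy b q (r f)) \<le> 2 * K * H2dot_Lp_norm p f powr q"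
        by (rule enn2real_leI[OF _ energy[OF f]]) (use K in simp)
      then have "enn2real (wenergy b q (r f)) powr (1 / q) \<le> (2 * K * H2dot_Lp_norm p f powr q) powr (1 / q)"
        using q by (intro powr_mono2) simp_all
      also have "\<dots> = (2 * K) powr (1 / q) * H2dot_Lp_norm p f"
        using H q by (simp add: powr_mult powr_powr)
      finally show "Lp_norm q (weighted_lebesgue b) f \<le> (2 * K) powr (1 / q) * H2dot_Lp_norm p f"
        unfolding weighted_Lp_norm[OF mX[OF f] rs(4)[OF f]] .
    qed
    fix u :: "nat \<Rightarrow> real ^ 'n \<Rightarrow> complex"
    assume "(\<forall>n. u n \<in> X) \<and> (\<exists>B. \<forall>n. H2dot_Lp_norm p (u n) \<le> B)"
    then obtain A where u: "\<And>n. u n \<in> X" and A: "\<And>n. H2dot_Lp_norm p (u n) \<le> A" by blast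
    have NA: "N (s (u n)) \<le> A" "P (r (u n)) \<le> A" for n
      using A[of n] NP(1)[of "s (u n)"] NP(2)[of "r (u n)"] unfolding rs(5)[OF u] by linarith+
    have ma: "mass p (r (u n)) \<le> A powr p" "mass 2 (s (u n)) \<le> A powr 2" for n
      unfolding Npow(3,4)
      by (intro powr_mono2 NA NP, use p in simp) (intro powr_mono2 NA NP, simp)
    obtain k l where kl: "strict_mono k" "l \<in> borel_measurable borel"
      "(\<lambda>n. wenergy b q (\<lambda>y. r (u (k n)) y - l y)) \<longlonglongrightarrow> 0"
      using convergent_subsequence[of B \<Phi> w b p q "\<lambda>n. r (u n)" "A powr p" "\<lambda>n. s (u n)" "A powr 2",
        OF mp b p(1) q(1) \<kappa> pq rs(1)[OF u] ma(1) rs(2)[OF u] ma(2) rs(3)[OF u]] by blast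
    have ml: "l \<in> borel_measurable lebesgue" by (rule measurable_lebesgueI[OF kl(2)])
    have mr: "r (u n) \<in> borel_measurable borel" for n using rs(1)[OF u] by (simp add: Lp_fun_def)
    \<comment> \<open>The limit inherits finite energy from one member of the sequence at energy
      distance below 1.\<close>
    have "\<forall>\<^sub>F n in sequentially. wenergy b q (\<lambda>y. r (u (k n)) y - l y) < 1"
      by (rule order_tendstoD(2)[OF kl(3)]) simp
    then obtain n where n: "wenergy b q (\<lambda>y. r (u (k n)) y - l y) < 1"
      by (auto simp: eventually_sequentially)
    have "wenergy b q (\<lambda>y. l y - 0) \<le> ennreal (2 powr q) * (wenergy b q (\<lambda>y. l y - r (u (k n)) y) + wenergy b q (\<lambda>y. r (u (k n)) y - 0))"
      by (rule wenergy_triangle[OF kl(2) borel_measurable_const mr q(3)])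
    also have "wenergy b q (\<lambda>y. l y - r (u (k n)) y) = wenergy b q (\<lambda>y. r (u (k n)) y - l y)"
      unfolding wenergy_def by (simp only: norm_minus_commute)
    also have "ennreal (2 powr q) * (wenergy b q (\<lambda>y. r (u (k n)) y - l y) + wenergy b q (\<lambda>y. r (u (k n)) y - 0)) < \<infinity>"
      using less_trans[OF n, of \<infinity>] fin[OF u, of "k n"] by (simp add: ennreal_mult_less_top)
    finally have finl: "wenergy b q l < \<infinity>" by simp
    show "\<exists>ra v. strict_mono ra \<and> v \<in> Lp_space q (weighted_lebesgue b) \<and>
        (\<lambda>n. Lp_norm q (weighted_lebesgue b) (\<lambda>x. u (ra n) x - v x)) \<longlonglongrightarrow> 0"
    proof (intro exI conjI)
      show "strict_mono k" by (rule kl(1))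
      show "l \<in> Lp_space q (weighted_lebesgue b)" by (rule weighted_Lp_space[OF ml _ finl]) simp
      have eq: "Lp_norm q (weighted_lebesgue b) (\<lambda>x. u (k n) x - l x)
          = enn2real (wenergy b q (\<lambda>y. r (u (k n)) y - l y)) powr (1 / q)" for n
      proof (rule weighted_Lp_norm)
        show "(\<lambda>x. u (k n) x - l x) \<in> borel_measurable lebesgue"
          by (rule borel_measurable_diff[OF mX[OF u] ml])
        show "AE x in lborel. u (k n) x - l x = r (u (k n)) x - l x"
          using rs(4)[OF u, of "k n"] by eventually_elim simp
      qed
      have "(\<lambda>n. enn2real (wenergy b q (\<lambda>y. r (u (k n)) y - l y))) \<longlonglongrightarrow> 0"
        by (rule tendsto_enn2real) (use kl(3) in simp_all)
      then show "(\<lambda>n. Lp_norm q (weighted_lebesgue b) (\<lambda>x. u (k n) x - l x)) \<longlonglongrightarrow> 0"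
        unfolding eq using q by (intro tendsto_zero_powrI[OF _ tendsto_const]) simp_all
    qed
  qed
qed

end
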